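(* Consider the generalized censored block model with homogeneity measurements, with edge size $d$, two groups and noise parameter $\theta\in(0,1/2)$. Let $\epsilon>0$ be any constant. If $$\binom{n}{d}\alpha_n\ \ge\ (1+\epsilon)\,\frac{2^{d-2}}{d}\,\frac{n\log n}{(\sqrt{1-\theta}-\sqrt{\theta})^2},$$ then the algorithm HSCLR, adapted to this model as described in the context, is strongly consistent for any given hidden partition $\Psi$. (That is, HSCLR achieves the information-theoretic limit for strong consistency in this model.)
   Context: Model. $d\ge2$ and $\theta\in(0,1/2)$ are fixed, $k=2$, $n\to\infty$, $\log$ is natural. Nodes are $[n]$, $\mathcal{E}=\binom{[n]}{d}$. A hidden partition is $\Psi:[n]\to\{0,1\}$, with both group sizes linear in $n$. An edge is homogeneous if $\Psi$ is constant on it, heterogeneous otherwise. The observations $W_e\in\{0,1,\mathsf{x}\}$ ($\mathsf{x}$ denotes erasure), $e\in\mathcal{E}$, are independent: if $e$ is homogeneous, $W_e=1$ w.p. $\alpha_n(1-\theta)$, $W_e=0$ w.p. $\alpha_n\theta$, $W_e=\mathsf{x}$ w.p. $1-\alpha_n$; if $e$ is heterogeneous, $W_e=1$ w.p. $\alpha_n\theta$, $W_e=0$ w.p. $\alpha_n(1-\theta)$, $W_e=\mathsf{x}$ w.p. $1-\alpha_n$. The information-theoretic limit (known): the maximum likelihood estimator is strongly consistent for any hidden partition under the displayed condition, whereas no algorithm is strongly consistent for any given hidden partition if $\binom{n}{d}\alpha_n\le(1-\epsilon)\frac{2^{d-2}}{d}\frac{n\log n}{(\sqrt{1-\theta}-\sqrt\theta)^2}$.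 Strong consistency. $\Phi$ is strongly consistent if $\lim_{n\to\infty}\Pr(\mathrm{err}(\Phi)=0)=1$, where $\mathrm{err}(\Phi)=\frac1n\min_\Pi|\{i:\Psi(i)\neq\Pi(\Phi(i))\}|$, the minimum over the two permutations $\Pi$ of the label set. Algorithm HSC (input: a family of weights $\{W_e\}$ and $k$). (1) Compute $\mathbf{A}\in\mathbb{R}^{n\times n}$: $\mathbf{A}_{ij}=\sum_{e:\{i,j\}\subset e}W_e$ for $i\ne j$ (sum over the edges in the input), $\mathbf{A}_{ii}=0$. (2) Obtain $\mathbf{A}^0$ from $\mathbf{A}$ by zeroing out row $i$ and column $i$ for every $i$ with $\sum_j\mathbf{A}_{ij}>c_{\mathrm{thr}}\frac1n\sum_{i',j'}\mathbf{A}_{i'j'}$, where $c_{\mathrm{thr}}>0$ is a suitable constant depending only on $d$. (3) Let $\mathbf{U}^0\in\mathbb{R}^{n\times k}$ have as columns the (orthonormal) eigenvectors of $\mathbf{A}^0$ for its $k$ largest eigenvalues, and cluster the rows of $\mathbf{U}^0$ by a $(1+\epsilon')$-approximate solution $\Phi$ of the $k$-means problem ($\epsilon'>0$ a fixed constant), i.e. $\mathrm{cost}(\Phi)\le(1+\epsilon')\min_{\Phi'}\mathrm{cost}(\Phi')$, $\mathrm{cost}(\Phi)=\sum_{j}\sum_{i\in\Phi^{-1}(j)}\big\|\mathbf{U}^0_{i*}-\frac{1}{|\Phi^{-1}(j)|}\sum_{\ell\in\Phi^{-1}(j)}\mathbf{U}^0_{\ell *}\big\|^2$. Adapted HSCLR.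 (1) Split $\mathcal{E}=\mathcal{E}_1\sqcup\mathcal{E}_2$ at random, each edge being put in $\mathcal{E}_1$ independently with probability $\beta=\frac{\log\log n}{\log n}$. (2) Let $W'_e=W_e$ if $W_e\neq\mathsf{x}$ and $W'_e=0$ otherwise; apply HSC with $k=2$ to $\{W'_e\}_{e\in\mathcal{E}_1}$ and represent the output by $\mathbf{X}\in\{0,1\}^n$. (3) Likelihood-based refinement: for $\mathbf{V}\in\{0,1\}^n$ and $e\in\mathcal{E}$ let $f_e(\mathbf{V})=1$ if $\mathbf{V}$ is constant on $e$ and $0$ otherwise, and let $\mathsf{d}(\mathbf{V})=|\{e\in\mathcal{E}_2:W_e\neq f_e(\mathbf{V})\}|$. For every $i\in[n]$, the output at node $i$ is $\mathbf{X}_i$ if $\mathsf{d}(\mathbf{X})<\mathsf{d}(\mathbf{X}\oplus\mathbf{e}_i)$ and $\mathbf{X}_i\oplus1$ otherwise, where $\mathbf{e}_i$ is the $i$-th unit vector and $\oplus$ is addition mod 2. *)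

theory Defs
  imports
    "HOL-Probability.Probability"
    "HOL-Combinatorics.Permutations"
    "HOL-Library.Landau_Symbols"
    "HOL-Library.Monad_Syntax"
    "Jordan_Normal_Form.Char_Poly"
begin

text \<open>Nodes are \<open>{..<n}\<close>; group labels are the natural numbers \<open>0, 1\<close>.\<close>

definition edges :: "nat \<Rightarrow> nat \<Rightarrow> nat set set" where
  "edges n d = {e. e \<subseteq> {..<n} \<and> card e = d}"

definition hidden_partitions :: "(nat \<Rightarrow> nat \<Rightarrow> nat) \<Rightarrow> bool" where
  "hidden_partitions \<Psi> \<longleftrightarrow>
     (\<forall>n. \<Psi> n \<in> {..<n} \<rightarrow> {0, 1}) \<and>
     (\<forall>b\<in>{0, 1}. (\<lambda>n. real (card {i\<in>{..<n}. \<Psi> n i = b})) \<in> \<Theta>(\<lambda>n. real n))"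


section \<open>The model\<close>

text \<open>An observation is \<open>Some 0\<close>, \<open>Some 1\<close> or the erasure symbol \<open>None\<close>.\<close>

definition measurement_pmf :: "real \<Rightarrow> real \<Rightarrow> (nat \<Rightarrow> nat) \<Rightarrow> nat set \<Rightarrow> nat option pmf" where
  "measurement_pmf \<theta> a \<Psi> e =
     (if \<Psi> constant_on e
      then pmf_of_list [(Some 1, a * (1 - \<theta>)), (Some 0, a * \<theta>), (None, 1 - a)]
      else pmf_of_list [(Some 1, a * \<theta>), (Some 0, a * (1 - \<theta>)), (None, 1 - a)])"

lemma pmf_measurement_pmf:
  assumes "0 \<le> \<theta>" "\<theta> \<le> 1" "0 \<le> a" "a \<le> 1"
  shows "pmf (measurement_pmf \<theta> a \<Psi> e) (Some 1) = (if \<Psi> constant_on e then a * (1 - \<theta>) else a * \<theta>)"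
    and "pmf (measurement_pmf \<theta> a \<Psi> e) (Some 0) = (if \<Psi> constant_on e then a * \<theta> else a * (1 - \<theta>))"
    and "pmf (measurement_pmf \<theta> a \<Psi> e) None = 1 - a"
proof -
  have "pmf_of_list_wf [(Some (1::nat), a * (1 - \<theta>)), (Some 0, a * \<theta>), (None, 1 - a)]"
       "pmf_of_list_wf [(Some (1::nat), a * \<theta>), (Some 0, a * (1 - \<theta>)), (None, 1 - a)]"
    using assms by (auto simp: pmf_of_list_wf_def algebra_simps mult_left_le_one_le)
  then show "pmf (measurement_pmf \<theta> a \<Psi> e) (Some 1) = (if \<Psi> constant_on e then a * (1 - \<theta>) else a * \<theta>)"
    and "pmf (measurement_pmf \<theta> a \<Psi> e) (Some 0) = (if \<Psi> constant_on e then a * \<theta> else a * (1 - \<theta>))"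
    and "pmf (measurement_pmf \<theta> a \<Psi> e) None = 1 - a"
    by (auto simp: measurement_pmf_def pmf_pmf_of_list)
qed

text \<open>The observations of all edges are independent; the value off \<open>edges n d\<close> is a dummy.\<close>

definition gcbm :: "nat \<Rightarrow> nat \<Rightarrow> real \<Rightarrow> real \<Rightarrow> (nat \<Rightarrow> nat) \<Rightarrow> (nat set \<Rightarrow> nat option) pmf" where
  "gcbm n d \<theta> a \<Psi> = Pi_pmf (edges n d) None (measurement_pmf \<theta> a \<Psi>)"

definition err :: "nat \<Rightarrow> (nat \<Rightarrow> nat) \<Rightarrow> (nat \<Rightarrow> nat) \<Rightarrow> real" where
  "err n \<Psi> \<Phi> =
     1 / real n * real (Min ((\<lambda>\<pi>. card {i\<in>{..<n}. \<Psi> i \<noteq> \<pi> (\<Phi> i)}) ` {\<pi>. \<pi> permutes {0, 1}}))"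

text \<open>A (possibly randomised) algorithm maps \<open>n\<close> and the observations to a distribution of labelings.\<close>

definition strongly_consistent ::
    "nat \<Rightarrow> real \<Rightarrow> (nat \<Rightarrow> real) \<Rightarrow> (nat \<Rightarrow> nat \<Rightarrow> nat) \<Rightarrow>
     (nat \<Rightarrow> (nat set \<Rightarrow> nat option) \<Rightarrow> (nat \<Rightarrow> nat) pmf) \<Rightarrow> bool" where
  "strongly_consistent d \<theta> \<alpha> \<Psi> alg \<longleftrightarrow>
     (\<lambda>n. measure_pmf.prob (gcbm n d \<theta> (\<alpha> n) (\<Psi> n) \<bind> alg n) {\<Phi>. err n (\<Psi> n) \<Phi> = 0})
       \<longlonglongrightarrow> 1"


section \<open>Hypergraph spectral clustering\<close>

definition adj_mat :: "nat \<Rightarrow> nat set set \<Rightarrow> (nat set \<Rightarrow> real) \<Rightarrow> real mat" where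
  "adj_mat n E w =
     mat n n (\<lambda>(i, j). if i = j then 0 else \<Sum>e\<in>{e\<in>E. {i, j} \<subseteq> e}. w e)"

definition trim :: "real \<Rightarrow> real mat \<Rightarrow> real mat" where
  "trim c A =
     (let n = dim_row A;
          total = \<Sum>i<n. \<Sum>j<n. A $$ (i, j);
          heavy = (\<lambda>i. (\<Sum>j<n. A $$ (i, j)) > c * (1 / real n) * total)
      in mat n n (\<lambda>(i, j). if heavy i \<or> heavy j then 0 else A $$ (i, j)))"

text \<open>
  The columns of \<open>U\<close> are the first \<open>k\<close> members of some orthonormal eigenbasis of \<open>A\<close> that is
  ordered by nonincreasing eigenvalue, so eigenvalues count with multiplicity and ties are
  broken arbitrarily. This is meant for \<open>k \<le> dim_row A\<close>.
\<close>

definition top_eigenvectors :: "real mat \<Rightarrow> nat \<Rightarrow> real mat \<Rightarrow> bool" where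
  "top_eigenvectors A k U \<longleftrightarrow>
     (\<exists>V \<mu>. V \<in> carrier_mat (dim_row A) (dim_row A) \<and>
            transpose_mat V * V = 1\<^sub>m (dim_row A) \<and>
            (\<forall>j<dim_row A. eigenvector A (Matrix.col V j) (\<mu> j)) \<and>
            antimono_on {..<dim_row A} \<mu> \<and>
            U = mat (dim_row A) k (\<lambda>(i, j). V $$ (i, j)))"

definition kmeans_cost :: "real mat \<Rightarrow> nat \<Rightarrow> (nat \<Rightarrow> nat) \<Rightarrow> real" where
  "kmeans_cost U k \<Phi> =
     (\<Sum>j<k. let C = {i\<in>{..<dim_row U}. \<Phi> i = j} in
        \<Sum>i\<in>C. \<Sum>c<dim_col U. (U $$ (i, c) - 1 / real (card C) * (\<Sum>l\<in>C. U $$ (l, c)))\<^sup>2)"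

definition approx_kmeans :: "real \<Rightarrow> real mat \<Rightarrow> nat \<Rightarrow> (nat \<Rightarrow> nat) \<Rightarrow> bool" where
  "approx_kmeans \<epsilon> U k \<Phi> \<longleftrightarrow>
     \<Phi> \<in> {..<dim_row U} \<rightarrow> {..<k} \<and>
     kmeans_cost U k \<Phi> \<le> (1 + \<epsilon>) * Min (kmeans_cost U k ` ({..<dim_row U} \<rightarrow>\<^sub>E {..<k}))"

definition hsc_output ::
    "real \<Rightarrow> real \<Rightarrow> nat \<Rightarrow> nat \<Rightarrow> nat set set \<Rightarrow> (nat set \<Rightarrow> real) \<Rightarrow> (nat \<Rightarrow> nat) \<Rightarrow> bool" where
  "hsc_output c_thr \<epsilon> k n E w \<Phi> \<longleftrightarrow>
     (\<exists>U. top_eigenvectors (trim c_thr (adj_mat n E w)) k U \<and> approx_kmeans \<epsilon> U k \<Phi>)"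

text \<open>
  The algorithm leaves open which eigenvectors and which approximate solution are used.
  An implementation fixes these choices as a function of the input alone: \<open>n\<close>, the edges in the
  input and their weights. There are \<open>k\<close> eigenvectors only if \<open>k \<le> n\<close>.
\<close>

definition hsc_implementation ::
    "nat \<Rightarrow> real \<Rightarrow> real \<Rightarrow> nat \<Rightarrow>
     (nat \<Rightarrow> nat set set \<Rightarrow> (nat set \<Rightarrow> real) \<Rightarrow> nat \<Rightarrow> nat) \<Rightarrow> bool" where
  "hsc_implementation d c_thr \<epsilon> k hsc \<longleftrightarrow>
     (\<forall>n\<ge>k. \<forall>E\<subseteq>edges n d. \<forall>w. hsc_output c_thr \<epsilon> k n E w (hsc n E w))"


section \<open>Spectral clustering with local refinement\<close>

definition homogeneity :: "(nat \<Rightarrow> nat) \<Rightarrow> nat set \<Rightarrow> nat" where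
  "homogeneity V e = (if V constant_on e then 1 else 0)"

text \<open>Erased edges count as disagreements.\<close>

definition disagreements ::
    "nat set set \<Rightarrow> (nat set \<Rightarrow> nat option) \<Rightarrow> (nat \<Rightarrow> nat) \<Rightarrow> nat" where
  "disagreements E W V = card {e\<in>E. W e \<noteq> Some (homogeneity V e)}"

definition flip :: "nat \<Rightarrow> (nat \<Rightarrow> nat) \<Rightarrow> nat \<Rightarrow> nat" where
  "flip i V = V(i := (V i + 1) mod 2)"

definition refine :: "nat set set \<Rightarrow> (nat set \<Rightarrow> nat option) \<Rightarrow> (nat \<Rightarrow> nat) \<Rightarrow> nat \<Rightarrow> nat" where
  "refine E W X i =
     (if disagreements E W X < disagreements E W (flip i X) then X i else (X i + 1) mod 2)"

definition random_subset_pmf :: "'a set \<Rightarrow> real \<Rightarrow> 'a set pmf" where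
  "random_subset_pmf S p =
     map_pmf (\<lambda>s. {e\<in>S. s e}) (Pi_pmf S False (\<lambda>_. bernoulli_pmf p))"

definition weight :: "nat option \<Rightarrow> real" where
  "weight x = (case x of None \<Rightarrow> 0 | Some b \<Rightarrow> real b)"

text \<open>
  For \<open>n \<le> 2\<close> the splitting probability may lie outside \<open>[0, 1]\<close> and is then clipped
  by \<open>bernoulli_pmf\<close>.
\<close>

definition hsclr ::
    "(nat \<Rightarrow> nat set set \<Rightarrow> (nat set \<Rightarrow> real) \<Rightarrow> nat \<Rightarrow> nat) \<Rightarrow> nat \<Rightarrow>
     nat \<Rightarrow> (nat set \<Rightarrow> nat option) \<Rightarrow> (nat \<Rightarrow> nat) pmf" where
  "hsclr hsc d n W = do {
     E1 \<leftarrow> random_subset_pmf (edges n d) (ln (ln (real n)) / ln (real n));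
     let X = hsc n E1 (\<lambda>e\<in>E1. weight (W e));
     return_pmf (refine (edges n d - E1) W X)
   }"

end

theory Submission
  imports Defs "HOL-Real_Asymp.Real_Asymp"
begin

text \<open>
  Write \<open>\<beta>\<close> for the splitting probability \<open>ln (ln n) / ln n\<close>. The proof has two parts: the
  clustering step labels all but a small fraction of the nodes correctly, and the refinement
  then decides each single node correctly with probability \<open>1 - o(1/n)\<close>.

  \<^bold>\<open>Clustering.\<close> The edges of the first part with observation \<open>1\<close> are independent, and
  \<open>D = (n choose d) \<alpha> \<beta> / n\<close>, which up to constants is the expected degree, tends to infinity,
  though possibly as slowly as \<open>ln (ln n)\<close>. At such a density the adjacency matrix \<open>A\<close> need not be close to its
  mean in operator norm, but the trimmed matrix is within \<open>o(D)\<close> of the block constant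
  mean \<open>P\<close>. Two properties of the random hypergraph imply this, both obtained from exponential
  moments and a union bound: \<open>A - P\<close> is small on all pairs of sign vectors, and a small set
  of nodes meets few edges more than once (\<open>typical\<close>). The first controls flat vectors. For a vector
  with small support the second is used: a matrix all of whose small principal submatrices have
  small row sums on average can be oriented so that all its rows become small, and the Schur test with small
  rows and columns of order \<open>D\<close> gives a norm of \<open>o(D)\<close> (\<open>trimmed_form_bound\<close>). Trimming is what
  bounds the columns.

  If \<open>A\<^sub>0 u = l u\<close> with \<open>l\<close> of order \<open>D\<close>, then \<open>u\<close> is close to \<open>P u / l\<close>, which is constant on
  the groups. The two leading eigenvalues are of order \<open>D\<close> because the form of \<open>P\<close> is of that
  order on all vectors that are constant on the groups. So the rows of the eigenvector matrix
  nearly take two values, which orthonormality keeps apart, and every near-optimal 2-means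
  partition agrees with the groups up to few nodes (\<open>hsc_recovers_groups\<close>).

  \<^bold>\<open>Refinement.\<close> Given the first part, the observations in the second part are still
  independent. Comparing the two labels of a node \<open>i\<close> is a likelihood ratio test on the edges
  through \<open>i\<close> whose other nodes carry equal labels. Each such edge contributes the factor
  \<open>1 - \<alpha> (sqrt (1 - \<theta>) - sqrt \<theta>)\<^sup>2\<close> to the Chernoff bound (\<open>refine_failure_prob\<close>). There are at
  least about \<open>((n - 1) choose (d - 1)) / 2 ^ (d - 2)\<close> of them, with near equality for balanced
  groups. Wrongly labelled nodes and edges used in the first part touch only a small
  fraction of them, so above the threshold the error probability is at most
  \<open>n powr - (1 + \<epsilon> / 2)\<close>, and a union bound over the nodes finishes the proof.
\<close>

section \<open>Bilinear forms of sparse matrices\<close>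

definition bilin :: "'a set \<Rightarrow> ('a \<Rightarrow> 'a \<Rightarrow> real) \<Rightarrow> ('a \<Rightarrow> real) \<Rightarrow> ('a \<Rightarrow> real) \<Rightarrow> real" where
  "bilin I M x y = (\<Sum>i\<in>I. \<Sum>j\<in>I. x i * M i j * y j)"

lemma L2_set_power2: "(L2_set f A)\<^sup>2 = (\<Sum>i\<in>A. (f i)\<^sup>2)"
  by (simp add: L2_set_def sum_nonneg)

text \<open>
  The Cauchy--Schwarz inequality over pairs \<open>(i, j)\<close> of weight \<open>B i j\<close>. The bound is the geometric
  mean of the row and the column bound, so it is small as soon as one of the two is.
\<close>

lemma schur_test:
  fixes B :: "'a \<Rightarrow> 'b \<Rightarrow> real"
  assumes fin: "finite I" "finite J"
    and nn: "\<And>i j. i \<in> I \<Longrightarrow> j \<in> J \<Longrightarrow> 0 \<le> B i j"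
    and rows: "\<And>i. i \<in> I \<Longrightarrow> (\<Sum>j\<in>J. B i j) \<le> r"
    and cols: "\<And>j. j \<in> J \<Longrightarrow> (\<Sum>i\<in>I. B i j) \<le> c"
    and "0 \<le> r" "0 \<le> c"
  shows "(\<Sum>i\<in>I. \<Sum>j\<in>J. \<bar>x i\<bar> * B i j * \<bar>y j\<bar>) \<le> sqrt (r * c) * L2_set x I * L2_set y J"
proof -
  define f where "f = (\<lambda>(i, j). sqrt (B i j) * x i)"
  define g where "g = (\<lambda>(i, j). sqrt (B i j) * y j)"
  have "(\<Sum>i\<in>I. \<Sum>j\<in>J. \<bar>x i\<bar> * B i j * \<bar>y j\<bar>) = (\<Sum>p\<in>I \<times> J. \<bar>f p\<bar> * \<bar>g p\<bar>)"
    unfolding sum.cartesian_product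
  proof (rule sum.cong[OF refl], clarify)
    fix i j assume "i \<in> I" "j \<in> J"
    then have "sqrt (B i j) * sqrt (B i j) = B i j" using nn by simp
    then show "\<bar>x i\<bar> * B i j * \<bar>y j\<bar> = \<bar>f (i, j)\<bar> * \<bar>g (i, j)\<bar>"
      by (simp add: f_def g_def abs_mult nn \<open>i \<in> I\<close> \<open>j \<in> J\<close>)
  qed
  also have "\<dots> \<le> L2_set f (I \<times> J) * L2_set g (I \<times> J)"
    by (rule L2_set_mult_ineq)
  also have "\<dots> \<le> (sqrt r * L2_set x I) * (sqrt c * L2_set y J)"
  proof (rule mult_mono)
    have "(\<Sum>p\<in>I \<times> J. (f p)\<^sup>2) = (\<Sum>i\<in>I. \<Sum>j\<in>J. B i j * (x i)\<^sup>2)"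
      unfolding sum.cartesian_product
      by (intro sum.cong refl) (auto simp: f_def power_mult_distrib nn)
    also have "\<dots> = (\<Sum>i\<in>I. (\<Sum>j\<in>J. B i j) * (x i)\<^sup>2)"
      by (simp add: sum_distrib_right)
    also have "\<dots> \<le> (\<Sum>i\<in>I. r * (x i)\<^sup>2)"
      by (intro sum_mono mult_right_mono rows) auto
    finally show "L2_set f (I \<times> J) \<le> sqrt r * L2_set x I"
      by (simp add: L2_set_def real_sqrt_mult[symmetric] sum_distrib_left)
    have "(\<Sum>p\<in>I \<times> J. (g p)\<^sup>2) = (\<Sum>i\<in>I. \<Sum>j\<in>J. B i j * (y j)\<^sup>2)"
      unfolding sum.cartesian_product
      by (intro sum.cong refl) (auto simp: g_def power_mult_distrib nn)
    also have "\<dots> = (\<Sum>j\<in>J. (\<Sum>i\<in>I. B i j) * (y j)\<^sup>2)"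
      by (subst sum.swap) (simp add: sum_distrib_right)
    also have "\<dots> \<le> (\<Sum>j\<in>J. c * (y j)\<^sup>2)"
      by (intro sum_mono mult_right_mono cols) auto
    finally show "L2_set g (I \<times> J) \<le> sqrt c * L2_set y J"
      by (simp add: L2_set_def real_sqrt_mult[symmetric] sum_distrib_left)
  qed (use \<open>0 \<le> r\<close> in auto)
  finally show ?thesis by (simp add: real_sqrt_mult mult_ac)
qed

text \<open>
  Some vertex of \<open>S\<close> has weight at most \<open>\<kappa>\<close> into \<open>S\<close>, as this holds on average. Remove it, charge
  its entries to its row, and repeat. This is the acyclic orientation of a degenerate graph, with
  weights.
\<close>

lemma sparse_orientation:
  fixes M :: "'a \<Rightarrow> 'a \<Rightarrow> real"
  assumes "finite S" and nn: "\<And>i j. 0 \<le> M i j" and sym: "\<And>i j. M i j = M j i"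
    and "\<And>T. T \<subseteq> S \<Longrightarrow> (\<Sum>i\<in>T. \<Sum>j\<in>T. M i j) \<le> \<kappa> * real (card T)"
  shows "\<exists>N. (\<forall>i j. 0 \<le> N i j \<and> N i j \<le> M i j) \<and> (\<forall>i\<in>S. \<forall>j\<in>S. M i j \<le> N i j + N j i) \<and>
    (\<forall>i\<in>S. (\<Sum>j\<in>S. N i j) \<le> \<kappa>)"
  using assms(1,4)
proof (induction "card S" arbitrary: S)
  case 0
  then show ?case using nn by (intro exI[of _ M]) auto
next
  case (Suc m)
  have "\<exists>v\<in>S. (\<Sum>j\<in>S. M v j) \<le> \<kappa>"
  proof (rule ccontr)
    assume "\<not> ?thesis"
    then have *: "\<kappa> < (\<Sum>j\<in>S. M v j)" if "v \<in> S" for v using that by force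
    have "S \<noteq> {}" using Suc.hyps(2) by auto
    then have "(\<Sum>i\<in>S. \<kappa>) < (\<Sum>i\<in>S. \<Sum>j\<in>S. M i j)"
      using * Suc.prems(1) by (intro sum_strict_mono) auto
    with Suc.prems(2)[of S] show False by (simp add: mult.commute)
  qed
  then obtain v where v: "v \<in> S" "(\<Sum>j\<in>S. M v j) \<le> \<kappa>" by blast
  have "m = card (S - {v})" using Suc.hyps(2) v Suc.prems(1) by simp
  moreover have "(\<Sum>i\<in>T. \<Sum>j\<in>T. M i j) \<le> \<kappa> * real (card T)" if "T \<subseteq> S - {v}" for T
    using Suc.prems(2) that by blast
  ultimately have "\<exists>N. (\<forall>i j. 0 \<le> N i j \<and> N i j \<le> M i j) \<and>
      (\<forall>i\<in>S - {v}. \<forall>j\<in>S - {v}. M i j \<le> N i j + N j i) \<and> (\<forall>i\<in>S - {v}. (\<Sum>j\<in>S - {v}. N i j) \<le> \<kappa>)"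
    using Suc.prems(1) by (intro Suc.hyps(1)) auto
  then obtain N where
    N: "\<And>i j. 0 \<le> N i j \<and> N i j \<le> M i j" "\<And>i j. i \<in> S - {v} \<Longrightarrow> j \<in> S - {v} \<Longrightarrow> M i j \<le> N i j + N j i"
       "\<And>i. i \<in> S - {v} \<Longrightarrow> (\<Sum>j\<in>S - {v}. N i j) \<le> \<kappa>"
    by blast
  define N' where "N' i j = (if i = v then M v j else if j = v then 0 else N i j)" for i j
  have r: "(\<Sum>j\<in>S. N' i j) \<le> \<kappa>" if i: "i \<in> S" for i
  proof (cases "i = v")
    case True then show ?thesis using v by (simp add: N'_def)
  next
    case False
    then have "(\<Sum>j\<in>S. N' i j) = (\<Sum>j\<in>S - {v}. N i j)"
      using v Suc.prems(1) by (subst sum.remove[of S v]) (auto simp: N'_def intro!: sum.cong)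
    then show ?thesis using N(3)[of i] i False by simp
  qed
  have "M i j \<le> N' i j + N' j i" if "i \<in> S" "j \<in> S" for i j
    using N(2)[of i j] that sym[of i j] nn[of v v] by (auto simp: N'_def)
  moreover have "0 \<le> N' i j \<and> N' i j \<le> M i j" for i j
    using N(1) nn by (simp add: N'_def)
  ultimately show ?case using r by blast
qed

text \<open>
  Both \<open>N\<close> and its transpose in the orientation \<open>M \<le> N + N\<^sup>T\<close> have rows bounded by \<open>\<kappa>\<close> and columns
  by \<open>R\<close>, or vice versa. The Schur test thus improves the trivial bound \<open>R\<close> to \<open>sqrt (\<kappa> * R)\<close>.
\<close>

lemma sparse_set_form:
  fixes M :: "'a \<Rightarrow> 'a \<Rightarrow> real"
  assumes "finite S" and nn: "\<And>i j. 0 \<le> M i j" and sym: "\<And>i j. M i j = M j i"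
    and sparse: "\<And>T. T \<subseteq> S \<Longrightarrow> (\<Sum>i\<in>T. \<Sum>j\<in>T. M i j) \<le> \<kappa> * real (card T)"
    and rows: "\<And>i. i \<in> S \<Longrightarrow> (\<Sum>j\<in>S. M i j) \<le> R"
    and "0 \<le> \<kappa>" "0 \<le> R"
  shows "(\<Sum>i\<in>S. \<Sum>j\<in>S. \<bar>x i\<bar> * M i j * \<bar>y j\<bar>) \<le> 2 * sqrt (\<kappa> * R) * L2_set x S * L2_set y S"
proof -
  obtain N where N: "\<And>i j. 0 \<le> N i j" "\<And>i j. N i j \<le> M i j"
      "\<And>i j. i \<in> S \<Longrightarrow> j \<in> S \<Longrightarrow> M i j \<le> N i j + N j i"
      "\<And>i. i \<in> S \<Longrightarrow> (\<Sum>j\<in>S. N i j) \<le> \<kappa>"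
    using sparse_orientation[OF assms(1) nn sym sparse] by metis
  have col: "(\<Sum>i\<in>S. N i j) \<le> R" if "j \<in> S" for j
  proof -
    have "(\<Sum>i\<in>S. N i j) \<le> (\<Sum>i\<in>S. M j i)" using N(2) sym by (intro sum_mono) metis
    then show ?thesis using rows[OF that] by linarith
  qed
  have "(\<Sum>i\<in>S. \<Sum>j\<in>S. \<bar>x i\<bar> * M i j * \<bar>y j\<bar>) \<le>
     (\<Sum>i\<in>S. \<Sum>j\<in>S. \<bar>x i\<bar> * N i j * \<bar>y j\<bar> + \<bar>x i\<bar> * N j i * \<bar>y j\<bar>)"
    using N(3) by (intro sum_mono) (simp add: distrib_left[symmetric] distrib_right[symmetric] mult_left_mono mult_right_mono)
  also have "\<dots> = (\<Sum>i\<in>S. \<Sum>j\<in>S. \<bar>x i\<bar> * N i j * \<bar>y j\<bar>) + (\<Sum>i\<in>S. \<Sum>j\<in>S. \<bar>x i\<bar> * N j i * \<bar>y j\<bar>)"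
    by (simp add: sum.distrib)
  also have "\<dots> \<le> sqrt (\<kappa> * R) * L2_set x S * L2_set y S + sqrt (R * \<kappa>) * L2_set x S * L2_set y S"
    using N col assms by (intro add_mono schur_test) auto
  also have "\<dots> = 2 * sqrt (\<kappa> * R) * L2_set x S * L2_set y S"
    by (simp add: mult.commute[of R \<kappa>])
  finally show ?thesis .
qed

text \<open>
  At most \<open>card S\<close> indices receive weight more than \<open>2 * \<kappa>\<close> from \<open>S\<close>: otherwise \<open>S\<close> together with
  \<open>card S\<close> of them would not be sparse. With these indices added, \<open>S\<close> is still a sparse set, and
  for all other indices the columns are small.
\<close>

lemma small_support_form:
  fixes M :: "'a \<Rightarrow> 'a \<Rightarrow> real"
  assumes fin: "finite I" and nn: "\<And>i j. 0 \<le> M i j" and sym: "\<And>i j. M i j = M j i"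
    and S: "S \<subseteq> I"
    and sparse: "\<And>T. T \<subseteq> I \<Longrightarrow> card T \<le> 2 * card S \<Longrightarrow> (\<Sum>i\<in>T. \<Sum>j\<in>T. M i j) \<le> \<kappa> * real (card T)"
    and rows: "\<And>i. i \<in> I \<Longrightarrow> (\<Sum>j\<in>I. M i j) \<le> R"
    and "0 \<le> \<kappa>" "0 \<le> R"
  shows "(\<Sum>i\<in>S. \<Sum>j\<in>I. \<bar>x i\<bar> * M i j * \<bar>y j\<bar>) \<le> 4 * sqrt (\<kappa> * R) * L2_set x S * L2_set y I"
proof -
  have finS: "finite S" using fin S finite_subset by blast
  define T where "T = {j\<in>I. 2 * \<kappa> < (\<Sum>i\<in>S. M i j)}"
  have finT: "finite T" using fin by (simp add: T_def)
  have cT: "card T \<le> card S"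
  proof (rule ccontr)
    assume "\<not> card T \<le> card S"
    then obtain T' where T': "T' \<subseteq> T" "card T' = card S" 
      by (metis nat_le_linear obtain_subset_with_card_n)
    have finT': "finite T'" using finT T'(1) finite_subset by blast
    have "S \<noteq> {}"
    proof
      assume "S = {}"
      then have "T = {}" using \<open>0 \<le> \<kappa>\<close> by (auto simp: T_def)
      then show False using \<open>\<not> card T \<le> card S\<close> by simp
    qed
    then have "T' \<noteq> {}" using T'(2) finS by auto
    have "2 * \<kappa> * card S = (\<Sum>j\<in>T'. 2 * \<kappa>)" using T'(2) by simp
    also have "\<dots> < (\<Sum>j\<in>T'. \<Sum>i\<in>S. M i j)"
      using T'(1) \<open>T' \<noteq> {}\<close> finT' by (intro sum_strict_mono) (auto simp: T_def)
    also have "\<dots> \<le> (\<Sum>j\<in>T'. \<Sum>i\<in>S \<union> T'. M j i)"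
    proof (rule sum_mono)
      fix j
      have "(\<Sum>i\<in>S. M i j) = (\<Sum>i\<in>S. M j i)" using sym by (intro sum.cong) auto
      also have "\<dots> \<le> (\<Sum>i\<in>S \<union> T'. M j i)"
        using finS finT' nn by (intro sum_mono2) auto
      finally show "(\<Sum>i\<in>S. M i j) \<le> (\<Sum>i\<in>S \<union> T'. M j i)" .
    qed
    also have "\<dots> \<le> (\<Sum>j\<in>S \<union> T'. \<Sum>i\<in>S \<union> T'. M j i)"
      using finS finT' nn by (intro sum_mono2) (auto intro!: sum_nonneg)
    also have "\<dots> \<le> \<kappa> * real (card (S \<union> T'))"
    proof (rule sparse)
      show "S \<union> T' \<subseteq> I" using S T'(1) by (auto simp: T_def)
      show "card (S \<union> T') \<le> 2 * card S" using card_Un_le[of S T'] T'(2) by simp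
    qed
    also have "\<dots> \<le> \<kappa> * real (2 * card S)"
      using card_Un_le[of S T'] T'(2) \<open>0 \<le> \<kappa>\<close> by (intro mult_left_mono) auto
    finally show False by simp
  qed
  define U where "U = S \<union> T"
  have U: "U \<subseteq> I" using S by (auto simp: U_def T_def)
  have finU: "finite U" using finS finT by (simp add: U_def)
  have cU: "card U \<le> 2 * card S" using card_Un_le[of S T] cT by (simp add: U_def)
  have rowsU: "(\<Sum>j\<in>J. M i j) \<le> R" if "J \<subseteq> I" "i \<in> I" for i J
    using sum_mono2[OF fin that(1), of "M i"] nn rows[OF that(2)] by fastforce
  have "(\<Sum>i\<in>S. \<Sum>j\<in>I. \<bar>x i\<bar> * M i j * \<bar>y j\<bar>) =
      (\<Sum>i\<in>S. \<Sum>j\<in>U. \<bar>x i\<bar> * M i j * \<bar>y j\<bar>) + (\<Sum>i\<in>S. \<Sum>j\<in>I - U. \<bar>x i\<bar> * M i j * \<bar>y j\<bar>)"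
    unfolding sum.distrib[symmetric] by (subst sum.subset_diff[OF U fin]) (simp add: add.commute)
  also have "(\<Sum>i\<in>S. \<Sum>j\<in>U. \<bar>x i\<bar> * M i j * \<bar>y j\<bar>) =
      (\<Sum>i\<in>U. \<Sum>j\<in>U. \<bar>if i \<in> S then x i else 0\<bar> * M i j * \<bar>y j\<bar>)"
    by (rule sum.mono_neutral_cong_left) (use finU in \<open>auto simp: U_def\<close>)
  also have "\<dots> \<le> 2 * sqrt (\<kappa> * R) * L2_set (\<lambda>i. if i \<in> S then x i else 0) U * L2_set y U"
    using U cU rowsU assms by (intro sparse_set_form) (auto intro!: sparse finU intro: order.trans[OF card_mono] finite_subset)
  also have "L2_set (\<lambda>i. if i \<in> S then x i else 0) U = L2_set x S"
    unfolding L2_set_def by (intro arg_cong[of _ _ sqrt] sum.mono_neutral_cong_right) (use finU in \<open>auto simp: U_def\<close>)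
  also have "2 * sqrt (\<kappa> * R) * L2_set x S * L2_set y U \<le> 2 * sqrt (\<kappa> * R) * L2_set x S * L2_set y I"
    using U fin \<open>0 \<le> \<kappa>\<close> \<open>0 \<le> R\<close> by (intro mult_left_mono) (auto simp: L2_set_def sum_nonneg intro!: sum_mono2)
  also have "(\<Sum>i\<in>S. \<Sum>j\<in>I - U. \<bar>x i\<bar> * M i j * \<bar>y j\<bar>) \<le> sqrt (R * (2 * \<kappa>)) * L2_set x S * L2_set y (I - U)"
    using S assms finS by (intro schur_test rowsU) (auto simp: U_def T_def not_less)
  also have "\<dots> \<le> (2 * sqrt (\<kappa> * R)) * L2_set x S * L2_set y I"
  proof (intro mult_mono)
    have "sqrt (R * (2 * \<kappa>)) \<le> sqrt (2\<^sup>2 * (\<kappa> * R))"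
      using \<open>0 \<le> \<kappa>\<close> \<open>0 \<le> R\<close> by (intro real_sqrt_le_mono) (simp add: algebra_simps)
    then show "sqrt (R * (2 * \<kappa>)) \<le> 2 * sqrt (\<kappa> * R)" by (simp add: real_sqrt_mult)
  qed (use fin \<open>0 \<le> \<kappa>\<close> \<open>0 \<le> R\<close> in \<open>auto simp: L2_set_def sum_nonneg intro!: sum_mono2\<close>)
  finally show ?thesis by linarith
qed

text \<open>
  A bilinear form on a box is largest at a corner.
\<close>

lemma form_le_of_sign_vectors:
  fixes M :: "'a \<Rightarrow> 'a \<Rightarrow> real"
  assumes sgn: "\<And>s t. (\<forall>i. s i \<in> {-1, 1}) \<Longrightarrow> (\<forall>i. t i \<in> {-1, 1}) \<Longrightarrow> \<bar>bilin I M s t\<bar> \<le> q"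
    and x: "\<And>i. i \<in> I \<Longrightarrow> \<bar>x i\<bar> \<le> a" and y: "\<And>i. i \<in> I \<Longrightarrow> \<bar>y i\<bar> \<le> b" and "0 \<le> a" "0 \<le> b"
  shows "\<bar>bilin I M x y\<bar> \<le> a * b * q"
proof -
  define s :: "'a \<Rightarrow> real" where "s i = (if 0 \<le> (\<Sum>j\<in>I. M i j * y j) then 1 else -1)" for i
  define t :: "'a \<Rightarrow> real" where "t j = (if 0 \<le> (\<Sum>i\<in>I. s i * M i j) then 1 else -1)" for j
  have "\<bar>bilin I M x y\<bar> \<le> (\<Sum>i\<in>I. a * (s i * (\<Sum>j\<in>I. M i j * y j)))"
    unfolding bilin_def
  proof (rule order.trans[OF sum_abs], rule sum_mono)
    fix i assume "i \<in> I"
    have "\<bar>\<Sum>j\<in>I. x i * M i j * y j\<bar> = \<bar>x i\<bar> * \<bar>\<Sum>j\<in>I. M i j * y j\<bar>"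
      by (simp add: abs_mult[symmetric] sum_distrib_left mult.assoc)
    also have "\<dots> \<le> a * \<bar>\<Sum>j\<in>I. M i j * y j\<bar>" using x \<open>i \<in> I\<close> by (intro mult_right_mono) auto
    also have "\<bar>\<Sum>j\<in>I. M i j * y j\<bar> = s i * (\<Sum>j\<in>I. M i j * y j)" by (simp add: s_def)
    finally show "\<bar>\<Sum>j\<in>I. x i * M i j * y j\<bar> \<le> a * (s i * (\<Sum>j\<in>I. M i j * y j))" .
  qed
  also have "\<dots> = a * (\<Sum>i\<in>I. \<Sum>j\<in>I. s i * (M i j * y j))"
    by (simp add: sum_distrib_left)
  also have "\<dots> = a * (\<Sum>j\<in>I. y j * (\<Sum>i\<in>I. s i * M i j))"
    by (subst sum.swap) (simp add: sum_distrib_left mult_ac)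
  also have "\<dots> \<le> a * (\<Sum>j\<in>I. b * (t j * (\<Sum>i\<in>I. s i * M i j)))"
  proof (intro mult_left_mono sum_mono \<open>0 \<le> a\<close>)
    fix j assume "j \<in> I"
    have "y j * (\<Sum>i\<in>I. s i * M i j) \<le> \<bar>y j\<bar> * \<bar>\<Sum>i\<in>I. s i * M i j\<bar>"
      by (metis abs_ge_self abs_mult)
    also have "\<dots> \<le> b * \<bar>\<Sum>i\<in>I. s i * M i j\<bar>" using y \<open>j \<in> I\<close> by (intro mult_right_mono) auto
    also have "\<bar>\<Sum>i\<in>I. s i * M i j\<bar> = t j * (\<Sum>i\<in>I. s i * M i j)" by (simp add: t_def)
    finally show "y j * (\<Sum>i\<in>I. s i * M i j) \<le> b * (t j * (\<Sum>i\<in>I. s i * M i j))" .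
  qed
  also have "\<dots> = a * b * (\<Sum>j\<in>I. \<Sum>i\<in>I. s i * M i j * t j)"
    by (simp add: sum_distrib_left mult_ac)
  also have "\<dots> = a * b * bilin I M s t"
    unfolding bilin_def by (subst sum.swap) simp
  also have "\<dots> \<le> a * b * q"
  proof -
    have "\<bar>bilin I M s t\<bar> \<le> q" by (rule sgn) (auto simp: s_def t_def)
    then show ?thesis using \<open>0 \<le> a\<close> \<open>0 \<le> b\<close> by (intro mult_left_mono) auto
  qed
  finally show ?thesis .
qed


lemma bilin_transpose: "bilin I M x y = bilin I (\<lambda>i j. M j i) y x"
  unfolding bilin_def by (subst sum.swap) (simp add: mult_ac)

lemma bilin_add_left: "bilin I M (\<lambda>i. x i + x' i) y = bilin I M x y + bilin I M x' y"
  by (simp add: bilin_def sum.distrib[symmetric] algebra_simps)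

lemma bilin_add_right: "bilin I M x (\<lambda>i. y i + y' i) = bilin I M x y + bilin I M x y'"
  by (simp add: bilin_def sum.distrib[symmetric] algebra_simps)

lemma bilin_diff: "bilin I (\<lambda>i j. M i j - N i j) x y = bilin I M x y - bilin I N x y"
  by (simp add: bilin_def sum_subtractf[symmetric] algebra_simps)

lemma sum_abs_le_sqrt_card: "(\<Sum>i\<in>A. \<bar>x i\<bar>) \<le> sqrt (real (card A)) * L2_set x A"
  using L2_set_mult_ineq[of "\<lambda>_. 1" x A] by (simp add: L2_set_constant)

lemma L2_set_mono_set: "finite B \<Longrightarrow> A \<subseteq> B \<Longrightarrow> L2_set x A \<le> L2_set x B"
  by (auto simp: L2_set_def intro!: sum_mono2)

text \<open>
  Sparsity takes care of \<open>M\<close>. For \<open>P\<close> it suffices that its entries are of order \<open>D / card I\<close> and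
  that only few rows are involved.
\<close>

lemma form_bound_small_support:
  fixes M P :: "'a \<Rightarrow> 'a \<Rightarrow> real"
  assumes fin: "finite I" and nn: "\<And>i j. 0 \<le> M i j" and sym: "\<And>i j. M i j = M j i"
    and S: "S \<subseteq> I" "real (card S) \<le> \<sigma> * real (card I) / 2"
    and sparse: "\<And>T. T \<subseteq> I \<Longrightarrow> real (card T) \<le> \<sigma> * real (card I) \<Longrightarrow>
         (\<Sum>i\<in>T. \<Sum>j\<in>T. M i j) \<le> \<kappa> * D * real (card T)"
    and rows: "\<And>i. i \<in> I \<Longrightarrow> (\<Sum>j\<in>I. M i j) \<le> C * D"
    and P: "\<And>i j. i \<in> I \<Longrightarrow> j \<in> I \<Longrightarrow> \<bar>P i j\<bar> \<le> c * D / real (card I)"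
    and "0 \<le> \<kappa>" "0 \<le> C" "0 \<le> D" "0 \<le> c" "0 < \<sigma>"
    and supp: "\<And>i. i \<in> I - S \<Longrightarrow> x i = 0"
  shows "\<bar>bilin I (\<lambda>i j. M i j - P i j) x y\<bar> \<le>
    (4 * sqrt (\<kappa> * C) + c * sqrt \<sigma>) * D * L2_set x I * L2_set y I"
proof (cases "I = {}")
  case True then show ?thesis by (simp add: bilin_def)
next
  case False
  define n where "n = real (card I)"
  have n: "n > 0" using False fin by (simp add: n_def card_gt_0_iff)
  have S_eq: "(\<Sum>i\<in>I. f i) = (\<Sum>i\<in>S. f i)" if "\<And>i. i \<in> I - S \<Longrightarrow> f i = 0" for f :: "'a \<Rightarrow> real"
    using that S fin by (intro sum.mono_neutral_right) auto
  have "\<bar>bilin I M x y\<bar> \<le> (\<Sum>i\<in>I. \<Sum>j\<in>I. \<bar>x i\<bar> * M i j * \<bar>y j\<bar>)"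
    unfolding bilin_def using nn
    by (intro order.trans[OF sum_abs] sum_mono order.trans[OF sum_abs]) (simp add: abs_mult)
  also have "\<dots> = (\<Sum>i\<in>S. \<Sum>j\<in>I. \<bar>x i\<bar> * M i j * \<bar>y j\<bar>)"
    by (rule S_eq) (simp add: supp)
  also have "\<dots> \<le> 4 * sqrt ((\<kappa> * D) * (C * D)) * L2_set x S * L2_set y I"
  proof (rule small_support_form[OF fin nn sym S(1)])
    fix T assume "T \<subseteq> I" "card T \<le> 2 * card S"
    then show "(\<Sum>i\<in>T. \<Sum>j\<in>T. M i j) \<le> \<kappa> * D * real (card T)"
      using S(2) by (intro sparse) auto
  qed (use assms in auto)
  also have "\<dots> \<le> (4 * sqrt (\<kappa> * C) * D) * L2_set x I * L2_set y I"
  proof (rule mult_right_mono, rule mult_mono)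
    show "L2_set x S \<le> L2_set x I" by (rule L2_set_mono_set[OF fin S(1)])
    have "(\<kappa> * D) * (C * D) = \<kappa> * C * D\<^sup>2" by (simp add: power2_eq_square mult_ac)
    then have "sqrt ((\<kappa> * D) * (C * D)) = sqrt (\<kappa> * C) * sqrt (D\<^sup>2)"
      by (simp only: real_sqrt_mult)
    then show "4 * sqrt ((\<kappa> * D) * (C * D)) \<le> 4 * sqrt (\<kappa> * C) * D"
      using \<open>0 \<le> D\<close> by simp
  qed (use assms in auto)
  finally have 1: "\<bar>bilin I M x y\<bar> \<le> (4 * sqrt (\<kappa> * C) * D) * L2_set x I * L2_set y I" .
  have "\<bar>bilin I P x y\<bar> \<le> (\<Sum>i\<in>I. \<Sum>j\<in>I. \<bar>x i\<bar> * (c * D / n) * \<bar>y j\<bar>)"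
    unfolding bilin_def
    by (intro order.trans[OF sum_abs] sum_mono order.trans[OF sum_abs])
       (simp only: abs_mult n_def, intro mult_left_mono mult_right_mono P, auto)
  also have "\<dots> = (c * D / n) * ((\<Sum>i\<in>S. \<bar>x i\<bar>) * (\<Sum>j\<in>I. \<bar>y j\<bar>))"
  proof -
    have "(\<Sum>i\<in>I. \<Sum>j\<in>I. \<bar>x i\<bar> * (c * D / n) * \<bar>y j\<bar>) = (\<Sum>i\<in>S. \<Sum>j\<in>I. \<bar>x i\<bar> * (c * D / n) * \<bar>y j\<bar>)"
      by (rule S_eq) (simp add: supp)
    also have "\<dots> = (c * D / n) * ((\<Sum>i\<in>S. \<bar>x i\<bar>) * (\<Sum>j\<in>I. \<bar>y j\<bar>))"
      by (subst sum_product, subst sum_distrib_left, rule sum.cong[OF refl], subst sum_distrib_left,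
          rule sum.cong[OF refl]) (simp add: mult_ac)
    finally show ?thesis .
  qed
  also have "\<dots> \<le> (c * D / n) * ((sqrt (\<sigma> * n) * L2_set x I) * (sqrt n * L2_set y I))"
  proof (intro mult_left_mono mult_mono)
    have "(\<Sum>i\<in>S. \<bar>x i\<bar>) \<le> sqrt (real (card S)) * L2_set x S" by (rule sum_abs_le_sqrt_card)
    also have "\<dots> \<le> sqrt (\<sigma> * n) * L2_set x I"
      using S n \<open>0 < \<sigma>\<close> by (intro mult_mono L2_set_mono_set fin) (auto simp: n_def)
    finally show "(\<Sum>i\<in>S. \<bar>x i\<bar>) \<le> sqrt (\<sigma> * n) * L2_set x I" .
    show "(\<Sum>j\<in>I. \<bar>y j\<bar>) \<le> sqrt n * L2_set y I" unfolding n_def by (rule sum_abs_le_sqrt_card)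
  qed (use n assms in \<open>auto intro: sum_nonneg\<close>)
  also have "\<dots> = (c * sqrt \<sigma> * D) * L2_set x I * L2_set y I"
  proof -
    have "sqrt (\<sigma> * n) * sqrt n = sqrt \<sigma> * n"
      using n by (simp add: real_sqrt_mult)
    then show ?thesis using n by (simp add: field_simps)
  qed
  finally have 2: "\<bar>bilin I P x y\<bar> \<le> (c * sqrt \<sigma> * D) * L2_set x I * L2_set y I" .
  show ?thesis
    unfolding bilin_diff using 1 2 by (simp add: algebra_simps)
qed

text \<open>
  This bounds the operator norm of \<open>A0 - P\<close>. Coordinates of \<open>x\<close> above \<open>2 * norm x / sqrt (\<sigma> * n)\<close>
  are at most \<open>\<sigma> * n / 4\<close> in number; together with the trimmed indices \<open>H\<close> they form a small set,
  on which sparsity of \<open>A\<close> and smallness of the entries of \<open>P\<close> suffice. The remaining coordinates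
  of \<open>x\<close> and \<open>y\<close> lie in a box away from \<open>H\<close>, where \<open>A0\<close> agrees with \<open>A\<close> and the bound on sign
  vectors applies.
\<close>

lemma trimmed_form_bound:
  fixes A A0 P :: "'a \<Rightarrow> 'a \<Rightarrow> real"
  assumes fin: "finite I" and nn: "\<And>i j. 0 \<le> A i j" and sym: "\<And>i j. A i j = A j i"
    and H: "H \<subseteq> I" "real (card H) \<le> \<sigma> * real (card I) / 4"
    and A0: "\<And>i j. A0 i j = (if i \<in> H \<or> j \<in> H then 0 else A i j)"
    and sparse: "\<And>T. T \<subseteq> I \<Longrightarrow> real (card T) \<le> \<sigma> * real (card I) \<Longrightarrow>
         (\<Sum>i\<in>T. \<Sum>j\<in>T. A i j) \<le> \<kappa> * D * real (card T)"
    and rows: "\<And>i. i \<in> I - H \<Longrightarrow> (\<Sum>j\<in>I. A i j) \<le> C * D"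
    and P: "\<And>i j. i \<in> I \<Longrightarrow> j \<in> I \<Longrightarrow> \<bar>P i j\<bar> \<le> c * D / real (card I)"
    and cut: "\<And>s t. (\<forall>i. s i \<in> {-1, 1}) \<Longrightarrow> (\<forall>i. t i \<in> {-1, 1}) \<Longrightarrow>
         \<bar>bilin I (\<lambda>i j. A i j - P i j) s t\<bar> \<le> \<mu> * D * real (card I)"
    and nonneg: "0 \<le> \<kappa>" "0 \<le> C" "0 \<le> D" "0 \<le> c" "0 < \<sigma>"
  shows "\<bar>bilin I (\<lambda>i j. A0 i j - P i j) x y\<bar> \<le>
    (8 * sqrt (\<kappa> * C) + 2 * c * sqrt \<sigma> + 4 * \<mu> / \<sigma>) * D * L2_set x I * L2_set y I"
proof (cases "I = {}")
  case True then show ?thesis by (simp add: bilin_def)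
next
  case False
  define n where "n = real (card I)"
  have n: "n > 0" using False fin by (simp add: n_def card_gt_0_iff)
  define E where "E i j = A0 i j - P i j" for i j
  have A0nn: "0 \<le> A0 i j" "A0 i j \<le> A i j" for i j using nn A0 by auto
  have A0sym: "A0 i j = A0 j i" for i j using sym A0 by auto
  have A0sparse: "(\<Sum>i\<in>T. \<Sum>j\<in>T. A0 i j) \<le> \<kappa> * D * real (card T)"
    if "T \<subseteq> I" "real (card T) \<le> \<sigma> * real (card I)" for T
  proof -
    have "(\<Sum>i\<in>T. \<Sum>j\<in>T. A0 i j) \<le> (\<Sum>i\<in>T. \<Sum>j\<in>T. A i j)" by (intro sum_mono A0nn)
    then show ?thesis using sparse[OF that] by linarith
  qed
  have A0rows: "(\<Sum>j\<in>I. A0 i j) \<le> C * D" if "i \<in> I" for i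
  proof (cases "i \<in> H")
    case True then show ?thesis using A0 nonneg by simp
  next
    case False
    then have "(\<Sum>j\<in>I. A0 i j) \<le> (\<Sum>j\<in>I. A i j)" by (intro sum_mono A0nn)
    then show ?thesis using rows[of i] that False by simp
  qed
  \<comment> \<open>\<open>lim z\<close> is the level above which an entry of \<open>z\<close> counts as large\<close>
  define lim where "lim z = 2 * L2_set z I / sqrt (\<sigma> * n)" for z :: "'a \<Rightarrow> real"
  define big where "big z = {i\<in>I. lim z < \<bar>z i\<bar>} \<union> H" for z :: "'a \<Rightarrow> real"
  have lim_nn: "0 \<le> lim z" for z using n nonneg by (simp add: lim_def)
  have big_sub: "big z \<subseteq> I" for z using H by (auto simp: big_def)
  have big_card: "real (card (big z)) \<le> \<sigma> * real (card I) / 2" for z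
  proof -
    let ?B = "{i\<in>I. lim z < \<bar>z i\<bar>}"
    have "real (card ?B) \<le> \<sigma> * n / 4"
    proof (cases "L2_set z I = 0")
      case True
      then have "?B = {}" using L2_set_eq_0_iff[OF fin, of z] lim_nn[of z] by auto
      then have "card ?B = 0" by (simp only: card.empty)
      then show ?thesis using n nonneg by (simp only:) simp
    next
      case False
      then have pos: "L2_set z I > 0" by (metis L2_set_nonneg less_eq_real_def)
      have "real (card ?B) * (lim z)\<^sup>2 = (\<Sum>i\<in>?B. (lim z)\<^sup>2)" by simp
      also have "\<dots> \<le> (\<Sum>i\<in>?B. (z i)\<^sup>2)"
        using lim_nn by (intro sum_mono) (auto simp: abs_le_square_iff[symmetric])
      also have "\<dots> \<le> (\<Sum>i\<in>I. (z i)\<^sup>2)" using fin by (intro sum_mono2) auto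
      also have "\<dots> = (L2_set z I)\<^sup>2" by (simp add: L2_set_power2)
      finally have "real (card ?B) * (4 * (L2_set z I)\<^sup>2 / (\<sigma> * n)) \<le> (L2_set z I)\<^sup>2"
        using n nonneg by (simp add: lim_def power_divide power_mult_distrib)
      then show ?thesis using pos n nonneg by (simp add: field_simps)
    qed
    then show ?thesis
      using H(2) card_Un_le[of ?B H] by (simp add: n_def big_def)
  qed
  define large where "large z i = (if i \<in> big z then z i else 0)" for z :: "'a \<Rightarrow> real" and i
  define rest where "rest z i = (if i \<in> big z then 0 else z i)" for z :: "'a \<Rightarrow> real" and i
  have split: "z = (\<lambda>i. large z i + rest z i)" for z by (auto simp: large_def rest_def)
  have L2: "L2_set (large z) I \<le> L2_set z I" "L2_set (rest z) I \<le> L2_set z I" for z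
    unfolding L2_set_def by (auto intro!: sum_mono simp: large_def rest_def)
  define b where "b = (4 * sqrt (\<kappa> * C) + c * sqrt \<sigma>) * D"
  have b: "0 \<le> b" using nonneg by (simp add: b_def)
  have 1: "\<bar>bilin I E (large x) y\<bar> \<le> b * L2_set x I * L2_set y I"
  proof -
    have "\<bar>bilin I E (large x) y\<bar> \<le> b * L2_set (large x) I * L2_set y I"
      unfolding E_def b_def
      by (rule form_bound_small_support[OF fin A0nn(1) A0sym big_sub big_card A0sparse A0rows P])
         (use nonneg in \<open>auto simp: large_def\<close>)
    also have "\<dots> \<le> b * L2_set x I * L2_set y I"
      using b L2 by (intro mult_right_mono mult_left_mono) auto
    finally show ?thesis .
  qed
  have 2: "\<bar>bilin I E (rest x) (large y)\<bar> \<le> b * L2_set x I * L2_set y I"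
  proof -
    have "bilin I E (rest x) (large y) = bilin I (\<lambda>i j. A0 i j - P j i) (large y) (rest x)"
      by (subst bilin_transpose) (simp add: E_def A0sym)
    also have "\<bar>\<dots>\<bar> \<le> b * L2_set (large y) I * L2_set (rest x) I"
      unfolding b_def
      by (rule form_bound_small_support[OF fin A0nn(1) A0sym big_sub big_card A0sparse A0rows P])
         (use nonneg in \<open>auto simp: large_def\<close>)
    also have "\<dots> \<le> b * L2_set y I * L2_set x I"
      using b L2 by (intro mult_mono) auto
    finally show ?thesis by (simp add: mult_ac)
  qed
  have 3: "\<bar>bilin I E (rest x) (rest y)\<bar> \<le> (4 * \<mu> / \<sigma>) * D * L2_set x I * L2_set y I"
  proof -
    have "bilin I E (rest x) (rest y) = bilin I (\<lambda>i j. A i j - P i j) (rest x) (rest y)"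
      unfolding bilin_def by (intro sum.cong refl) (auto simp: E_def A0 rest_def big_def)
    also have "\<bar>\<dots>\<bar> \<le> lim x * lim y * (\<mu> * D * real (card I))"
      using lim_nn by (intro form_le_of_sign_vectors cut) (auto simp: rest_def big_def)
    also have "\<dots> = (4 * \<mu> / \<sigma>) * D * L2_set x I * L2_set y I"
    proof -
      have "sqrt (\<sigma> * n) * sqrt (\<sigma> * n) = \<sigma> * n" using n nonneg by simp
      then have "lim x * lim y = 4 * (L2_set x I * L2_set y I) / (\<sigma> * n)"
        by (simp add: lim_def)
      then show ?thesis using n nonneg by (simp add: n_def[symmetric] field_simps)
    qed
    finally show ?thesis .
  qed
  have "bilin I E x y = bilin I E (large x) y + (bilin I E (rest x) (large y) + bilin I E (rest x) (rest y))"
    using split[of x] split[of y] by (metis bilin_add_left bilin_add_right)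
  then have "\<bar>bilin I E x y\<bar> \<le> b * L2_set x I * L2_set y I + (b * L2_set x I * L2_set y I +
      (4 * \<mu> / \<sigma>) * D * L2_set x I * L2_set y I)"
    using 1 2 3 by linarith
  then show ?thesis unfolding E_def b_def by (simp add: algebra_simps)
qed

section \<open>Spectral clustering of a perturbed block matrix\<close>

text \<open>
  From \<open>l u = P u + (A - P) u\<close>, the vector \<open>u\<close> differs from \<open>P u / l\<close> by \<open>(A - P) u / l\<close>. For a block
  matrix \<open>P\<close> the vector \<open>P u / l\<close> is constant on blocks, so this takes the place of a
  perturbation theorem for eigenspaces.
\<close>

lemma eigenvector_near_image:
  fixes A P :: "'a \<Rightarrow> 'a \<Rightarrow> real"
  assumes bound: "\<And>x y. \<bar>bilin I (\<lambda>i j. A i j - P i j) x y\<bar> \<le> \<eta> * D * L2_set x I * L2_set y I"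
    and unit: "L2_set u I = 1"
    and eig: "\<And>i. i \<in> I \<Longrightarrow> (\<Sum>j\<in>I. A i j * u j) = l * u i"
    and l: "c * D \<le> l" "0 < c * D" and "0 \<le> \<eta> * D"
  shows "(\<Sum>i\<in>I. (u i - (\<Sum>j\<in>I. P i j * u j) / l)\<^sup>2) \<le> (\<eta> * D / (c * D))\<^sup>2"
proof -
  define r where "r i = l * u i - (\<Sum>j\<in>I. P i j * u j)" for i
  have "(L2_set r I)\<^sup>2 = bilin I (\<lambda>i j. A i j - P i j) r u"
  proof -
    have "(\<Sum>j\<in>I. (A i j - P i j) * u j) = r i" if "i \<in> I" for i
      using eig[OF that] by (simp add: r_def left_diff_distrib sum_subtractf)
    then have "(\<Sum>i\<in>I. (r i)\<^sup>2) = (\<Sum>i\<in>I. r i * (\<Sum>j\<in>I. (A i j - P i j) * u j))"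
      by (intro sum.cong) (auto simp: power2_eq_square)
    then show ?thesis by (simp add: L2_set_power2 bilin_def sum_distrib_left mult.assoc)
  qed
  also have "\<dots> \<le> \<eta> * D * L2_set r I" using bound[of r u] unit by simp
  finally have "L2_set r I \<le> \<eta> * D"
    using \<open>0 \<le> \<eta> * D\<close> L2_set_nonneg[of r I]
    by (cases "L2_set r I = 0") (auto simp: power2_eq_square)
  have "(\<Sum>i\<in>I. (u i - (\<Sum>j\<in>I. P i j * u j) / l)\<^sup>2) = (\<Sum>i\<in>I. (r i / l)\<^sup>2)"
    using l by (intro sum.cong refl) (simp add: r_def diff_divide_distrib)
  also have "\<dots> = (L2_set r I / l)\<^sup>2"
    by (simp add: power_divide sum_divide_distrib[symmetric] L2_set_power2)
  also have "\<dots> \<le> (\<eta> * D / (c * D))\<^sup>2"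
    using l \<open>L2_set r I \<le> \<eta> * D\<close> \<open>0 \<le> \<eta> * D\<close> by (intro power_mono frac_le) auto
  finally show ?thesis .
qed

lemma form_eigen_expansion:
  fixes A :: "nat \<Rightarrow> nat \<Rightarrow> real" and v :: "nat \<Rightarrow> nat \<Rightarrow> real"
  assumes complete: "\<And>i j. i < n \<Longrightarrow> j < n \<Longrightarrow> (\<Sum>k<n. v k i * v k j) = (if i = j then 1 else 0)"
    and eig: "\<And>k i. k < n \<Longrightarrow> i < n \<Longrightarrow> (\<Sum>j<n. A i j * v k j) = \<mu> k * v k i"
  shows "bilin {..<n} A x x = (\<Sum>k<n. \<mu> k * (\<Sum>i<n. v k i * x i)\<^sup>2)"
    and "(\<Sum>i<n. (x i)\<^sup>2) = (\<Sum>k<n. (\<Sum>i<n. v k i * x i)\<^sup>2)"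
proof -
  define p where "p k = (\<Sum>i<n. v k i * x i)" for k
  have x: "x j = (\<Sum>k<n. p k * v k j)" if "j < n" for j
  proof -
    have "(\<Sum>k<n. p k * v k j) = (\<Sum>i<n. (\<Sum>k<n. v k i * v k j) * x i)"
      unfolding p_def sum_distrib_right by (subst sum.swap) (simp add: mult_ac)
    also have "\<dots> = (\<Sum>i<n. if i = j then x i else 0)"
      by (rule sum.cong[OF refl]) (simp add: complete that)
    also have "\<dots> = x j" using that by simp
    finally show ?thesis by simp
  qed
  have Ax: "(\<Sum>j<n. A i j * x j) = (\<Sum>k<n. \<mu> k * p k * v k i)" if "i < n" for i
  proof -
    have "(\<Sum>j<n. A i j * x j) = (\<Sum>j<n. \<Sum>k<n. p k * (A i j * v k j))"
      by (intro sum.cong refl) (simp add: x sum_distrib_left mult_ac)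
    also have "\<dots> = (\<Sum>k<n. p k * (\<Sum>j<n. A i j * v k j))"
      by (subst sum.swap) (simp add: sum_distrib_left)
    also have "\<dots> = (\<Sum>k<n. \<mu> k * p k * v k i)"
      by (intro sum.cong refl) (simp add: eig that)
    finally show ?thesis .
  qed
  have "bilin {..<n} A x x = (\<Sum>i<n. x i * (\<Sum>j<n. A i j * x j))"
    by (simp add: bilin_def sum_distrib_left mult.assoc)
  also have "\<dots> = (\<Sum>i<n. \<Sum>k<n. \<mu> k * p k * (v k i * x i))"
  proof (intro sum.cong refl)
    fix i assume "i \<in> {..<n}"
    then have "x i * (\<Sum>j<n. A i j * x j) = x i * (\<Sum>k<n. \<mu> k * p k * v k i)" by (simp only: Ax lessThan_iff)
    then show "x i * (\<Sum>j<n. A i j * x j) = (\<Sum>k<n. \<mu> k * p k * (v k i * x i))"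
      by (simp only: sum_distrib_left mult_ac)
  qed
  also have "\<dots> = (\<Sum>k<n. \<mu> k * p k * p k)"
    by (subst sum.swap) (simp add: sum_distrib_left p_def)
  finally show "bilin {..<n} A x x = (\<Sum>k<n. \<mu> k * (\<Sum>i<n. v k i * x i)\<^sup>2)"
    by (simp add: p_def power2_eq_square mult.assoc)
  have "(\<Sum>i<n. (x i)\<^sup>2) = (\<Sum>i<n. \<Sum>k<n. p k * (v k i * x i))"
  proof (intro sum.cong refl)
    fix i assume "i \<in> {..<n}"
    then have "(x i)\<^sup>2 = x i * (\<Sum>k<n. p k * v k i)" by (simp only: x[symmetric] lessThan_iff power2_eq_square)
    then show "(x i)\<^sup>2 = (\<Sum>k<n. p k * (v k i * x i))"
      by (simp only: sum_distrib_left mult_ac)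
  qed
  also have "\<dots> = (\<Sum>k<n. p k * p k)"
    by (subst sum.swap) (simp add: sum_distrib_left p_def)
  finally show "(\<Sum>i<n. (x i)\<^sup>2) = (\<Sum>k<n. (\<Sum>i<n. v k i * x i)\<^sup>2)"
    by (simp add: p_def power2_eq_square)
qed

text \<open>
  The vectors that are constant on both groups form a plane, so one of them is orthogonal to the
  leading eigenvector. Its Rayleigh quotient is at most \<open>\<mu> 1\<close>, and at least \<open>c - \<eta>\<close>.
\<close>

lemma second_eigenvalue_ge:
  fixes A P :: "nat \<Rightarrow> nat \<Rightarrow> real" and v :: "nat \<Rightarrow> nat \<Rightarrow> real"
  assumes complete: "\<And>i j. i < n \<Longrightarrow> j < n \<Longrightarrow> (\<Sum>k<n. v k i * v k j) = (if i = j then 1 else 0)"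
    and eig: "\<And>k i. k < n \<Longrightarrow> i < n \<Longrightarrow> (\<Sum>j<n. A i j * v k j) = \<mu> k * v k i"
    and desc: "antimono_on {..<n} \<mu>"
    and bound: "\<And>x y. \<bar>bilin {..<n} (\<lambda>i j. A i j - P i j) x y\<bar> \<le> \<eta> * L2_set x {..<n} * L2_set y {..<n}"
    and g: "\<And>i. i < n \<Longrightarrow> g i \<in> {0, 1::nat}" "\<exists>i<n. g i = 0" "\<exists>i<n. g i = 1"
    and lower: "\<And>z. c * (\<Sum>i<n. (z (g i))\<^sup>2) \<le> bilin {..<n} P (\<lambda>i. z (g i)) (\<lambda>i. z (g i))"
    and k: "k < 2"
  shows "c - \<eta> \<le> \<mu> k"
proof -
  obtain i0 i1 where i01: "i0 < n" "g i0 = 0" "i1 < n" "g i1 = 1" using g by blast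
  have n2: "1 < n"
  proof (rule ccontr)
    assume "\<not> 1 < n"
    then have "i0 = i1" using i01 by linarith
    then show False using i01 by simp
  qed
  define a where "a b = (\<Sum>i | i < n \<and> g i = b. v 0 i)" for b
  \<comment> \<open>a combination of the group indicators orthogonal to \<open>v 0\<close>, or their sum if both are orthogonal to it\<close>
  define z :: "nat \<Rightarrow> real" where
    "z b = (if a 0 = 0 \<and> a 1 = 0 then 1 else if b = 0 then a 1 else - a 0)" for b
  define x where "x i = z (g i)" for i
  have sum_g: "(\<Sum>i<n. f i) = (\<Sum>i | i < n \<and> g i = 0. f i) + (\<Sum>i | i < n \<and> g i = 1. f i)" for f :: "nat \<Rightarrow> real"
    using g(1) by (subst sum.union_disjoint[symmetric]) (auto intro!: sum.cong)
  have orth: "(\<Sum>i<n. v 0 i * x i) = 0"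
  proof -
    have "(\<Sum>i | i < n \<and> g i = b. v 0 i * x i) = a b * z b" for b
      unfolding a_def sum_distrib_right by (rule sum.cong) (auto simp: x_def)
    then show ?thesis unfolding sum_g by (simp add: z_def)
  qed
  have "z 0 \<noteq> 0 \<or> z 1 \<noteq> 0" by (auto simp: z_def)
  then have "\<exists>i<n. x i \<noteq> 0" using i01 unfolding x_def by metis
  then have xpos: "(\<Sum>i<n. (x i)\<^sup>2) > 0" by (auto intro!: sum_pos2)
  have L2: "L2_set x {..<n} * L2_set x {..<n} = (\<Sum>i<n. (x i)\<^sup>2)"
    by (metis L2_set_power2 power2_eq_square)
  have "bilin {..<n} A x x = (\<Sum>k<n. \<mu> k * (\<Sum>i<n. v k i * x i)\<^sup>2)"
    by (rule form_eigen_expansion[OF complete eig])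
  also have "\<dots> \<le> (\<Sum>k<n. \<mu> 1 * (\<Sum>i<n. v k i * x i)\<^sup>2)"
  proof (rule sum_mono)
    fix k assume "k \<in> {..<n}"
    show "\<mu> k * (\<Sum>i<n. v k i * x i)\<^sup>2 \<le> \<mu> 1 * (\<Sum>i<n. v k i * x i)\<^sup>2"
    proof (cases "k = 0")
      case True then show ?thesis by (simp add: orth)
    next
      case False
      then have "\<mu> k \<le> \<mu> 1"
        using desc n2 \<open>k \<in> {..<n}\<close> by (intro monotone_onD[OF desc]) auto
      then show ?thesis by (rule mult_right_mono) simp
    qed
  qed
  also have "\<dots> = \<mu> 1 * (\<Sum>i<n. (x i)\<^sup>2)"
    using form_eigen_expansion(2)[OF complete eig, of x] by (simp add: sum_distrib_left)
  finally have 1: "bilin {..<n} A x x \<le> \<mu> 1 * (\<Sum>i<n. (x i)\<^sup>2)" .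
  have 2: "c * (\<Sum>i<n. (x i)\<^sup>2) \<le> bilin {..<n} P x x"
    using lower[of z] by (simp add: x_def[abs_def])
  have 3: "\<bar>bilin {..<n} A x x - bilin {..<n} P x x\<bar> \<le> \<eta> * (\<Sum>i<n. (x i)\<^sup>2)"
    using bound[of x x] by (simp add: bilin_diff L2 mult.assoc)
  have "(c - \<eta>) * (\<Sum>i<n. (x i)\<^sup>2) \<le> \<mu> 1 * (\<Sum>i<n. (x i)\<^sup>2)"
    unfolding left_diff_distrib using 1 2 3 by linarith
  then have "c - \<eta> \<le> \<mu> 1" using xpos by simp
  also have "\<mu> 1 \<le> \<mu> k" using k n2 by (intro monotone_onD[OF desc]) auto
  finally show ?thesis .
qed

abbreviation misplaced :: "nat \<Rightarrow> (nat \<Rightarrow> nat) \<Rightarrow> (nat \<Rightarrow> nat) \<Rightarrow> (nat \<Rightarrow> nat) \<Rightarrow> nat set" where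
  "misplaced n g \<pi> \<Phi> \<equiv> {i\<in>{..<n}. g i \<noteq> \<pi> (\<Phi> i)}"

text \<open>
  Some unit combination \<open>w\<close> of the two columns is orthogonal to \<open>m 1\<close>. If \<open>m 0\<close> and \<open>m 1\<close> were close,
  the corresponding combination of the columns of \<open>u\<close> would be close to \<open>0\<close>, although
  orthonormality gives it norm \<open>1\<close>.
\<close>

lemma center_separation:
  fixes u m :: "nat \<Rightarrow> nat \<Rightarrow> real"
  assumes g: "\<And>i. i < n \<Longrightarrow> g i \<in> {0, 1::nat}"
    and u: "(\<Sum>i<n. (u i 0)\<^sup>2) = 1" "(\<Sum>i<n. (u i 1)\<^sup>2) = 1" "(\<Sum>i<n. u i 0 * u i 1) = 0"
    and K: "(\<Sum>i<n. \<Sum>c<2. (u i c - m (g i) c)\<^sup>2) \<le> K" "K \<le> 1/8"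
  shows "1 \<le> 4 * real n * (\<Sum>c<2. (m 0 c - m 1 c)\<^sup>2)"
proof -
  have two: "(\<Sum>c<2. f c) = f 0 + f 1" for f :: "nat \<Rightarrow> real" by (simp add: numeral_2_eq_2)
  define \<Delta> where "\<Delta> = (\<Sum>c<2. (m 0 c - m 1 c)\<^sup>2)"
  define h where "h = sqrt ((m 1 0)\<^sup>2 + (m 1 1)\<^sup>2)"
  \<comment> \<open>\<open>m 1\<close> rotated by a right angle and normalised\<close>
  define w0 where "w0 = (if h = 0 then 1 else - m 1 1 / h)"
  define w1 where "w1 = (if h = 0 then 0 else m 1 0 / h)"
  have h2: "h\<^sup>2 = (m 1 0)\<^sup>2 + (m 1 1)\<^sup>2" by (simp add: h_def)
  have w: "w0\<^sup>2 + w1\<^sup>2 = 1"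
    using h2 by (auto simp: w0_def w1_def power_divide add_divide_distrib[symmetric] add.commute)
  have w_orth: "w0 * m 1 0 + w1 * m 1 1 = 0"
    using h2 by (auto simp: w0_def w1_def field_simps)
  have CS: "(w0 * p + w1 * q)\<^sup>2 \<le> p\<^sup>2 + q\<^sup>2" for p q
  proof -
    have "(w0\<^sup>2 + w1\<^sup>2) * (p\<^sup>2 + q\<^sup>2) - (w0 * p + w1 * q)\<^sup>2 = (w0 * q - w1 * p)\<^sup>2"
      by (simp add: power2_eq_square algebra_simps)
    then have "0 \<le> p\<^sup>2 + q\<^sup>2 - (w0 * p + w1 * q)\<^sup>2" by (simp only: w mult_1_left zero_le_power2)
    then show ?thesis by (simp only: diff_ge_0_iff_ge)
  qed
  have "1 = (\<Sum>i<n. (w0 * u i 0 + w1 * u i 1)\<^sup>2)"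
  proof -
    have "(\<Sum>i<n. (w0 * u i 0 + w1 * u i 1)\<^sup>2) =
        (\<Sum>i<n. w0\<^sup>2 * (u i 0)\<^sup>2 + w1\<^sup>2 * (u i 1)\<^sup>2 + 2 * w0 * w1 * (u i 0 * u i 1))"
      by (intro sum.cong refl) (simp add: power2_eq_square algebra_simps)
    also have "\<dots> = w0\<^sup>2 * (\<Sum>i<n. (u i 0)\<^sup>2) + w1\<^sup>2 * (\<Sum>i<n. (u i 1)\<^sup>2) + 2 * w0 * w1 * (\<Sum>i<n. u i 0 * u i 1)"
      by (simp add: sum.distrib sum_distrib_left)
    finally show ?thesis using u w by simp
  qed
  also have "\<dots> \<le> (\<Sum>i<n. 2 * (\<Sum>c<2. (u i c - m (g i) c)\<^sup>2) + 2 * \<Delta>)"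
  proof (rule sum_mono)
    fix i assume "i \<in> {..<n}"
    define p where "p = w0 * (u i 0 - m (g i) 0) + w1 * (u i 1 - m (g i) 1)"
    define q where "q = w0 * m (g i) 0 + w1 * m (g i) 1"
    have "q\<^sup>2 \<le> \<Delta>"
    proof (cases "g i = 0")
      case True
      then have "q = w0 * (m 0 0 - m 1 0) + w1 * (m 0 1 - m 1 1)"
        using w_orth by (simp add: q_def algebra_simps)
      then show ?thesis using CS[of "m 0 0 - m 1 0" "m 0 1 - m 1 1"] by (simp add: \<Delta>_def two)
    next
      case False
      then have "g i = 1" using g[of i] \<open>i \<in> {..<n}\<close> by auto
      then have "q = 0" using w_orth by (simp add: q_def)
      then show ?thesis by (simp add: \<Delta>_def sum_nonneg)
    qed
    moreover have "p\<^sup>2 \<le> (\<Sum>c<2. (u i c - m (g i) c)\<^sup>2)"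
      unfolding p_def two by (rule CS)
    moreover have "(w0 * u i 0 + w1 * u i 1)\<^sup>2 = (p + q)\<^sup>2" by (simp add: p_def q_def algebra_simps)
    moreover have "(p + q)\<^sup>2 \<le> 2 * p\<^sup>2 + 2 * q\<^sup>2"
      using zero_le_power2[of "p - q"] by (simp add: power2_eq_square algebra_simps)
    ultimately show "(w0 * u i 0 + w1 * u i 1)\<^sup>2 \<le> 2 * (\<Sum>c<2. (u i c - m (g i) c)\<^sup>2) + 2 * \<Delta>" by linarith
  qed
  also have "\<dots> \<le> 2 * K + 2 * real n * \<Delta>"
    using K(1) by (simp add: sum.distrib sum_distrib_left[symmetric])
  finally show ?thesis using K(2) unfolding \<Delta>_def[symmetric] by simp
qed

text \<open>
  By the separation of \<open>m 0\<close> and \<open>m 1\<close>, only few nodes have a cluster center further than half the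
  separation from the value of their group. Two nodes from different groups that are not
  among these cannot share a cluster, and each group contains such a node; so the two clusters
  are matched with the two groups.
\<close>

lemma two_means_recovers_groups:
  fixes u m cen :: "nat \<Rightarrow> nat \<Rightarrow> real"
  assumes g: "\<And>i. i < n \<Longrightarrow> g i \<in> {0, 1::nat}" and \<Phi>: "\<And>i. i < n \<Longrightarrow> \<Phi> i \<in> {0, 1::nat}"
    and u: "(\<Sum>i<n. (u i 0)\<^sup>2) = 1" "(\<Sum>i<n. (u i 1)\<^sup>2) = 1" "(\<Sum>i<n. u i 0 * u i 1) = 0"
    and K: "(\<Sum>i<n. \<Sum>c<2. (u i c - m (g i) c)\<^sup>2) \<le> K" "K \<le> 1/8"
    and L: "(\<Sum>i<n. \<Sum>c<2. (u i c - cen (\<Phi> i) c)\<^sup>2) \<le> L"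
    and size: "\<And>b. b \<in> {0, 1} \<Longrightarrow> 32 * (K + L) * real n < real (card {i\<in>{..<n}. g i = b})"
  shows "\<exists>\<pi>. \<pi> permutes {0, 1::nat} \<and> real (card (misplaced n g \<pi> \<Phi>)) \<le> 32 * (K + L) * real n"
proof -
  define \<Delta> where "\<Delta> = (\<Sum>c<2. (m 0 c - m 1 c)\<^sup>2)"
  have sep: "1 \<le> 4 * real n * \<Delta>" unfolding \<Delta>_def by (rule center_separation[OF g u K])
  define dev where "dev i = (\<Sum>c<2. (cen (\<Phi> i) c - m (g i) c)\<^sup>2)" for i
  have dev_nn: "0 \<le> dev i" for i by (simp add: dev_def sum_nonneg)
  have \<Delta>_nn: "0 \<le> \<Delta>" by (simp add: \<Delta>_def sum_nonneg)
  define Bad where "Bad = {i\<in>{..<n}. \<Delta> / 4 \<le> dev i}"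
  have sq: "(p - q)\<^sup>2 \<le> 2 * (r - p)\<^sup>2 + 2 * (r - q)\<^sup>2" for p q r :: real
    using zero_le_power2[of "(r - p) + (r - q)"] by (simp add: power2_eq_square algebra_simps)
  have "(\<Sum>i<n. dev i) \<le> 2 * (K + L)"
  proof -
    have "(\<Sum>i<n. dev i) \<le> (\<Sum>i<n. \<Sum>c<2. 2 * (u i c - cen (\<Phi> i) c)\<^sup>2 + 2 * (u i c - m (g i) c)\<^sup>2)"
      unfolding dev_def by (intro sum_mono sq)
    also have "\<dots> = 2 * (\<Sum>i<n. \<Sum>c<2. (u i c - cen (\<Phi> i) c)\<^sup>2) + 2 * (\<Sum>i<n. \<Sum>c<2. (u i c - m (g i) c)\<^sup>2)"
      by (simp add: sum.distrib sum_distrib_left)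
    finally show ?thesis using K(1) L by simp
  qed
  moreover have "real (card Bad) * (\<Delta> / 4) \<le> (\<Sum>i<n. dev i)"
  proof -
    have "real (card Bad) * (\<Delta> / 4) = (\<Sum>i\<in>Bad. \<Delta> / 4)" by simp
    also have "\<dots> \<le> (\<Sum>i\<in>Bad. dev i)" by (intro sum_mono) (auto simp: Bad_def)
    also have "\<dots> \<le> (\<Sum>i<n. dev i)" by (intro sum_mono2) (auto simp: Bad_def dev_nn)
    finally show ?thesis .
  qed
  ultimately have "real (card Bad) * \<Delta> \<le> 8 * (K + L)" by simp
  then have "real (card Bad) * \<Delta> * (4 * real n) \<le> 8 * (K + L) * (4 * real n)"
    by (intro mult_right_mono) auto
  moreover have "real (card Bad) * 1 \<le> real (card Bad) * (4 * real n * \<Delta>)"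
    using sep by (intro mult_left_mono) auto
  ultimately have bad: "real (card Bad) \<le> 32 * (K + L) * real n" by (simp add: mult_ac)
  have good: "\<exists>i<n. i \<notin> Bad \<and> g i = b" if "b \<in> {0, 1}" for b
  proof (rule ccontr)
    assume "\<not> ?thesis"
    then have "{i\<in>{..<n}. g i = b} \<subseteq> Bad" by blast
    then have "card {i\<in>{..<n}. g i = b} \<le> card Bad" by (intro card_mono) (auto simp: Bad_def)
    then show False using size[OF that] bad by linarith
  qed
  have diff: "\<Phi> i \<noteq> \<Phi> j" if "i < n" "j < n" "i \<notin> Bad" "j \<notin> Bad" "g i = 0" "g j = 1" for i j
  proof
    assume eq: "\<Phi> i = \<Phi> j"
    have "\<Delta> \<le> (\<Sum>c<2. 2 * (cen (\<Phi> i) c - m 0 c)\<^sup>2 + 2 * (cen (\<Phi> i) c - m 1 c)\<^sup>2)"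
      unfolding \<Delta>_def by (intro sum_mono sq)
    also have "\<dots> = 2 * dev i + 2 * dev j"
      using that eq by (simp add: dev_def sum.distrib sum_distrib_left)
    also have "\<dots> < \<Delta>" using that by (auto simp: Bad_def)
    finally show False by simp
  qed
  obtain i0 i1 where i01: "i0 < n" "i0 \<notin> Bad" "g i0 = 0" "i1 < n" "i1 \<notin> Bad" "g i1 = 1"
    using good[of 0] good[of 1] by auto
  define \<pi> :: "nat \<Rightarrow> nat" where "\<pi> = (if \<Phi> i0 = 0 then id else Transposition.transpose 0 1)"
  have perm: "\<pi> permutes {0, 1}" by (auto simp: \<pi>_def permutes_id intro: permutes_swap_id)
  have "misplaced n g \<pi> \<Phi> \<subseteq> Bad"
  proof (rule subsetI, rule ccontr)
    fix i assume i: "i \<in> (misplaced n g \<pi> \<Phi>)" "i \<notin> Bad"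
    then have "\<Phi> i0 \<noteq> \<Phi> i1" "g i = 0 \<Longrightarrow> \<Phi> i \<noteq> \<Phi> i1" "g i = 1 \<Longrightarrow> \<Phi> i0 \<noteq> \<Phi> i"
      using diff i01 by auto
    moreover have "g i \<in> {0, 1}" "\<Phi> i \<in> {0, 1}" "\<Phi> i0 \<in> {0, 1}" "\<Phi> i1 \<in> {0, 1}"
      using g \<Phi> i i01 by auto
    ultimately show False using i by (auto simp: \<pi>_def split: if_splits)
  qed
  then have "card (misplaced n g \<pi> \<Phi>) \<le> card Bad" by (intro card_mono) (auto simp: Bad_def)
  with bad perm show ?thesis by (intro exI[of _ \<pi>]) auto
qed


text \<open>
  The mean is the best center. So the cost of a partition can be bounded with any
  other choice of centers.
\<close>

lemma sum_sq_dev_mean_le: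
  fixes x :: "'a \<Rightarrow> real"
  assumes "finite C"
  shows "(\<Sum>i\<in>C. (x i - 1 / real (card C) * (\<Sum>l\<in>C. x l))\<^sup>2) \<le> (\<Sum>i\<in>C. (x i - m)\<^sup>2)"
proof (cases "C = {}")
  case False
  define \<mu> where "\<mu> = 1 / real (card C) * (\<Sum>l\<in>C. x l)"
  have sum: "(\<Sum>l\<in>C. x l) = real (card C) * \<mu>"
    using False assms by (simp add: \<mu>_def)
  have "(\<Sum>i\<in>C. (x i - m)\<^sup>2) = (\<Sum>i\<in>C. (x i - \<mu>)\<^sup>2 + 2 * (\<mu> - m) * x i + (m\<^sup>2 - \<mu>\<^sup>2))"
    by (intro sum.cong refl) (simp add: power2_eq_square algebra_simps)
  also have "\<dots> = (\<Sum>i\<in>C. (x i - \<mu>)\<^sup>2) + 2 * (\<mu> - m) * (\<Sum>i\<in>C. x i) + real (card C) * (m\<^sup>2 - \<mu>\<^sup>2)"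
    by (simp add: sum.distrib sum_distrib_left)
  also have "\<dots> = (\<Sum>i\<in>C. (x i - \<mu>)\<^sup>2) + real (card C) * (\<mu> - m)\<^sup>2"
    unfolding sum by (simp add: power2_eq_square algebra_simps)
  finally show ?thesis unfolding \<mu>_def[symmetric] by simp
qed simp

lemma kmeans_cost_le_centers:
  "kmeans_cost U k \<Phi> \<le> (\<Sum>j<k. \<Sum>i\<in>{i\<in>{..<dim_row U}. \<Phi> i = j}. \<Sum>c<dim_col U. (U $$ (i, c) - m j c)\<^sup>2)"
  unfolding kmeans_cost_def Let_def
  by (rule sum_mono, subst (1 2) sum.swap, intro sum_mono sum_sq_dev_mean_le) simp

lemma sum_by_labels:
  fixes f :: "nat \<Rightarrow> nat \<Rightarrow> real"
  assumes "\<Phi> \<in> {..<n} \<rightarrow> {..<k}"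
  shows "(\<Sum>j<k. \<Sum>i\<in>{i\<in>{..<n}. \<Phi> i = j}. f j i) = (\<Sum>i<n. f (\<Phi> i) i)"
proof -
  have "(\<Sum>j<k. \<Sum>i\<in>{i\<in>{..<n}. \<Phi> i = j}. f j i) = (\<Sum>j<k. \<Sum>i\<in>{i\<in>{..<n}. \<Phi> i = j}. f (\<Phi> i) i)"
    by (intro sum.cong) auto
  also have "\<dots> = (\<Sum>i<n. f (\<Phi> i) i)"
    using assms by (intro sum.group) auto
  finally show ?thesis .
qed

text \<open>
  The partition into the groups is a candidate for the minimum.
\<close>

lemma approx_kmeans_centers:
  assumes km: "approx_kmeans \<epsilon> U 2 \<Phi>" and "0 < \<epsilon>" and dims: "dim_row U = n" "dim_col U = 2"
    and g: "\<And>i. i < n \<Longrightarrow> g i \<in> {0, 1::nat}"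
    and K: "(\<Sum>i<n. \<Sum>c<2. (U $$ (i, c) - m (g i) c)\<^sup>2) \<le> K"
  shows "\<exists>cen. (\<Sum>i<n. \<Sum>c<2. (U $$ (i, c) - cen (\<Phi> i) c)\<^sup>2) \<le> (1 + \<epsilon>) * K"
proof -
  have \<Phi>: "\<Phi> \<in> {..<n} \<rightarrow> {..<2}" using km dims by (simp add: approx_kmeans_def)
  define g' where "g' = restrict g {..<n}"
  have g': "g' \<in> {..<n} \<rightarrow>\<^sub>E {..<2}" using g by (force simp: g'_def)
  define cen where "cen j c = 1 / real (card {i\<in>{..<n}. \<Phi> i = j}) * (\<Sum>l\<in>{i\<in>{..<n}. \<Phi> i = j}. U $$ (l, c))" for j c
  have "(\<Sum>i<n. \<Sum>c<2. (U $$ (i, c) - cen (\<Phi> i) c)\<^sup>2) = kmeans_cost U 2 \<Phi>"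
    unfolding kmeans_cost_def Let_def dims cen_def[symmetric] by (rule sum_by_labels[OF \<Phi>, symmetric])
  also have "\<dots> \<le> (1 + \<epsilon>) * Min (kmeans_cost U 2 ` ({..<n} \<rightarrow>\<^sub>E {..<2}))"
    using km dims by (simp add: approx_kmeans_def)
  also have "\<dots> \<le> (1 + \<epsilon>) * kmeans_cost U 2 g'"
    using \<open>0 < \<epsilon>\<close> g' by (intro mult_left_mono Min_le finite_imageI finite_PiE imageI) auto
  also have "kmeans_cost U 2 g' \<le> (\<Sum>i<n. \<Sum>c<2. (U $$ (i, c) - m (g' i) c)\<^sup>2)"
    using kmeans_cost_le_centers[of U 2 g' m] g' by (subst (asm) sum_by_labels) (auto simp: dims)
  also have "\<dots> = (\<Sum>i<n. \<Sum>c<2. (U $$ (i, c) - m (g i) c)\<^sup>2)"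
    by (intro sum.cong refl) (simp add: g'_def)
  also note K
  finally show ?thesis using \<open>0 < \<epsilon>\<close> by (auto simp: mult_left_mono)
qed

text \<open>
  Orthonormality of the columns of a square matrix entails that of the rows, that is,
  completeness of the eigenbasis.
\<close>

lemma top_eigenvectorsE:
  assumes "top_eigenvectors (mat n n (\<lambda>(i, j). A i j)) k U" "k \<le> n"
  obtains v \<mu> where "\<And>i j. i < n \<Longrightarrow> j < n \<Longrightarrow> (\<Sum>k<n. v k i * v k j) = (if i = j then 1 else 0)"
    and "\<And>k l. k < n \<Longrightarrow> l < n \<Longrightarrow> (\<Sum>i<n. v k i * v l i) = (if k = l then 1 else 0)"
    and "\<And>k i. k < n \<Longrightarrow> i < n \<Longrightarrow> (\<Sum>j<n. A i j * v k j) = \<mu> k * v k i"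
    and "antimono_on {..<n} \<mu>" and "U = mat n k (\<lambda>(i, c). v c i)"
proof -
  let ?A = "mat n n (\<lambda>(i, j). A i j)"
  obtain V \<mu> where V: "V \<in> carrier_mat n n" "transpose_mat V * V = 1\<^sub>m n"
      "\<forall>j<n. eigenvector ?A (Matrix.col V j) (\<mu> j)" "antimono_on {..<n} \<mu>"
      "U = mat n k (\<lambda>(i, j). V $$ (i, j))"
    using assms(1) unfolding top_eigenvectors_def dim_row_mat by blast
  have V': "V * transpose_mat V = 1\<^sub>m n"
    by (rule mat_mult_left_right_inverse[OF _ _ V(2)]) (use V(1) in auto)
  show ?thesis
  proof (rule that[of "\<lambda>k i. V $$ (i, k)" \<mu>])
    fix i j assume ij: "i < n" "j < n"
    have "(V * transpose_mat V) $$ (i, j) = (\<Sum>k<n. V $$ (i, k) * V $$ (j, k))"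
      using V(1) ij by (simp add: scalar_prod_def lessThan_atLeast0)
    then show "(\<Sum>k<n. V $$ (i, k) * V $$ (j, k)) = (if i = j then 1 else 0)"
      using ij by (simp add: V')
    have "(transpose_mat V * V) $$ (i, j) = (\<Sum>k<n. V $$ (k, i) * V $$ (k, j))"
      using V(1) ij by (simp add: scalar_prod_def lessThan_atLeast0)
    then show "(\<Sum>k<n. V $$ (k, i) * V $$ (k, j)) = (if i = j then 1 else 0)"
      using ij by (simp add: V(2))
    have "?A *\<^sub>v Matrix.col V i = \<mu> i \<cdot>\<^sub>v Matrix.col V i"
      using V(3) ij by (simp add: eigenvector_def)
    then have "(?A *\<^sub>v Matrix.col V i) $ j = (\<mu> i \<cdot>\<^sub>v Matrix.col V i) $ j" by simp
    then show "(\<Sum>k<n. A j k * V $$ (k, i)) = \<mu> i * V $$ (j, i)"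
      using V(1) ij by (simp add: scalar_prod_def lessThan_atLeast0)
  qed (use V in auto)
qed

lemma hsc_recovers_groups:
  fixes A B :: "nat \<Rightarrow> nat \<Rightarrow> real"
  assumes eig: "top_eigenvectors (mat n n (\<lambda>(i, j). A i j)) 2 U" and km: "approx_kmeans \<epsilon> U 2 \<Phi>"
    and "0 < \<epsilon>" "2 \<le> n" "0 < D" "0 < c" "0 \<le> \<eta>" "2 * \<eta> \<le> c"
    and g: "\<And>i. i < n \<Longrightarrow> g i \<in> {0, 1::nat}"
    and bound: "\<And>x y. \<bar>bilin {..<n} (\<lambda>i j. A i j - B (g i) (g j)) x y\<bar> \<le> \<eta> * D * L2_set x {..<n} * L2_set y {..<n}"
    and lower: "\<And>z. c * D * (\<Sum>i<n. (z (g i))\<^sup>2) \<le>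
         bilin {..<n} (\<lambda>i j. B (g i) (g j)) (\<lambda>i. z (g i)) (\<lambda>i. z (g i))"
    and K: "K = 8 * (\<eta> / c)\<^sup>2" "K \<le> 1/8"
    and size: "\<And>b. b \<in> {0, 1} \<Longrightarrow> 32 * (2 + \<epsilon>) * K * real n < real (card {i\<in>{..<n}. g i = b})"
  shows "\<exists>\<pi>. \<pi> permutes {0, 1::nat} \<and> real (card (misplaced n g \<pi> \<Phi>)) \<le> 32 * (2 + \<epsilon>) * K * real n"
proof -
  obtain v \<mu> where complete: "\<And>i j. i < n \<Longrightarrow> j < n \<Longrightarrow> (\<Sum>k<n. v k i * v k j) = (if i = j then 1 else 0)"
    and orth: "\<And>k l. k < n \<Longrightarrow> l < n \<Longrightarrow> (\<Sum>i<n. v k i * v l i) = (if k = l then 1 else 0)"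
    and ev: "\<And>k i. k < n \<Longrightarrow> i < n \<Longrightarrow> (\<Sum>j<n. A i j * v k j) = \<mu> k * v k i"
    and desc: "antimono_on {..<n} \<mu>" and U: "U = mat n 2 (\<lambda>(i, c). v c i)"
    by (rule top_eigenvectorsE[OF eig \<open>2 \<le> n\<close>]) blast
  have K0: "0 \<le> K" using K by simp
  have nonempty: "\<exists>i<n. g i = b" if "b \<in> {0, 1}" for b
  proof (rule ccontr)
    assume "\<not> ?thesis"
    then have "card {i\<in>{..<n}. g i = b} = 0" by (auto simp: card_eq_0_iff)
    moreover have "0 \<le> 32 * (2 + \<epsilon>) * K * real n" using K0 \<open>0 < \<epsilon>\<close> by simp
    ultimately show False using size[OF that] by linarith
  qed
  have \<mu>: "c / 2 * D \<le> \<mu> k" if "k < 2" for k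
  proof -
    have "c * D - \<eta> * D \<le> \<mu> k"
      by (rule second_eigenvalue_ge[where n = n and v = v and A = A and g = g and P = "\<lambda>i j. B (g i) (g j)"])
         (use complete ev desc bound g lower that nonempty in auto)
    moreover have "c / 2 * D \<le> (c - \<eta>) * D"
      using \<open>2 * \<eta> \<le> c\<close> \<open>0 < D\<close> by (intro mult_right_mono) auto
    ultimately show ?thesis by (simp add: algebra_simps)
  qed
  \<comment> \<open>the images of the eigenvectors under the rescaled expected matrix are constant on groups\<close>
  define m where "m b k = (\<Sum>j<n. B b (g j) * v k j) / \<mu> k" for b k
  have near: "(\<Sum>i<n. (v k i - m (g i) k)\<^sup>2) \<le> (2 * \<eta> / c)\<^sup>2" if "k < 2" for k
  proof -
    have kn: "k < n" using that \<open>2 \<le> n\<close> by simp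
    have "(\<Sum>i<n. (v k i)\<^sup>2) = 1" using orth[OF kn kn] by (simp add: power2_eq_square)
    then have unit: "L2_set (v k) {..<n} = 1" by (simp add: L2_set_def)
    have "(\<Sum>i<n. (v k i - (\<Sum>j<n. B (g i) (g j) * v k j) / \<mu> k)\<^sup>2) \<le> (\<eta> * D / (c / 2 * D))\<^sup>2"
      by (rule eigenvector_near_image[where A = A and P = "\<lambda>i j. B (g i) (g j)", OF bound unit _ \<mu>[OF that]])
         (use ev kn \<open>0 < D\<close> \<open>0 < c\<close> \<open>0 \<le> \<eta>\<close> in auto)
    then show ?thesis using \<open>0 < D\<close> by (simp add: m_def mult.commute)
  qed
  have Kb: "(\<Sum>i<n. \<Sum>k<2. (v k i - m (g i) k)\<^sup>2) \<le> K"
  proof -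
    have "(\<Sum>i<n. \<Sum>k<2. (v k i - m (g i) k)\<^sup>2) = (\<Sum>k<2. \<Sum>i<n. (v k i - m (g i) k)\<^sup>2)"
      by (rule sum.swap)
    also have "\<dots> \<le> (\<Sum>k<(2::nat). (2 * \<eta> / c)\<^sup>2)" by (intro sum_mono near) auto
    also have "\<dots> = K" by (simp add: K(1) power_divide power_mult_distrib)
    finally show ?thesis .
  qed
  have Ueq: "U $$ (i, k) = v k i" if "i < n" "k < 2" for i k using that by (simp add: U)
  have "(\<Sum>i<n. \<Sum>k<2. (U $$ (i, k) - m (g i) k)\<^sup>2) \<le> K"
    using Kb by (simp add: Ueq)
  from approx_kmeans_centers[OF km \<open>0 < \<epsilon>\<close> _ _ g this] obtain cen where
    cen: "(\<Sum>i<n. \<Sum>k<2. (U $$ (i, k) - cen (\<Phi> i) k)\<^sup>2) \<le> (1 + \<epsilon>) * K"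
    by (auto simp: U)
  have \<Phi>: "\<Phi> i \<in> {0, 1}" if "i < n" for i
  proof -
    have "\<Phi> i < 2" using km that by (auto simp: approx_kmeans_def U)
    then show ?thesis by auto
  qed
  have *: "K + (1 + \<epsilon>) * K = (2 + \<epsilon>) * K" by (simp add: algebra_simps)
  have "\<exists>\<pi>. \<pi> permutes {0, 1::nat} \<and>
      real (card (misplaced n g \<pi> \<Phi>)) \<le> 32 * (K + (1 + \<epsilon>) * K) * real n"
  proof (rule two_means_recovers_groups[where u = "\<lambda>i k. v k i"])
    show "(\<Sum>i<n. \<Sum>k<2. (v k i - cen (\<Phi> i) k)\<^sup>2) \<le> (1 + \<epsilon>) * K" using cen by (simp add: Ueq)
    show "(\<Sum>i<n. (v 0 i)\<^sup>2) = 1" "(\<Sum>i<n. (v 1 i)\<^sup>2) = 1" "(\<Sum>i<n. v 0 i * v 1 i) = 0"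
      using orth[of 0 0] orth[of 1 1] orth[of 0 1] \<open>2 \<le> n\<close> by (auto simp: power2_eq_square)
    show "32 * (K + (1 + \<epsilon>) * K) * real n < real (card {i\<in>{..<n}. g i = b})" if "b \<in> {0, 1}" for b
      using size[OF that] by (simp only: * mult.assoc)
  qed (use g \<Phi> Kb K(2) in auto)
  then show ?thesis by (simp only: * mult.assoc)
qed

section \<open>Tail bounds for independent observations\<close>

text \<open>
  Markov's inequality for the exponential of a sum of independent variables. All tail bounds below
  are instances.
\<close>

lemma prob_sum_ge_le_exp:
  fixes p :: "'a \<Rightarrow> 'b pmf" and h :: "'a \<Rightarrow> 'b \<Rightarrow> real"
  assumes A: "finite A" and fin: "\<And>e. e \<in> A \<Longrightarrow> finite (set_pmf (p e))"
  shows "measure_pmf.prob (Pi_pmf A dflt p) {f. t \<le> (\<Sum>e\<in>A. h e (f e))} \<le>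
    exp (- t) * (\<Prod>e\<in>A. measure_pmf.expectation (p e) (\<lambda>x. exp (h e x)))"
proof -
  let ?M = "Pi_pmf A dflt p"
  have fin_M: "finite (set_pmf ?M)"
    using A fin by (simp add: set_Pi_pmf finite_PiE_dflt)
  have "measure_pmf.prob ?M {f. t \<le> (\<Sum>e\<in>A. h e (f e))} =
      measure_pmf.expectation ?M (indicator {f. t \<le> (\<Sum>e\<in>A. h e (f e))})" by simp
  also have "\<dots> \<le> measure_pmf.expectation ?M (\<lambda>f. exp (- t) * (\<Prod>e\<in>A. exp (h e (f e))))"
  proof (rule integral_mono)
    fix f :: "'a \<Rightarrow> 'b"
    have "exp (- t) * (\<Prod>e\<in>A. exp (h e (f e))) = exp ((\<Sum>e\<in>A. h e (f e)) - t)"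
      using A by (simp add: exp_sum exp_minus exp_diff field_simps)
    then show "indicator {f. t \<le> (\<Sum>e\<in>A. h e (f e))} f \<le> exp (- t) * (\<Prod>e\<in>A. exp (h e (f e)))"
      by (auto simp: indicator_def)
  qed (use fin_M in \<open>auto intro: integrable_measure_pmf_finite\<close>)
  also have "\<dots> = exp (- t) * measure_pmf.expectation ?M (\<lambda>f. \<Prod>e\<in>A. exp (h e (f e)))" by simp
  also have "measure_pmf.expectation ?M (\<lambda>f. \<Prod>e\<in>A. exp (h e (f e))) =
      (\<Prod>e\<in>A. measure_pmf.expectation (p e) (\<lambda>x. exp (h e x)))"
    using fin by (intro expectation_prod_Pi_pmf A integrable_measure_pmf_finite) auto
  finally show ?thesis .
qed

lemma bernoulli_family_tail:
  assumes A: "finite A" and p: "\<And>e. e \<in> A \<Longrightarrow> 0 \<le> p e \<and> p e \<le> 1"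
  shows "measure_pmf.prob (Pi_pmf A False (\<lambda>e. bernoulli_pmf (p e))) {f. t \<le> (\<Sum>e\<in>A. c e * of_bool (f e))}
    \<le> exp (- t + (\<Sum>e\<in>A. p e * (exp (c e) - 1)))"
proof -
  let ?m = "\<lambda>e. measure_pmf.expectation (bernoulli_pmf (p e)) (\<lambda>b. exp (c e * of_bool b))"
  have "measure_pmf.prob (Pi_pmf A False (\<lambda>e. bernoulli_pmf (p e))) {f. t \<le> (\<Sum>e\<in>A. c e * of_bool (f e))}
     \<le> exp (- t) * (\<Prod>e\<in>A. ?m e)"
    by (rule prob_sum_ge_le_exp[OF A]) (rule finite_subset[OF subset_UNIV finite])
  also have "(\<Prod>e\<in>A. ?m e)
      \<le> (\<Prod>e\<in>A. exp (p e * (exp (c e) - 1)))"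
  proof (rule prod_mono)
    fix e assume "e \<in> A"
    then have "?m e = 1 + p e * (exp (c e) - 1)"
      using p[OF \<open>e \<in> A\<close>] by (subst integral_bernoulli_pmf) (auto simp: algebra_simps)
    moreover have "0 \<le> ?m e"
      by (intro Bochner_Integration.integral_nonneg) auto
    ultimately show "0 \<le> ?m e \<and>
        ?m e \<le> exp (p e * (exp (c e) - 1))"
      using exp_ge_add_one_self[of "p e * (exp (c e) - 1)"] by linarith
  qed
  also have "exp (- t) * (\<Prod>e\<in>A. exp (p e * (exp (c e) - 1))) = exp (- t + (\<Sum>e\<in>A. p e * (exp (c e) - 1)))"
    using A by (simp only: exp_sum exp_add)
  finally show ?thesis by simp
qed

lemma exp_le_quadratic:
  fixes x :: real
  assumes "\<bar>x\<bar> \<le> 1"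
  shows "exp x \<le> 1 + x + x\<^sup>2"
proof (cases "0 \<le> x")
  case True then show ?thesis using assms by (intro exp_bound) auto
next
  case False
  define y where "y = - x"
  have y: "0 < y" using False by (simp add: y_def)
  have "exp x = inverse (exp y)" by (simp add: y_def exp_minus)
  also have "\<dots> \<le> inverse (1 + y)" using y by (intro le_imp_inverse_le) auto
  also have "\<dots> \<le> 1 - y + y\<^sup>2"
  proof -
    have "(1 - y + y\<^sup>2) * (1 + y) = 1 + y ^ 3" by (simp add: power2_eq_square power3_eq_cube algebra_simps)
    then have "1 \<le> (1 - y + y\<^sup>2) * (1 + y)" using y by simp
    then show ?thesis using y by (simp add: inverse_eq_divide divide_le_eq)
  qed
  finally show ?thesis by (simp add: y_def)
qed

text \<open>
  A Bernstein bound with the tilt \<open>\<mu> / (2 * L\<^sup>2)\<close>; its exponent is proportional to the total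
  mean, as needed for sparse hypergraphs.
\<close>

lemma bernoulli_deviation_tail:
  assumes A: "finite A" and p: "\<And>e. e \<in> A \<Longrightarrow> 0 \<le> p e \<and> p e \<le> 1"
    and c: "\<And>e. e \<in> A \<Longrightarrow> \<bar>c e\<bar> \<le> L" and L: "0 < L" and \<mu>: "0 < \<mu>" "\<mu> \<le> 2 * L"
    and Q: "(\<Sum>e\<in>A. p e) \<le> Q"
  shows "measure_pmf.prob (Pi_pmf A False (\<lambda>e. bernoulli_pmf (p e)))
      {f. \<mu> * Q \<le> (\<Sum>e\<in>A. c e * (of_bool (f e) - p e))} \<le> exp (- (\<mu>\<^sup>2 * Q / (4 * L\<^sup>2)))"
proof -
  define lam where "lam = \<mu> / (2 * L\<^sup>2)"
  have lam: "0 < lam" "lam * L \<le> 1" using L \<mu> by (auto simp: lam_def field_simps power2_eq_square)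
  define t where "t = lam * (\<mu> * Q + (\<Sum>e\<in>A. c e * p e))"
  have "{f. \<mu> * Q \<le> (\<Sum>e\<in>A. c e * (of_bool (f e) - p e))} = {f. t \<le> (\<Sum>e\<in>A. (lam * c e) * of_bool (f e))}"
  proof -
    have "(\<Sum>e\<in>A. (lam * c e) * of_bool (f e)) = lam * (\<Sum>e\<in>A. c e * of_bool (f e))" for f :: "'a \<Rightarrow> bool"
      by (simp add: sum_distrib_left mult.assoc)
    then show ?thesis
      using lam(1) by (auto simp: t_def right_diff_distrib sum_subtractf)
  qed
  then have "measure_pmf.prob (Pi_pmf A False (\<lambda>e. bernoulli_pmf (p e)))
      {f. \<mu> * Q \<le> (\<Sum>e\<in>A. c e * (of_bool (f e) - p e))} \<le> exp (- t + (\<Sum>e\<in>A. p e * (exp (lam * c e) - 1)))"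
    using bernoulli_family_tail[OF A p, where t = t and c = "\<lambda>e. lam * c e"] by simp
  also have "\<dots> \<le> exp (- (\<mu>\<^sup>2 * Q / (4 * L\<^sup>2)))"
  proof -
    have "(\<Sum>e\<in>A. p e * (exp (lam * c e) - 1)) \<le> (\<Sum>e\<in>A. p e * (lam * c e + (lam * L)\<^sup>2))"
    proof (intro sum_mono mult_left_mono)
      fix e assume e: "e \<in> A"
      have "\<bar>lam * c e\<bar> \<le> lam * L" using c[OF e] lam by (simp add: abs_mult)
      then have "exp (lam * c e) \<le> 1 + lam * c e + (lam * c e)\<^sup>2" using lam by (intro exp_le_quadratic) auto
      also have "(lam * c e)\<^sup>2 \<le> (lam * L)\<^sup>2" using \<open>\<bar>lam * c e\<bar> \<le> lam * L\<close> by (rule power2_le_iff_abs_le[THEN iffD2, rotated]) (use lam L in auto)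
      finally show "exp (lam * c e) - 1 \<le> lam * c e + (lam * L)\<^sup>2" by simp
    qed (use p in auto)
    also have "\<dots> = lam * (\<Sum>e\<in>A. c e * p e) + (lam * L)\<^sup>2 * (\<Sum>e\<in>A. p e)"
    proof -
      have "p e * (lam * c e + (lam * L)\<^sup>2) = lam * (c e * p e) + (lam * L)\<^sup>2 * p e" for e
        by (simp add: algebra_simps)
      then show ?thesis by (simp only: sum.distrib sum_distrib_left)
    qed
    also have "\<dots> \<le> lam * (\<Sum>e\<in>A. c e * p e) + (lam * L)\<^sup>2 * Q"
      using Q by (intro add_left_mono mult_left_mono) auto
    finally have "- t + (\<Sum>e\<in>A. p e * (exp (lam * c e) - 1)) \<le> (lam * L)\<^sup>2 * Q - lam * \<mu> * Q"
      by (simp add: t_def algebra_simps)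
    also have "\<dots> = - (\<mu>\<^sup>2 * Q / (4 * L\<^sup>2))"
      using L by (simp add: lam_def power2_eq_square field_simps)
    finally show ?thesis by simp
  qed
  finally show ?thesis .
qed

lemma prob_UN_le:
  assumes "finite I" "\<And>i. i \<in> I \<Longrightarrow> measure_pmf.prob p (S i) \<le> b"
  shows "measure_pmf.prob p (\<Union>i\<in>I. S i) \<le> real (card I) * b"
proof -
  have "measure_pmf.prob p (\<Union>i\<in>I. S i) \<le> (\<Sum>i\<in>I. measure_pmf.prob p (S i))"
    using assms(1) by (intro measure_pmf.finite_measure_subadditive_finite) auto
  also have "\<dots> \<le> (\<Sum>i\<in>I. b)" using assms(2) by (rule sum_mono)
  finally show ?thesis by simp
qed

section \<open>Counting hyperedges\<close>

lemma finite_edges [simp, intro]: "finite (edges n d)"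
  by (rule finite_subset[of _ "Pow {..<n}"]) (auto simp: edges_def)

lemma edgesD: "e \<in> edges n d \<Longrightarrow> finite e" "e \<in> edges n d \<Longrightarrow> card e = d" "e \<in> edges n d \<Longrightarrow> i \<in> e \<Longrightarrow> i < n"
  by (auto simp: edges_def intro: finite_subset)

lemma card_edges: "card (edges n d) = n choose d"
  using n_subsets[of "{..<n}" d] by (simp add: edges_def)

lemma card_supersets:
  assumes "finite S" "T \<subseteq> S" "card T \<le> d"
  shows "card {e. T \<subseteq> e \<and> e \<subseteq> S \<and> card e = d} = (card S - card T) choose (d - card T)"
proof -
  have finT: "finite T" using assms finite_subset by blast
  have "bij_betw (\<lambda>f. f \<union> T) {f. f \<subseteq> S - T \<and> card f = d - card T} {e. T \<subseteq> e \<and> e \<subseteq> S \<and> card e = d}"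
  proof (rule bij_betwI[where g = "\<lambda>e. e - T"])
    show "(\<lambda>f. f \<union> T) \<in> {f. f \<subseteq> S - T \<and> card f = d - card T} \<rightarrow> {e. T \<subseteq> e \<and> e \<subseteq> S \<and> card e = d}"
    proof
      fix f assume f: "f \<in> {f. f \<subseteq> S - T \<and> card f = d - card T}"
      then have "finite f" "f \<inter> T = {}" using assms(1) finite_subset by auto
      then have "card (f \<union> T) = card f + card T" using finT by (simp add: card_Un_disjoint)
      then show "f \<union> T \<in> {e. T \<subseteq> e \<and> e \<subseteq> S \<and> card e = d}" using f assms by auto
    qed
    show "(\<lambda>e. e - T) \<in> {e. T \<subseteq> e \<and> e \<subseteq> S \<and> card e = d} \<rightarrow> {f. f \<subseteq> S - T \<and> card f = d - card T}"
      using finT by (auto simp: card_Diff_subset)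
  qed auto
  then have "card {e. T \<subseteq> e \<and> e \<subseteq> S \<and> card e = d} = card {f. f \<subseteq> S - T \<and> card f = d - card T}"
    using bij_betw_same_card by fastforce
  also have "\<dots> = card (S - T) choose (d - card T)" using assms(1) by (intro n_subsets) auto
  finally show ?thesis using assms finT by (simp add: card_Diff_subset)
qed

lemma card_edges_containing:
  assumes "T \<subseteq> {..<n}" "card T \<le> d"
  shows "card {e\<in>edges n d. T \<subseteq> e} = (n - card T) choose (d - card T)"
proof -
  have "{e\<in>edges n d. T \<subseteq> e} = {e. T \<subseteq> e \<and> e \<subseteq> {..<n} \<and> card e = d}" by (auto simp: edges_def)
  then show ?thesis using card_supersets[of "{..<n}" T d] assms by simp
qed

lemma card_edges_through:
  assumes "i < n" "1 \<le> d"
  shows "card {e\<in>edges n d. i \<in> e} = (n - 1) choose (d - 1)"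
  using card_edges_containing[of "{i}" n d] assms by simp

lemma card_edges_through_pair:
  assumes "i < n" "j < n" "i \<noteq> j" "2 \<le> d"
  shows "card {e\<in>edges n d. {i, j} \<subseteq> e} = (n - 2) choose (d - 2)"
  using card_edges_containing[of "{i, j}" n d] assms by (simp add: numeral_2_eq_2)

lemma card_edges_meeting_twice:
  assumes U: "U \<subseteq> {..<n}" and d: "2 \<le> d"
  shows "card {e\<in>edges n d. 2 \<le> card (e \<inter> U)} \<le> (card U)\<^sup>2 * ((n - 2) choose (d - 2))"
proof -
  have finU: "finite U" using U finite_subset by blast
  have "{e\<in>edges n d. 2 \<le> card (e \<inter> U)} \<subseteq> (\<Union>(i, j)\<in>{(i, j)\<in>U \<times> U. i \<noteq> j}. {e\<in>edges n d. {i, j} \<subseteq> e})"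
  proof
    fix e assume e: "e \<in> {e\<in>edges n d. 2 \<le> card (e \<inter> U)}"
    then obtain T where "T \<subseteq> e \<inter> U" "card T = 2"
      by (metis (mono_tags, lifting) mem_Collect_eq obtain_subset_with_card_n)
    then obtain i j where "i \<noteq> j" "{i, j} \<subseteq> e \<inter> U" by (auto simp: card_2_iff)
    then show "e \<in> (\<Union>(i, j)\<in>{(i, j)\<in>U \<times> U. i \<noteq> j}. {e\<in>edges n d. {i, j} \<subseteq> e})" using e by auto
  qed
  then have "card {e\<in>edges n d. 2 \<le> card (e \<inter> U)} \<le> card (\<Union>(i, j)\<in>{(i, j)\<in>U \<times> U. i \<noteq> j}. {e\<in>edges n d. {i, j} \<subseteq> e})"
    using finU by (intro card_mono finite_UN_I) (auto intro: finite_subset[of _ "U \<times> U"])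
  also have "\<dots> \<le> (\<Sum>(i, j)\<in>{(i, j)\<in>U \<times> U. i \<noteq> j}. card {e\<in>edges n d. {i, j} \<subseteq> e})"
    using finU by (subst card_UN_le[THEN order.trans]) (auto intro: finite_subset[of _ "U \<times> U"] simp: case_prod_unfold)
  also have "\<dots> = (\<Sum>(i, j)\<in>{(i, j)\<in>U \<times> U. i \<noteq> j}. (n - 2) choose (d - 2))"
    by (rule sum.cong[OF refl]) (use U d in \<open>auto intro!: card_edges_through_pair[simplified]\<close>)
  also have "\<dots> = card {(i, j)\<in>U \<times> U. i \<noteq> j} * ((n - 2) choose (d - 2))" by (simp add: case_prod_unfold)
  also have "\<dots> \<le> card (U \<times> U) * ((n - 2) choose (d - 2))"
    using finU by (intro mult_right_mono card_mono) auto
  finally show ?thesis by (simp add: card_cartesian_product power2_eq_square)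
qed

text \<open>
  Both sides count edges with an ordered pair of distinct nodes in them.
\<close>

lemma binomial_pair_absorb:
  assumes "2 \<le> d" "2 \<le> n"
  shows "real (n choose d) * (real d * (real d - 1)) = real ((n - 2) choose (d - 2)) * (real n * (real n - 1))"
proof -
  obtain d' where d': "d = Suc (Suc d')" using assms(1) by (metis add_2_eq_Suc le_Suc_ex)
  obtain n' where n': "n = Suc (Suc n')" using assms(2) by (metis add_2_eq_Suc le_Suc_ex)
  have "Suc (Suc d') * (Suc (Suc n') choose Suc (Suc d')) = Suc (Suc n') * (Suc n' choose Suc d')"
    by (rule Suc_times_binomial_eq[symmetric, simplified mult.commute])
  moreover have "Suc d' * (Suc n' choose Suc d') = Suc n' * (n' choose d')"
    by (rule Suc_times_binomial_eq[symmetric, simplified mult.commute])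
  ultimately have "Suc d' * (Suc (Suc d') * (Suc (Suc n') choose Suc (Suc d'))) = Suc (Suc n') * (Suc n' * (n' choose d'))"
    by (metis mult.left_commute)
  then have "real (Suc d' * (Suc (Suc d') * (Suc (Suc n') choose Suc (Suc d')))) = real (Suc (Suc n') * (Suc n' * (n' choose d')))"
    by (rule arg_cong)
  then show ?thesis by (simp add: d' n' algebra_simps)
qed

lemma pair_codegree_le:
  assumes "2 \<le> d" "2 \<le> n"
  shows "real ((n - 2) choose (d - 2)) \<le> 2 * (real d)\<^sup>2 * real (n choose d) / (real n)\<^sup>2"
proof -
  have "real ((n - 2) choose (d - 2)) * (real n)\<^sup>2 \<le> 2 * (real ((n - 2) choose (d - 2)) * (real n * (real n - 1)))"
  proof -
    have "(real n)\<^sup>2 \<le> 2 * (real n * (real n - 1))" using assms by (simp add: power2_eq_square)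
    then have "real ((n - 2) choose (d - 2)) * (real n)\<^sup>2 \<le> real ((n - 2) choose (d - 2)) * (2 * (real n * (real n - 1)))"
      by (intro mult_left_mono) auto
    then show ?thesis by (simp only: mult_ac)
  qed
  also have "\<dots> = 2 * (real (n choose d) * (real d * (real d - 1)))"
    by (simp only: binomial_pair_absorb[OF assms])
  also have "\<dots> \<le> 2 * (real (n choose d) * (real d)\<^sup>2)"
    using assms by (intro mult_left_mono) (auto simp: power2_eq_square)
  finally show ?thesis using assms by (simp add: field_simps)
qed

lemma power_le_fact_binomial:
  assumes "r \<le> s"
  shows "(a - s) ^ r \<le> fact r * (a choose r)"
  using assms
proof (induction r)
  case (Suc r)
  have "(a - s) ^ Suc r = (a - s) ^ r * (a - s)" by simp
  also have "\<dots> \<le> (fact r * (a choose r)) * (a - r)"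
    using Suc by (intro mult_mono) auto
  also have "(a choose r) * (a - r) = Suc r * (a choose Suc r)"
    using binomial_absorb_comp[of a r] binomial_absorption[of r a] by (simp add: mult.commute)
  then have "(fact r * (a choose r)) * (a - r) = fact (Suc r) * (a choose Suc r)"
    by (simp only: fact_Suc mult.assoc of_nat_id mult.left_commute)
  finally show ?case .
qed simp

text \<open>
  Chebyshev's sum inequality, inductively.
\<close>

lemma power_mean:
  fixes x y :: real
  assumes "0 \<le> x" "0 \<le> y"
  shows "2 * ((x + y) / 2) ^ r \<le> x ^ r + y ^ r"
proof (induction r)
  case (Suc r)
  have "0 \<le> (x - y) * (x ^ r - y ^ r)"
  proof (cases "x \<le> y")
    case True
    then show ?thesis using assms by (intro mult_nonpos_nonpos) (auto intro: power_mono)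
  next
    case False
    then show ?thesis using assms by (intro mult_nonneg_nonneg) (auto intro: power_mono)
  qed
  then have *: "(x + y) / 2 * (x ^ r + y ^ r) \<le> x ^ Suc r + y ^ Suc r" by (simp add: algebra_simps)
  have "2 * ((x + y) / 2) ^ Suc r = (x + y) / 2 * (2 * ((x + y) / 2) ^ r)" by simp
  also have "\<dots> \<le> (x + y) / 2 * (x ^ r + y ^ r)" using Suc assms by (intro mult_left_mono) auto
  finally show ?case using * by linarith
qed simp

text \<open>
  By convexity the balanced split \<open>a = b\<close> is asymptotically the worst. Applied to the nodes other
  than \<open>i\<close> with \<open>r = d - 1\<close>, this is the source of the factor \<open>2 ^ (d - 2)\<close> in the
  threshold.
\<close>

lemma binomial_sum_ge:
  assumes "0 < \<delta>" and m: "2 * real r \<le> real (a + b)" "2 * (real r)\<^sup>2 \<le> \<delta> * real (a + b)"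
  shows "(1 - \<delta>) * (2 * (1 / 2) ^ r) * real ((a + b) choose r) \<le> real (a choose r) + real (b choose r)"
proof (cases "r = 0")
  case True then show ?thesis using assms by simp
next
  case False
  let ?m = "real (a + b)"
  have mpos: "0 < ?m" using m(1) False by linarith
  have "(1 - \<delta>) * ?m ^ r \<le> (?m - 2 * real r) ^ r"
  proof -
    have "1 - \<delta> \<le> 1 + real r * (- (2 * real r / ?m))"
      using m(2) mpos by (simp add: field_simps power2_eq_square)
    also have "\<dots> \<le> (1 + - (2 * real r / ?m)) ^ r"
      using m(1) mpos by (intro Bernoulli_inequality) (simp add: field_simps)
    finally have "(1 - \<delta>) * ?m ^ r \<le> (1 + - (2 * real r / ?m)) ^ r * ?m ^ r"
      using mpos by (intro mult_right_mono) auto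
    also have "\<dots> = (?m - 2 * real r) ^ r" using mpos by (simp add: power_mult_distrib[symmetric] field_simps)
    finally show ?thesis .
  qed
  also have "\<dots> \<le> (real (a - r) + real (b - r)) ^ r"
    using m(1) by (intro power_mono) auto
  finally have 1: "(1 - \<delta>) * ?m ^ r * (2 * (1 / 2) ^ r) \<le> 2 * ((real (a - r) + real (b - r)) / 2) ^ r"
    by (simp only: power_divide power_one) (simp add: divide_right_mono)
  also have "\<dots> \<le> real (a - r) ^ r + real (b - r) ^ r" by (rule power_mean) auto
  also have "\<dots> \<le> fact r * (real (a choose r) + real (b choose r))"
  proof -
    have "real ((a - r) ^ r + (b - r) ^ r) \<le> real (fact r * (a choose r) + fact r * (b choose r))"
      using power_le_fact_binomial[of r r a] power_le_fact_binomial[of r r b] unfolding of_nat_le_iff by linarith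
    then show ?thesis by (simp add: algebra_simps)
  qed
  finally have 2: "(1 - \<delta>) * (2 * (1 / 2) ^ r) * ?m ^ r \<le> fact r * (real (a choose r) + real (b choose r))"
    by (simp add: mult_ac)
  show ?thesis
  proof (cases "\<delta> \<le> 1")
    case True
    have "real ((a + b) choose r) * fact r \<le> ?m ^ r"
      using binomial_fact_pow[of "a + b" r] by (metis of_nat_fact of_nat_le_iff of_nat_mult of_nat_power)
    then have "(1 - \<delta>) * (2 * (1 / 2) ^ r) * (real ((a + b) choose r) * fact r) \<le> (1 - \<delta>) * (2 * (1 / 2) ^ r) * ?m ^ r"
      using True by (intro mult_left_mono) auto
    with 2 have "((1 - \<delta>) * (2 * (1 / 2) ^ r) * real ((a + b) choose r)) * fact r \<le> (real (a choose r) + real (b choose r)) * fact r"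
      unfolding mult.assoc[symmetric] by (simp only: mult.commute[of "fact r"])
    then show ?thesis by (simp only: mult_le_cancel_right_pos fact_gt_zero)
  next
    case False
    then have "(1 - \<delta>) * (2 * (1 / 2) ^ r) * real ((a + b) choose r) \<le> 0"
      by (intro mult_nonpos_nonneg) auto
    then show ?thesis by (smt (verit) of_nat_0_le_iff)
  qed
qed

text \<open>
  Two nodes of a group that holds a fraction \<open>\<gamma>\<close> of all nodes have of the order of
  \<open>n ^ (d - 2)\<close> common edges inside the group. The constant is not optimised.
\<close>

lemma group_codegree_ge:
  assumes d: "2 \<le> d" and \<gamma>: "0 < \<gamma>" "\<gamma> \<le> 1" and N: "\<gamma> * real n \<le> real N" "N \<le> n" and big: "2 * real d \<le> \<gamma> * real n"
  shows "(\<gamma> / (2 * real d)) ^ d * (real (n choose d) / real n) \<le> real ((N - 2) choose (d - 2)) * real N"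
proof -
  have n: "0 < real n"
  proof (rule ccontr)
    assume "\<not> 0 < real n"
    then show False using big d by simp
  qed
  have "d \<le> n"
  proof -
    have "real d \<le> \<gamma> * real n" using big by simp
    also have "\<dots> \<le> 1 * real n" using \<gamma> by (intro mult_right_mono) auto
    finally show ?thesis by simp
  qed
  have dN: "2 * real d \<le> real N" using big N by linarith
  define q where "q = \<gamma> * real n / (2 * real d)"
  have q: "0 \<le> q" using \<gamma> by (simp add: q_def)
  have 1: "q ^ (d - 2) \<le> real ((N - 2) choose (d - 2))"
  proof (cases "d = 2")
    case False
    have "q = (\<gamma> * real n / 2) / real d" by (simp add: q_def)
    also have "\<dots> \<le> real (N - 2) / real (d - 2)"
      using False d dN N by (intro frac_le) auto
    finally have "q ^ (d - 2) \<le> (real (N - 2) / real (d - 2)) ^ (d - 2)" using q by (intro power_mono) auto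
    also have "\<dots> \<le> real ((N - 2) choose (d - 2))"
      using dN by (intro binomial_ge_n_over_k_pow_k) linarith
    finally show ?thesis .
  qed simp
  have "(\<gamma> / (2 * real d)) ^ d * (real (n choose d) / real n) \<le> (\<gamma> / (2 * real d)) ^ d * (real n ^ d / real n)"
    using binomial_le_pow[OF \<open>d \<le> n\<close>] \<gamma> by (intro mult_left_mono divide_right_mono) (auto simp flip: of_nat_power)
  also have "\<dots> = q ^ (d - 2) * ((\<gamma> / (2 * real d))\<^sup>2 * real n)"
  proof -
    obtain d' where d': "d = d' + 2" using d by (metis add.commute le_Suc_ex)
    show ?thesis using n unfolding q_def d' by (simp add: power_add power_mult_distrib power_divide power2_eq_square mult_ac)
  qed
  also have "\<dots> \<le> real ((N - 2) choose (d - 2)) * real N"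
  proof (intro mult_mono 1)
    have "\<gamma> / (2 * real d) \<le> 1" using \<gamma> d by (simp add: divide_le_eq)
    moreover have "\<gamma> / (2 * real d) \<le> \<gamma> / 1" using \<gamma> d by (intro divide_left_mono) auto
    ultimately have "(\<gamma> / (2 * real d)) * (\<gamma> / (2 * real d)) \<le> \<gamma> * 1" using \<gamma> by (intro mult_mono) auto
    then have "(\<gamma> / (2 * real d))\<^sup>2 * real n \<le> \<gamma> * real n"
      unfolding power2_eq_square by (intro mult_right_mono) auto
    then show "(\<gamma> / (2 * real d))\<^sup>2 * real n \<le> real N" using N by linarith
  qed auto
  finally show ?thesis .
qed

section \<open>Typical hypergraphs\<close>

abbreviation inner_edges :: "nat \<Rightarrow> nat \<Rightarrow> (nat set \<Rightarrow> bool) \<Rightarrow> nat set \<Rightarrow> nat set set" where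
  "inner_edges n d f U \<equiv> {e\<in>edges n d. f e \<and> 2 \<le> card (e \<inter> U)}"

abbreviation edge_mean :: "real \<Rightarrow> real \<Rightarrow> (nat \<Rightarrow> nat) \<Rightarrow> nat set \<Rightarrow> real" where
  "edge_mean \<rho> \<theta> g e \<equiv> \<rho> * (if g constant_on e then 1 - \<theta> else \<theta>)"

text \<open>
  The coefficient of the edge \<open>e\<close> in the bilinear form of the codegree matrix, evaluated at \<open>s\<close>
  and \<open>t\<close>; see \<open>bilin_codeg\<close>.
\<close>

definition sign_sum :: "(nat \<Rightarrow> real) \<Rightarrow> (nat \<Rightarrow> real) \<Rightarrow> nat set \<Rightarrow> real" where
  "sign_sum s t e = (\<Sum>i\<in>e. \<Sum>j\<in>e - {i}. s i * t j)"

text \<open>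
  For each of the \<open>4 ^ n\<close> pairs of sign vectors this is a Bernstein bound with exponent
  proportional to \<open>Q\<close>, so the union bound is useful as soon as \<open>Q / n\<close> is large.
\<close>

lemma cut_deviation_prob:
  fixes p :: "nat set \<Rightarrow> real"
  assumes p: "\<And>e. e \<in> edges n d \<Longrightarrow> 0 \<le> p e \<and> p e \<le> 1" and d: "1 \<le> d"
    and \<mu>: "0 < \<mu>" "\<mu> \<le> 1" and Q: "(\<Sum>e\<in>edges n d. p e) \<le> Q"
  shows "measure_pmf.prob (Pi_pmf (edges n d) False (\<lambda>e. bernoulli_pmf (p e)))
      {f. \<exists>s t. (\<forall>i. s i \<in> {-1, 1}) \<and> (\<forall>i. t i \<in> {-1, 1}) \<and>
        \<mu> * Q < \<bar>\<Sum>e\<in>edges n d. sign_sum s t e * (of_bool (f e) - p e)\<bar>}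
    \<le> 4 ^ n * exp (- (\<mu>\<^sup>2 * Q / (4 * real d ^ 4)))"
proof -
  let ?M = "Pi_pmf (edges n d) False (\<lambda>e. bernoulli_pmf (p e))"
  define V where "V = {..<n} \<rightarrow>\<^sub>E {-1, 1::real}"
  define S where "S = (\<lambda>(s, t). {f. \<mu> * Q \<le> (\<Sum>e\<in>edges n d. sign_sum s t e * (of_bool (f e) - p e))})"
  have finV: "finite V" unfolding V_def by (intro finite_PiE) auto
  have cardV: "card V = 2 ^ n" by (simp add: V_def card_PiE numeral_2_eq_2)
  have restr: "sign_sum (restrict s {..<n}) (restrict t {..<n}) e = sign_sum s t e" if "e \<in> edges n d" for s t e
    using edgesD(3)[OF that] by (simp add: sign_sum_def)
  have neg: "sign_sum (\<lambda>i. - s i) t e = - sign_sum s t e" for s t e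
    by (simp add: sign_sum_def sum_negf)
  have "{f. \<exists>s t. (\<forall>i. s i \<in> {-1, 1}) \<and> (\<forall>i. t i \<in> {-1, 1}) \<and>
        \<mu> * Q < \<bar>\<Sum>e\<in>edges n d. sign_sum s t e * (of_bool (f e) - p e)\<bar>} \<subseteq> (\<Union>st\<in>V \<times> V. S st)"
  proof clarify
    fix f s t
    assume s: "\<forall>i. s i \<in> {-1, 1::real}" and t: "\<forall>i. t i \<in> {-1, 1::real}"
      and big: "\<mu> * Q < \<bar>\<Sum>e\<in>edges n d. sign_sum s t e * (of_bool (f e) - p e)\<bar>"
    define s' where "s' = (if 0 \<le> (\<Sum>e\<in>edges n d. sign_sum s t e * (of_bool (f e) - p e)) then s else (\<lambda>i. - s i))"
    have s': "s' i \<in> {-1, 1}" for i using s[rule_format, of i] by (auto simp: s'_def)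
    have "\<mu> * Q \<le> (\<Sum>e\<in>edges n d. sign_sum s' t e * (of_bool (f e) - p e))"
      using big by (auto simp: s'_def neg sum_negf abs_if split: if_splits)
    also have "\<dots> = (\<Sum>e\<in>edges n d. sign_sum (restrict s' {..<n}) (restrict t {..<n}) e * (of_bool (f e) - p e))"
      by (intro sum.cong refl) (simp add: restr)
    finally have "f \<in> S (restrict s' {..<n}, restrict t {..<n})" by (simp add: S_def)
    moreover have "restrict s' {..<n} \<in> V" "restrict t {..<n} \<in> V" using s' t by (auto simp: V_def)
    ultimately show "f \<in> (\<Union>st\<in>V \<times> V. S st)" by blast
  qed
  then have "measure_pmf.prob ?M {f. \<exists>s t. (\<forall>i. s i \<in> {-1, 1}) \<and> (\<forall>i. t i \<in> {-1, 1}) \<and>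
        \<mu> * Q < \<bar>\<Sum>e\<in>edges n d. sign_sum s t e * (of_bool (f e) - p e)\<bar>} \<le> measure_pmf.prob ?M (\<Union>st\<in>V \<times> V. S st)"
    by (intro measure_pmf.finite_measure_mono) auto
  also have "\<dots> \<le> real (card (V \<times> V)) * exp (- (\<mu>\<^sup>2 * Q / (4 * real d ^ 4)))"
  proof (rule prob_UN_le)
    fix st assume "st \<in> V \<times> V"
    then obtain s t where st: "st = (s, t)" "s \<in> V" "t \<in> V" by auto
    have ss: "\<bar>sign_sum s t e\<bar> \<le> (real d)\<^sup>2" if e: "e \<in> edges n d" for e
    proof -
      have one: "\<bar>s i\<bar> = 1 \<and> \<bar>t i\<bar> = 1" if "i \<in> e" for i
      proof -
        have "i < n" using edgesD(3)[OF e that] .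
        then have "s i \<in> {-1, 1}" "t i \<in> {-1, 1}" using st by (auto simp: V_def PiE_iff)
        then show ?thesis by auto
      qed
      have "\<bar>sign_sum s t e\<bar> \<le> (\<Sum>i\<in>e. \<Sum>j\<in>e - {i}. \<bar>s i * t j\<bar>)"
        unfolding sign_sum_def by (rule order.trans[OF sum_abs], intro sum_mono sum_abs)
      also have "\<dots> \<le> (\<Sum>i\<in>e. \<Sum>j\<in>e. 1)"
        using one edgesD(1)[OF e] by (intro sum_mono order.trans[OF sum_mono sum_mono2]) (auto simp: abs_mult)
      also have "\<dots> = (real d)\<^sup>2" using edgesD(2)[OF e] by (simp add: power2_eq_square)
      finally show ?thesis .
    qed
    have "measure_pmf.prob ?M {f. \<mu> * Q \<le> (\<Sum>e\<in>edges n d. sign_sum s t e * (of_bool (f e) - p e))}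
        \<le> exp (- (\<mu>\<^sup>2 * Q / (4 * ((real d)\<^sup>2)\<^sup>2)))"
    proof (rule bernoulli_deviation_tail[OF finite_edges p ss])
      have "1 \<le> (real d)\<^sup>2" using d by simp
      then show "0 < (real d)\<^sup>2" "\<mu> \<le> 2 * (real d)\<^sup>2" using \<mu> by linarith+
    qed (use \<mu> Q in auto)
    then show "measure_pmf.prob ?M (S st) \<le> exp (- (\<mu>\<^sup>2 * Q / (4 * real d ^ 4)))"
      by (simp add: S_def st(1))
  qed (use finV in auto)
  also have "real (card (V \<times> V)) = 4 ^ n"
    by (simp add: card_cartesian_product cardV power_mult_distrib[symmetric])
  finally show ?thesis .
qed

lemma binomial_le_exp:
  assumes "1 \<le> u" "u \<le> n"
  shows "real (n choose u) \<le> exp (real u * (1 + ln (real n / real u)))"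
proof -
  have n: "0 < real n" "0 < real u" using assms by auto
  have fact: "real u ^ u \<le> exp (real u) * fact u"
  proof -
    have "(\<lambda>k. real u ^ k / fact k) sums exp (real u)"
      using exp_converges[of "real u"] by (simp add: divide_inverse mult.commute)
    then have "sum (\<lambda>k. real u ^ k / fact k) {u} \<le> exp (real u)"
      by (metis (no_types, lifting) sums_iff sum_le_suminf finite.emptyI finite.insertI divide_nonneg_nonneg fact_ge_zero of_nat_0_le_iff zero_le_power)
    then show ?thesis by (simp add: divide_le_eq)
  qed
  have "real (n choose u) * fact u \<le> real n ^ u"
    using binomial_fact_pow[of n u] by (metis of_nat_fact of_nat_le_iff of_nat_mult of_nat_power)
  then have "real (n choose u) * fact u * real u ^ u \<le> real n ^ u * (exp (real u) * fact u)"
    using fact by (intro mult_mono) auto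
  then have "real (n choose u) * real u ^ u \<le> real n ^ u * exp (real u)"
    by (simp add: mult_ac)
  then have "real (n choose u) \<le> exp (real u) * (real n / real u) ^ u"
    using n by (simp add: power_divide field_simps)
  also have "(real n / real u) ^ u = exp (real u * ln (real n / real u))"
    using n by (simp add: exp_of_nat_mult)
  finally show ?thesis by (simp add: exp_add[symmetric] algebra_simps)
qed


text \<open>
  A set \<open>U\<close> of \<open>u\<close> nodes meets only about \<open>u\<^sup>2 D / n\<close> edges twice on average. With the tilt
  \<open>ln (n / u) / 2\<close>, the probability of \<open>\<kappa> D u\<close> such edges is at most
  \<open>exp (- \<kappa> D u ln (n / u) / 4)\<close>, against about \<open>exp (u ln (n / u))\<close> choices of \<open>U\<close>. The logarithms
  match, so a large constant \<open>D\<close> already wins, for all sizes \<open>u\<close> at once.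
\<close>

lemma sparse_prob_fixed_size:
  fixes p :: "nat set \<Rightarrow> real"
  assumes p: "\<And>e. e \<in> edges n d \<Longrightarrow> 0 \<le> p e \<and> p e \<le> \<rho>" and \<rho>: "\<rho> \<le> 1" and d: "2 \<le> d" and n: "2 \<le> n"
    and D: "D = real (n choose d) * \<rho> / real n" and "0 < \<kappa>"
    and \<sigma>: "0 < \<sigma>" "\<sigma> \<le> exp (- 1)" "2 * (real d)\<^sup>2 * sqrt \<sigma> \<le> \<kappa> / 4"
    and u: "1 \<le> u" "real u \<le> \<sigma> * real n" and big: "8 \<le> \<kappa> * D"
  shows "measure_pmf.prob (Pi_pmf (edges n d) False (\<lambda>e. bernoulli_pmf (p e)))
      {f. \<exists>U\<subseteq>{..<n}. card U = u \<and> \<kappa> * D * real u \<le> real (card (inner_edges n d f U))}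
    \<le> exp (2 - \<kappa> * D / 4) ^ u"
proof -
  let ?M = "Pi_pmf (edges n d) False (\<lambda>e. bernoulli_pmf (p e))"
  define lg where "lg = ln (real n / real u)"
  define S where "S U = {f. \<kappa> * D * real u \<le> real (card (inner_edges n d f U))}" for U
  have pos: "0 < real n" "0 < real u" using n u by auto
  have "0 < D" using big \<open>0 < \<kappa>\<close> by (metis less_le_trans zero_less_mult_pos zero_less_numeral)
  have un: "real u / real n \<le> \<sigma>" using u pos by (simp add: divide_le_eq)
  have "exp 1 \<le> real n / real u"
  proof -
    have "real u / real n \<le> exp (- 1)" using un \<sigma> by linarith
    then show ?thesis using pos by (simp add: exp_minus field_simps)
  qed
  then have lg: "1 \<le> lg" using pos by (simp add: lg_def ln_ge_iff)
  have explg: "exp (lg / 2) = sqrt (real n / real u)"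
  proof -
    have "exp (lg / 2) ^ 2 = real n / real u" using pos by (simp add: exp_double[symmetric] lg_def)
    then show ?thesis by (metis exp_ge_zero real_sqrt_unique)
  qed
  have fixed: "measure_pmf.prob ?M (S U) \<le> exp (- (\<kappa> * D * real u * lg / 4))" if U: "U \<subseteq> {..<n}" "card U = u" for U
  proof -
    define E where "E = {e\<in>edges n d. 2 \<le> card (e \<inter> U)}"
    define c where "c e = (if e \<in> E then lg / 2 else 0)" for e
    have "S U = {f. lg / 2 * (\<kappa> * D * real u) \<le> (\<Sum>e\<in>edges n d. c e * of_bool (f e))}"
    proof -
      have "(\<Sum>e\<in>edges n d. c e * of_bool (f e)) = lg / 2 * real (card (inner_edges n d f U))" for f
      proof -
        have "(\<Sum>e\<in>edges n d. c e * of_bool (f e)) = (\<Sum>e\<in>(inner_edges n d f U). lg / 2)"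
          by (rule sum.mono_neutral_cong_right) (auto simp: c_def E_def)
        then show ?thesis by simp
      qed
      then show ?thesis unfolding S_def by (simp only:) (use lg in \<open>auto simp: mult.assoc\<close>)
    qed
    then have "measure_pmf.prob ?M (S U) \<le>
        exp (- (lg / 2 * (\<kappa> * D * real u)) + (\<Sum>e\<in>edges n d. p e * (exp (c e) - 1)))"
      using p \<rho> by (simp only:) (rule bernoulli_family_tail, auto intro: order.trans)
    also have "\<dots> \<le> exp (- (\<kappa> * D * real u * lg / 4))"
    proof -
      have "(\<Sum>e\<in>edges n d. p e * (exp (c e) - 1)) = (\<Sum>e\<in>E. p e * (exp (lg / 2) - 1))"
        by (rule sum.mono_neutral_cong_right) (auto simp: c_def E_def)
      also have "\<dots> \<le> (\<Sum>e\<in>E. \<rho> * sqrt (real n / real u))"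
      proof (rule sum_mono)
        fix e assume "e \<in> E"
        then have "0 \<le> p e" "p e \<le> \<rho>" using p by (auto simp: E_def)
        moreover have "1 \<le> exp (lg / 2)" using lg by simp
        ultimately show "p e * (exp (lg / 2) - 1) \<le> \<rho> * sqrt (real n / real u)"
          unfolding explg[symmetric] by (intro mult_mono) auto
      qed
      also have "\<dots> = real (card E) * (\<rho> * sqrt (real n / real u))" by simp
      also have "\<dots> \<le> ((real u)\<^sup>2 * (2 * (real d)\<^sup>2 * real (n choose d) / (real n)\<^sup>2)) * (\<rho> * sqrt (real n / real u))"
      proof (rule mult_right_mono)
        have "real (card E) \<le> real (u\<^sup>2 * ((n - 2) choose (d - 2)))"
          using card_edges_meeting_twice[OF U(1) d] U(2) unfolding E_def of_nat_le_iff by simp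
        also have "\<dots> = (real u)\<^sup>2 * real ((n - 2) choose (d - 2))" by simp
        also have "\<dots> \<le> (real u)\<^sup>2 * (2 * (real d)\<^sup>2 * real (n choose d) / (real n)\<^sup>2)"
          using pair_codegree_le[OF d n] by (intro mult_left_mono) auto
        finally show "real (card E) \<le> (real u)\<^sup>2 * (2 * (real d)\<^sup>2 * real (n choose d) / (real n)\<^sup>2)" .
        have "0 < real (n choose d) * \<rho>" using \<open>0 < D\<close> pos by (simp add: D zero_less_divide_iff)
        then have "0 < \<rho>" by (simp add: zero_less_mult_iff)
        then show "0 \<le> \<rho> * sqrt (real n / real u)" using pos by simp
      qed
      also have "\<dots> = D * real u * (2 * (real d)\<^sup>2 * (real u / real n * sqrt (real n / real u)))"
        using pos by (simp add: D power2_eq_square field_simps)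
      also have "real u / real n * sqrt (real n / real u) = sqrt (real u / real n)"
      proof -
        have "sqrt (real u / real n) * sqrt (real u / real n) = real u / real n" using pos by simp
        moreover have "sqrt (real u / real n) * sqrt (real n / real u) = 1" using pos by (simp add: real_sqrt_mult[symmetric])
        ultimately show ?thesis by (metis mult.assoc mult.right_neutral)
      qed
      also have "D * real u * (2 * (real d)\<^sup>2 * sqrt (real u / real n)) \<le> D * real u * (\<kappa> / 4 * lg)"
      proof (rule mult_left_mono)
        have "2 * (real d)\<^sup>2 * sqrt (real u / real n) \<le> 2 * (real d)\<^sup>2 * sqrt \<sigma>"
          using un by (intro mult_left_mono) auto
        also have "\<dots> \<le> \<kappa> / 4 * 1" using \<sigma> by simp
        also have "\<dots> \<le> \<kappa> / 4 * lg" using lg \<open>0 < \<kappa>\<close> by (intro mult_left_mono) auto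
        finally show "2 * (real d)\<^sup>2 * sqrt (real u / real n) \<le> \<kappa> / 4 * lg" .
      qed (use \<open>0 < D\<close> in simp)
      finally have "(\<Sum>e\<in>edges n d. p e * (exp (c e) - 1)) \<le> \<kappa> * D * real u * lg / 4" by (simp add: mult_ac)
      moreover have "lg / 2 * (\<kappa> * D * real u) = 2 * (\<kappa> * D * real u * lg / 4)" by simp
      ultimately show ?thesis unfolding exp_le_cancel_iff by linarith
    qed
    finally show ?thesis .
  qed
  have sub: "{f. \<exists>U\<subseteq>{..<n}. card U = u \<and> \<kappa> * D * real u \<le> real (card (inner_edges n d f U))}
      = (\<Union>U\<in>{U. U \<subseteq> {..<n} \<and> card U = u}. S U)"
    by (auto simp: S_def)
  have "u \<le> n"
  proof -
    have "\<sigma> \<le> 1" using \<sigma>(2) by (meson exp_le_one_iff order.trans neg_le_0_iff_le zero_le_one)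
    then have "real u \<le> real n" using u pos by (metis mult_left_le_one_le mult.commute order.trans less_imp_le \<sigma>(1))
    then show ?thesis by simp
  qed
  have "measure_pmf.prob ?M (\<Union>U\<in>{U. U \<subseteq> {..<n} \<and> card U = u}. S U) \<le>
      real (card {U. U \<subseteq> {..<n} \<and> card U = u}) * exp (- (\<kappa> * D * real u * lg / 4))"
    by (rule prob_UN_le) (use fixed in auto)
  also have "\<dots> = real (n choose u) * exp (- (\<kappa> * D * real u * lg / 4))"
    using n_subsets[of "{..<n}" u] by simp
  also have "\<dots> \<le> exp (real u * (1 + lg)) * exp (- (\<kappa> * D * real u * lg / 4))"
    using binomial_le_exp[OF u(1) \<open>u \<le> n\<close>] by (intro mult_right_mono) (auto simp: lg_def)
  also have "\<dots> \<le> exp (real u * (2 - \<kappa> * D / 4))"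
  proof -
    have "0 \<le> (\<kappa> * D / 4 - 1) * (lg - 1)" using big lg by (intro mult_nonneg_nonneg) auto
    moreover have "(\<kappa> * D / 4 - 1) * (lg - 1) = \<kappa> * D * lg / 4 - \<kappa> * D / 4 - lg + 1"
      by (simp add: left_diff_distrib right_diff_distrib)
    ultimately have "1 + lg - \<kappa> * D * lg / 4 \<le> 2 - \<kappa> * D / 4" by linarith
    then have "real u * (1 + lg - \<kappa> * D * lg / 4) \<le> real u * (2 - \<kappa> * D / 4)"
      by (intro mult_left_mono) auto
    then show ?thesis by (simp add: exp_add[symmetric] algebra_simps)
  qed
  also have "\<dots> = exp (2 - \<kappa> * D / 4) ^ u" by (simp add: exp_of_nat_mult)
  finally show ?thesis unfolding sub .
qed

lemma sparse_prob:
  fixes p :: "nat set \<Rightarrow> real"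
  assumes p: "\<And>e. e \<in> edges n d \<Longrightarrow> 0 \<le> p e \<and> p e \<le> \<rho>" and \<rho>: "\<rho> \<le> 1" and d: "2 \<le> d" and n: "2 \<le> n"
    and D: "D = real (n choose d) * \<rho> / real n" and "0 < \<kappa>"
    and \<sigma>: "0 < \<sigma>" "\<sigma> \<le> exp (- 1)" "2 * (real d)\<^sup>2 * sqrt \<sigma> \<le> \<kappa> / 4"
    and big: "12 \<le> \<kappa> * D"
  shows "measure_pmf.prob (Pi_pmf (edges n d) False (\<lambda>e. bernoulli_pmf (p e)))
      {f. \<exists>U\<subseteq>{..<n}. 1 \<le> card U \<and> real (card U) \<le> \<sigma> * real n \<and>
         \<kappa> * D * real (card U) \<le> real (card (inner_edges n d f U))}
    \<le> 2 * exp (2 - \<kappa> * D / 4)"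
proof -
  let ?M = "Pi_pmf (edges n d) False (\<lambda>e. bernoulli_pmf (p e))"
  define S where "S u = {f. \<exists>U\<subseteq>{..<n}. card U = u \<and>
     \<kappa> * D * real u \<le> real (card (inner_edges n d f U))}" for u
  define r where "r = exp (2 - \<kappa> * D / 4)"
  have r: "0 \<le> r" "r \<le> 1 / 2"
  proof -
    have "r \<le> exp (- 1)" using big by (simp add: r_def)
    also have "\<dots> \<le> 1 / 2" using exp_ge_add_one_self[of 1] by (simp add: exp_minus field_simps)
    finally show "r \<le> 1 / 2" .
  qed (simp add: r_def)
  define us where "us = {u. 1 \<le> u \<and> u \<le> n \<and> real u \<le> \<sigma> * real n}"
  have us: "finite us" "us \<subseteq> {1..n}" by (auto simp: us_def)
  have "{f. \<exists>U\<subseteq>{..<n}. 1 \<le> card U \<and> real (card U) \<le> \<sigma> * real n \<and>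
         \<kappa> * D * real (card U) \<le> real (card (inner_edges n d f U))} \<subseteq> (\<Union>u\<in>us. S u)"
  proof clarify
    fix f U assume U: "U \<subseteq> {..<n}" "1 \<le> card U" "real (card U) \<le> \<sigma> * real n"
      "\<kappa> * D * real (card U) \<le> real (card (inner_edges n d f U))"
    have "card U \<le> n" using card_mono[OF _ U(1)] by simp
    then have "card U \<in> us" "f \<in> S (card U)" using U by (auto simp: us_def S_def)
    then show "f \<in> (\<Union>u\<in>us. S u)" by blast
  qed
  then have "measure_pmf.prob ?M {f. \<exists>U\<subseteq>{..<n}. 1 \<le> card U \<and> real (card U) \<le> \<sigma> * real n \<and>
         \<kappa> * D * real (card U) \<le> real (card (inner_edges n d f U))} \<le> measure_pmf.prob ?M (\<Union>u\<in>us. S u)"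
    by (intro measure_pmf.finite_measure_mono) auto
  also have "\<dots> \<le> (\<Sum>u\<in>us. measure_pmf.prob ?M (S u))"
    using us by (intro measure_pmf.finite_measure_subadditive_finite) auto
  also have "\<dots> \<le> (\<Sum>u\<in>us. r ^ u)"
  proof (rule sum_mono)
    fix u assume "u \<in> us"
    then show "measure_pmf.prob ?M (S u) \<le> r ^ u"
      unfolding S_def r_def
      using big by (intro sparse_prob_fixed_size[OF p \<rho> d n D \<open>0 < \<kappa>\<close> \<sigma>]) (auto simp: us_def)
  qed
  also have "\<dots> \<le> (\<Sum>u\<in>{1..n}. r ^ u)" using us r by (intro sum_mono2) auto
  also have "\<dots> \<le> 2 * r"
  proof -
    have "(\<Sum>u\<in>{1..m}. r ^ u) \<le> 2 * r - 2 * (r * r ^ m)" for m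
    proof (induction m)
      case (Suc m)
      have "(r * r ^ m) * (2 * r) \<le> (r * r ^ m) * 1" using r by (intro mult_left_mono) auto
      moreover have "(\<Sum>u\<in>{1..Suc m}. r ^ u) = (\<Sum>u\<in>{1..m}. r ^ u) + r * r ^ m" by simp
      ultimately show ?case using Suc by (simp add: algebra_simps)
    qed (use r in simp)
    from this[of n] show ?thesis using r zero_le_power[of r n] by (smt (verit) mult_nonneg_nonneg)
  qed
  finally show ?thesis by (simp add: r_def)
qed

text \<open>
  To be read with small \<open>\<mu>\<close> and \<open>\<kappa>\<close>. Up to constants \<open>Q / n\<close> is the mean degree, so the second condition
  says that small sets of nodes are much sparser than the whole hypergraph.
\<close>

definition typical ::
  "nat \<Rightarrow> nat \<Rightarrow> (nat set \<Rightarrow> real) \<Rightarrow> real \<Rightarrow> real \<Rightarrow> real \<Rightarrow> real \<Rightarrow> (nat set \<Rightarrow> bool) \<Rightarrow> bool" where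
  "typical n d p Q \<mu> \<kappa> \<sigma> f \<longleftrightarrow>
     (\<forall>s t. (\<forall>i. s i \<in> {-1, 1}) \<longrightarrow> (\<forall>i. t i \<in> {-1, 1}) \<longrightarrow>
        \<bar>\<Sum>e\<in>edges n d. sign_sum s t e * (of_bool (f e) - p e)\<bar> \<le> \<mu> * Q) \<and>
     (\<forall>U\<subseteq>{..<n}. 1 \<le> card U \<longrightarrow> real (card U) \<le> \<sigma> * real n \<longrightarrow>
        real (card (inner_edges n d f U)) < \<kappa> * (Q / real n) * real (card U))"

section \<open>The matrix of observed codegrees\<close>

text \<open>
  The matrix of the clustering step as a linear function of the edge weights, which makes sense
  for observed and for expected weights.
\<close>

definition codeg :: "nat \<Rightarrow> nat \<Rightarrow> (nat set \<Rightarrow> real) \<Rightarrow> nat \<Rightarrow> nat \<Rightarrow> real" where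
  "codeg n d w i j = (if i = j then 0 else \<Sum>e\<in>{e\<in>edges n d. {i, j} \<subseteq> e}. w e)"

lemma codeg_nonneg: "(\<And>e. 0 \<le> w e) \<Longrightarrow> 0 \<le> codeg n d w i j"
  by (simp add: codeg_def sum_nonneg)

lemma codeg_sym: "codeg n d w i j = codeg n d w j i"
  by (simp add: codeg_def insert_commute)

lemma bilin_codeg: "bilin {..<n} (codeg n d w) s t = (\<Sum>e\<in>edges n d. w e * sign_sum s t e)"
proof -
  have "bilin {..<n} (codeg n d w) s t =
      (\<Sum>i<n. \<Sum>j<n. \<Sum>e\<in>edges n d. w e * (if i \<in> e \<and> j \<in> e - {i} then s i * t j else 0))"
    unfolding bilin_def
  proof (intro sum.cong refl)
    fix i j
    have "(\<Sum>e\<in>edges n d. w e * (if i \<in> e \<and> j \<in> e - {i} then s i * t j else 0)) =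
        (\<Sum>e\<in>{e\<in>edges n d. i \<in> e \<and> j \<in> e - {i}}. w e * (s i * t j))"
      by (rule sum.mono_neutral_cong_right) auto
    also have "\<dots> = s i * codeg n d w i j * t j"
      by (auto simp: codeg_def sum_distrib_right sum_distrib_left mult_ac intro!: sum.cong)
    finally show "s i * codeg n d w i j * t j =
        (\<Sum>e\<in>edges n d. w e * (if i \<in> e \<and> j \<in> e - {i} then s i * t j else 0))" by simp
  qed
  also have "\<dots> = (\<Sum>e\<in>edges n d. w e * (\<Sum>i<n. \<Sum>j<n. if i \<in> e \<and> j \<in> e - {i} then s i * t j else 0))"
  proof -
    have "(\<Sum>i<n. \<Sum>j<n. \<Sum>e\<in>edges n d. w e * (if i \<in> e \<and> j \<in> e - {i} then s i * t j else 0)) =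
        (\<Sum>i<n. \<Sum>e\<in>edges n d. \<Sum>j<n. w e * (if i \<in> e \<and> j \<in> e - {i} then s i * t j else 0))"
      by (rule sum.cong[OF refl], rule sum.swap)
    also have "\<dots> = (\<Sum>e\<in>edges n d. \<Sum>i<n. \<Sum>j<n. w e * (if i \<in> e \<and> j \<in> e - {i} then s i * t j else 0))"
      by (rule sum.swap)
    finally show ?thesis by (simp only: sum_distrib_left)
  qed
  also have "\<dots> = (\<Sum>e\<in>edges n d. w e * sign_sum s t e)"
  proof (rule sum.cong[OF refl])
    fix e assume e: "e \<in> edges n d"
    have "(\<Sum>i<n. \<Sum>j<n. if i \<in> e \<and> j \<in> e - {i} then s i * t j else 0) =
        (\<Sum>i\<in>e. \<Sum>j<n. if j \<in> e - {i} then s i * t j else 0)"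
      using edgesD[OF e] by (intro sum.mono_neutral_cong_right) auto
    also have "\<dots> = sign_sum s t e"
      unfolding sign_sum_def
      by (intro sum.cong refl sum.mono_neutral_cong_right) (use edgesD[OF e] in auto)
    finally show "w e * (\<Sum>i<n. \<Sum>j<n. if i \<in> e \<and> j \<in> e - {i} then s i * t j else 0) = w e * sign_sum s t e"
      by simp
  qed
  finally show ?thesis .
qed

lemma bilin_indicator:
  assumes "finite I" "S \<subseteq> I" "T \<subseteq> I"
  shows "bilin I M (\<lambda>i. of_bool (i \<in> S)) (\<lambda>i. of_bool (i \<in> T)) = (\<Sum>i\<in>S. \<Sum>j\<in>T. M i j)"
proof -
  have "bilin I M (\<lambda>i. of_bool (i \<in> S)) (\<lambda>i. of_bool (i \<in> T)) =
      (\<Sum>i\<in>S. \<Sum>j\<in>I. of_bool (i \<in> S) * M i j * of_bool (j \<in> T))"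
    unfolding bilin_def using assms by (intro sum.mono_neutral_right) auto
  also have "\<dots> = (\<Sum>i\<in>S. \<Sum>j\<in>T. M i j)"
    using assms by (intro sum.cong refl sum.mono_neutral_cong_right) auto
  finally show ?thesis .
qed

lemma sign_sum_one: "finite e \<Longrightarrow> sign_sum (\<lambda>_. 1) (\<lambda>_. 1) e = real (card e) * (real (card e) - 1)"
  by (cases "e = {}") (auto simp: sign_sum_def of_nat_diff Suc_leI card_gt_0_iff)

lemma codeg_sum_le:
  fixes f :: "nat set \<Rightarrow> bool"
  assumes T: "T \<subseteq> {..<n}"
  shows "(\<Sum>i\<in>T. \<Sum>j\<in>T. codeg n d (\<lambda>e. of_bool (f e)) i j)
    \<le> (real d)\<^sup>2 * real (card (inner_edges n d f T))"
proof -
  let ?x = "\<lambda>i. of_bool (i \<in> T) :: real"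
  have "(\<Sum>i\<in>T. \<Sum>j\<in>T. codeg n d (\<lambda>e. of_bool (f e)) i j) =
      (\<Sum>e\<in>edges n d. of_bool (f e) * sign_sum ?x ?x e)"
    using bilin_indicator[OF _ T T, symmetric] by (simp add: bilin_codeg)
  also have "\<dots> \<le> (\<Sum>e\<in>edges n d. (real d)\<^sup>2 * of_bool (f e \<and> 2 \<le> card (e \<inter> T)))"
  proof (rule sum_mono)
    fix e assume e: "e \<in> edges n d"
    have eq: "sign_sum ?x ?x e = sign_sum (\<lambda>_. 1) (\<lambda>_. 1) (e \<inter> T)"
    proof -
      have "sign_sum ?x ?x e = (\<Sum>i\<in>e \<inter> T. \<Sum>j\<in>e - {i}. ?x i * ?x j)"
        unfolding sign_sum_def using edgesD[OF e] by (intro sum.mono_neutral_right) auto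
      also have "\<dots> = sign_sum (\<lambda>_. 1) (\<lambda>_. 1) (e \<inter> T)"
        unfolding sign_sum_def using edgesD(1)[OF e]
        by (intro sum.cong refl sum.mono_neutral_cong_right) auto
      finally show ?thesis .
    qed
    have fin: "finite (e \<inter> T)" using edgesD(1)[OF e] by simp
    have "sign_sum ?x ?x e \<le> (real d)\<^sup>2 * of_bool (2 \<le> card (e \<inter> T))"
    proof (cases "2 \<le> card (e \<inter> T)")
      case True
      have "card (e \<inter> T) \<le> d" using edgesD(2)[OF e] card_mono[OF edgesD(1)[OF e], of "e \<inter> T"] by simp
      then have "real (card (e \<inter> T)) * (real (card (e \<inter> T)) - 1) \<le> real d * real d"
        using True by (intro mult_mono) auto
      then show ?thesis using True by (simp add: eq sign_sum_one[OF fin] power2_eq_square)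
    next
      case False
      then have "card (e \<inter> T) = 0 \<or> card (e \<inter> T) = 1" by linarith
      then show ?thesis by (auto simp: eq sign_sum_one[OF fin] simp del: card_0_eq)
    qed
    then show "of_bool (f e) * sign_sum ?x ?x e \<le> (real d)\<^sup>2 * of_bool (f e \<and> 2 \<le> card (e \<inter> T))" by auto
  qed
  also have "\<dots> = (real d)\<^sup>2 * real (card (inner_edges n d f T))"
  proof -
    have "(\<Sum>e\<in>edges n d. (real d)\<^sup>2 * of_bool (f e \<and> 2 \<le> card (e \<inter> T))) =
        (\<Sum>e\<in>(inner_edges n d f T). (real d)\<^sup>2)"
      by (rule sum.mono_neutral_cong_right) auto
    then show ?thesis by simp
  qed
  finally show ?thesis .
qed

lemma codeg_row_sum:
  assumes "i < n"
  shows "(\<Sum>j<n. codeg n d w i j) = (real d - 1) * (\<Sum>e\<in>{e\<in>edges n d. i \<in> e}. w e)"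
proof -
  let ?x = "\<lambda>k. of_bool (k \<in> {i}) :: real"
  have "(\<Sum>j<n. codeg n d w i j) = bilin {..<n} (codeg n d w) ?x (\<lambda>j. of_bool (j \<in> {..<n}))"
    using assms by (subst bilin_indicator) auto
  also have "\<dots> = (\<Sum>e\<in>edges n d. w e * sign_sum ?x (\<lambda>j. of_bool (j \<in> {..<n})) e)" by (rule bilin_codeg)
  also have "\<dots> = (\<Sum>e\<in>{e\<in>edges n d. i \<in> e}. w e * (real d - 1))"
  proof (rule sum.mono_neutral_cong_right)
    fix e assume e: "e \<in> {e\<in>edges n d. i \<in> e}"
    then have e': "e \<in> edges n d" "i \<in> e" by auto
    have "sign_sum ?x (\<lambda>j. of_bool (j \<in> {..<n})) e = (\<Sum>k\<in>{i}. \<Sum>j\<in>e - {k}. ?x k * of_bool (j \<in> {..<n}))"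
      unfolding sign_sum_def using edgesD(1)[OF e'(1)] e' by (intro sum.mono_neutral_right) auto
    also have "\<dots> = (\<Sum>j\<in>e - {i}. 1)"
      using edgesD(3)[OF e'(1)] by simp
    also have "\<dots> = real d - 1"
      using edgesD(1,2)[OF e'(1)] e'(2) card_gt_0_iff[of e] by (auto simp: of_nat_diff Suc_leI)
    finally show "w e * sign_sum ?x (\<lambda>j. of_bool (j \<in> {..<n})) e = w e * (real d - 1)" by simp
  next
    show "\<forall>e\<in>edges n d - {e\<in>edges n d. i \<in> e}. w e * sign_sum ?x (\<lambda>j. of_bool (j \<in> {..<n})) e = 0"
      by (auto simp: sign_sum_def intro!: sum.neutral)
  qed auto
  finally show ?thesis by (simp add: sum_distrib_right[symmetric] mult.commute)
qed

lemma codeg_total: "(\<Sum>i<n. \<Sum>j<n. codeg n d w i j) = real d * (real d - 1) * (\<Sum>e\<in>edges n d. w e)"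
proof -
  have "(\<Sum>i<n. \<Sum>j<n. codeg n d w i j) = bilin {..<n} (codeg n d w) (\<lambda>_. 1) (\<lambda>_. 1)"
    by (simp add: bilin_def)
  also have "\<dots> = (\<Sum>e\<in>edges n d. w e * (real d * (real d - 1)))"
    unfolding bilin_codeg by (intro sum.cong refl) (simp add: sign_sum_one edgesD)
  finally show ?thesis by (simp add: sum_distrib_left mult_ac)
qed

section \<open>Spectral clustering of a typical hypergraph\<close>

lemma trim_mat:
  "trim c (mat n n (\<lambda>(i, j). A i j)) =
     mat n n (\<lambda>(i, j). if i \<in> {i\<in>{..<n}. c * (1 / real n) * (\<Sum>i<n. \<Sum>j<n. A i j) < (\<Sum>j<n. A i j)} \<or>
        j \<in> {i\<in>{..<n}. c * (1 / real n) * (\<Sum>i<n. \<Sum>j<n. A i j) < (\<Sum>j<n. A i j)} then 0 else A i j)"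
  unfolding trim_def Let_def by (intro eq_matI) auto

lemma adj_mat_codeg:
  assumes E: "E \<subseteq> edges n d" and w: "\<And>e. e \<in> edges n d \<Longrightarrow> (if e \<in> E then w e else 0) = v e"
  shows "adj_mat n E w = mat n n (\<lambda>(i, j). codeg n d v i j)"
proof (rule eq_matI)
  fix i j assume "i < dim_row (mat n n (\<lambda>(i, j). codeg n d v i j))" "j < dim_col (mat n n (\<lambda>(i, j). codeg n d v i j))"
  then have ij: "i < n" "j < n" by auto
  have v: "v e = (if e \<in> E then w e else 0)" if "e \<in> edges n d" for e using w[OF that] by simp
  have "(\<Sum>e\<in>{e\<in>E. {i, j} \<subseteq> e}. w e) = (\<Sum>e\<in>{e\<in>edges n d. {i, j} \<subseteq> e}. v e)"
    by (rule sum.mono_neutral_cong_left) (use E in \<open>auto simp: v subset_iff\<close>)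
  then show "adj_mat n E w $$ (i, j) = mat n n (\<lambda>(i, j). codeg n d v i j) $$ (i, j)"
    using ij by (simp add: adj_mat_def codeg_def)
qed (auto simp: adj_mat_def)

text \<open>
  Here \<open>\<rho> = \<alpha> * \<beta>\<close> is the probability that an edge lies in the first part and is not erased, and
  \<open>D\<close> is the scale of all degrees.
\<close>

locale two_groups =
  fixes n d :: nat and \<theta> \<rho> :: real and g :: "nat \<Rightarrow> nat"
  assumes d: "2 \<le> d" and \<theta>: "0 < \<theta>" "\<theta> < 1 / 2" and \<rho>: "0 < \<rho>" "\<rho> \<le> 1"
    and g: "\<And>i. i < n \<Longrightarrow> g i \<in> {0, 1}" and n_large: "4 * d\<^sup>2 \<le> n"
begin

definition grp_size :: "nat \<Rightarrow> nat" where "grp_size b = card {i\<in>{..<n}. g i = b}"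

definition p :: "nat set \<Rightarrow> real" where "p e = edge_mean \<rho> \<theta> g e"

definition Q :: real where "Q = real (n choose d) * \<rho>"

definition D :: real where "D = Q / real n"

definition B :: "nat \<Rightarrow> nat \<Rightarrow> real" where
  "B a b = \<rho> * \<theta> * real ((n - 2) choose (d - 2)) +
     (if a = b then \<rho> * (1 - 2 * \<theta>) * real ((grp_size a - 2) choose (d - 2)) else 0)"

lemma n_ge: "2 \<le> n" "d \<le> n" "2 * d \<le> n" "0 < real n"
proof -
  have "2 * d \<le> d\<^sup>2" using d by (simp add: power2_eq_square)
  then show "2 \<le> n" "d \<le> n" "2 * d \<le> n" "0 < real n" using n_large d by linarith+
qed

lemma Q_pos: "0 < Q" and D_pos: "0 < D" and Q_D: "Q = real n * D"
  using n_ge \<rho> by (auto simp: Q_def D_def)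

lemma p_bounds: "0 \<le> p e" "p e \<le> \<rho>"
proof -
  show "0 \<le> p e" using \<theta> \<rho> by (auto simp: p_def)
  have "p e \<le> \<rho> * 1" unfolding p_def using \<theta> \<rho> by (intro mult_left_mono) auto
  then show "p e \<le> \<rho>" by simp
qed

lemma p_split: "p e = \<rho> * \<theta> + \<rho> * (1 - 2 * \<theta>) * of_bool (g constant_on e)"
  by (simp add: p_def algebra_simps)

lemma size_le: "grp_size b \<le> n"
  unfolding grp_size_def using card_mono[of "{..<n}" "{i\<in>{..<n}. g i = b}"] by force

lemma sizes_sum: "grp_size 0 + grp_size 1 = n"
proof -
  have "grp_size 0 + grp_size 1 = card ({i\<in>{..<n}. g i = 0} \<union> {i\<in>{..<n}. g i = 1})"
    unfolding grp_size_def by (intro card_Un_disjoint[symmetric]) auto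
  also have "{i\<in>{..<n}. g i = 0} \<union> {i\<in>{..<n}. g i = 1} = {..<n}" using g by blast
  finally show ?thesis by simp
qed

lemma expected_codeg:
  assumes ij: "i < n" "j < n" "i \<noteq> j"
  shows "codeg n d p i j = B (g i) (g j)"
proof -
  let ?E = "{e\<in>edges n d. {i, j} \<subseteq> e}"
  have "codeg n d p i j = \<rho> * \<theta> * real (card ?E) + \<rho> * (1 - 2 * \<theta>) * real (card {e\<in>?E. g constant_on e})"
  proof -
    have "(\<Sum>e\<in>?E. of_bool (g constant_on e)) = (\<Sum>e\<in>{e\<in>?E. g constant_on e}. 1::real)"
      by (rule sum.mono_neutral_cong_right) auto
    then have "(\<Sum>e\<in>?E. of_bool (g constant_on e)) = real (card {e\<in>?E. g constant_on e})"
      by (simp only: sum_constant mult_1_right)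
    then show ?thesis
      using ij by (simp add: codeg_def p_split sum.distrib sum_distrib_left[symmetric] mult.commute)
  qed
  also have "card ?E = (n - 2) choose (d - 2)" using card_edges_through_pair[OF ij d] .
  also have "card {e\<in>?E. g constant_on e} = (if g i = g j then (grp_size (g i) - 2) choose (d - 2) else 0)"
  proof (cases "g i = g j")
    case True
    have "{e\<in>?E. g constant_on e} = {e. {i, j} \<subseteq> e \<and> e \<subseteq> {k\<in>{..<n}. g k = g i} \<and> card e = d}"
    proof (intro equalityI subsetI)
      fix e assume e: "e \<in> {e\<in>?E. g constant_on e}"
      then obtain y where y: "\<And>k. k \<in> e \<Longrightarrow> g k = y" by (auto simp: constant_on_def)
      have "i \<in> e" using e by auto
      then have "y = g i" using y by simp
      have "e \<subseteq> {..<n}" "card e = d" "{i, j} \<subseteq> e" using e by (auto simp: edges_def)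
      moreover from this have "e \<subseteq> {k\<in>{..<n}. g k = g i}" using y unfolding \<open>y = g i\<close> by blast
      ultimately show "e \<in> {e. {i, j} \<subseteq> e \<and> e \<subseteq> {k\<in>{..<n}. g k = g i} \<and> card e = d}" by blast
    next
      fix e assume e: "e \<in> {e. {i, j} \<subseteq> e \<and> e \<subseteq> {k\<in>{..<n}. g k = g i} \<and> card e = d}"
      then have "\<forall>k\<in>e. g k = g i" by auto
      then have "g constant_on e" unfolding constant_on_def by blast
      then show "e \<in> {e\<in>?E. g constant_on e}" using e by (auto simp: edges_def)
    qed
    then show ?thesis
      using True ij d card_supersets[of "{k\<in>{..<n}. g k = g i}" "{i, j}" d] by (simp add: grp_size_def numeral_2_eq_2)
  next
    case False
    then have "\<not> g constant_on e" if "i \<in> e" "j \<in> e" for e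
      using that unfolding constant_on_def by metis
    then have "{e\<in>?E. g constant_on e} = {}" by blast
    then show ?thesis using False by (simp only: card.empty if_False)
  qed
  finally show ?thesis by (simp add: B_def)
qed

lemma B_bounds: "\<bar>B a b\<bar> \<le> 2 * (real d)\<^sup>2 * D / real n"
proof -
  have nn: "0 \<le> B a b" using \<theta> \<rho> by (simp add: B_def)
  have "B a b \<le> \<rho> * \<theta> * real ((n - 2) choose (d - 2)) + \<rho> * (1 - 2 * \<theta>) * real ((n - 2) choose (d - 2))"
    unfolding B_def using \<theta> \<rho> size_le[of a] binomial_right_mono[of "grp_size a - 2" "n - 2" "d - 2"]
    by (intro add_left_mono) (auto intro!: mult_left_mono)
  also have "\<dots> = \<rho> * (1 - \<theta>) * real ((n - 2) choose (d - 2))" by (simp add: algebra_simps)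
  also have "\<dots> \<le> \<rho> * 1 * (2 * (real d)\<^sup>2 * real (n choose d) / (real n)\<^sup>2)"
    using \<theta> \<rho> pair_codegree_le[OF d n_ge(1)] by (intro mult_mono) auto
  also have "\<dots> = 2 * (real d)\<^sup>2 * D / real n" by (simp add: D_def Q_def power2_eq_square)
  finally show ?thesis using nn by simp
qed

lemma B_form_lower:
  assumes \<gamma>: "0 < \<gamma>" "\<gamma> \<le> 1" and sizes: "\<And>b. b \<in> {0, 1} \<Longrightarrow> \<gamma> * real n \<le> real (grp_size b)"
    and big: "2 * real d \<le> \<gamma> * real n"
  shows "((1 - 2 * \<theta>) * (\<gamma> / (2 * real d)) ^ d) * D * (\<Sum>i<n. (z (g i))\<^sup>2) \<le>
    bilin {..<n} (\<lambda>i j. B (g i) (g j)) (\<lambda>i. z (g i)) (\<lambda>i. z (g i))"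
proof -
  define t where "t = \<rho> * \<theta> * real ((n - 2) choose (d - 2))"
  define r where "r b = \<rho> * (1 - 2 * \<theta>) * real ((grp_size b - 2) choose (d - 2))" for b
  have t: "0 \<le> t" using \<theta> \<rho> by (simp add: t_def)
  have "bilin {..<n} (\<lambda>i j. B (g i) (g j)) (\<lambda>i. z (g i)) (\<lambda>i. z (g i)) =
      (\<Sum>i<n. \<Sum>j<n. t * (z (g i) * z (g j)) + (if g j = g i then r (g i) * (z (g i))\<^sup>2 else 0))"
  proof -
    have "B a b = t + (if a = b then r a else 0)" for a b by (simp add: B_def t_def r_def)
    then show ?thesis
      unfolding bilin_def by (intro sum.cong refl) (auto simp: power2_eq_square algebra_simps)
  qed
  also have "\<dots> = t * (\<Sum>i<n. z (g i))\<^sup>2 + (\<Sum>i<n. \<Sum>j<n. if g j = g i then r (g i) * (z (g i))\<^sup>2 else 0)"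
  proof -
    have "(\<Sum>i<n. \<Sum>j<n. t * (z (g i) * z (g j))) = t * (\<Sum>i<n. z (g i))\<^sup>2"
      unfolding power2_eq_square sum_product by (simp add: sum_distrib_left)
    then show ?thesis by (simp add: sum.distrib)
  qed
  also have "(\<Sum>i<n. \<Sum>j<n. if g j = g i then r (g i) * (z (g i))\<^sup>2 else 0) =
      (\<Sum>i<n. real (grp_size (g i)) * (r (g i) * (z (g i))\<^sup>2))"
  proof (rule sum.cong[OF refl])
    fix i
    have "(\<Sum>j<n. if g j = g i then r (g i) * (z (g i))\<^sup>2 else 0) = (\<Sum>j\<in>{j\<in>{..<n}. g j = g i}. r (g i) * (z (g i))\<^sup>2)"
      by (rule sum.mono_neutral_cong_right) auto
    then show "(\<Sum>j<n. if g j = g i then r (g i) * (z (g i))\<^sup>2 else 0) = real (grp_size (g i)) * (r (g i) * (z (g i))\<^sup>2)"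
      by (simp add: grp_size_def)
  qed
  finally have eq: "bilin {..<n} (\<lambda>i j. B (g i) (g j)) (\<lambda>i. z (g i)) (\<lambda>i. z (g i)) =
    t * (\<Sum>i<n. z (g i))\<^sup>2 + (\<Sum>i<n. real (grp_size (g i)) * (r (g i) * (z (g i))\<^sup>2))" .
  have "((1 - 2 * \<theta>) * (\<gamma> / (2 * real d)) ^ d) * D * (\<Sum>i<n. (z (g i))\<^sup>2) =
      (\<Sum>i<n. ((1 - 2 * \<theta>) * (\<gamma> / (2 * real d)) ^ d) * D * (z (g i))\<^sup>2)"
    by (rule sum_distrib_left)
  also have "\<dots> \<le> (\<Sum>i<n. (real (grp_size (g i)) * r (g i)) * (z (g i))\<^sup>2)"
  proof (intro sum_mono mult_right_mono)
    fix i assume "i \<in> {..<n}"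
    then have "(\<gamma> / (2 * real d)) ^ d * (real (n choose d) / real n) \<le> real ((grp_size (g i) - 2) choose (d - 2)) * real (grp_size (g i))"
      using sizes[OF g] by (intro group_codegree_ge[OF d \<gamma> _ size_le big]) auto
    then have "(\<rho> * (1 - 2 * \<theta>)) * ((\<gamma> / (2 * real d)) ^ d * (real (n choose d) / real n)) \<le>
        (\<rho> * (1 - 2 * \<theta>)) * (real ((grp_size (g i) - 2) choose (d - 2)) * real (grp_size (g i)))"
      using \<theta> \<rho> by (intro mult_left_mono) auto
    then show "((1 - 2 * \<theta>) * (\<gamma> / (2 * real d)) ^ d) * D \<le> real (grp_size (g i)) * r (g i)"
      by (simp add: r_def D_def Q_def mult_ac)
  qed auto
  also have "\<dots> \<le> t * (\<Sum>i<n. z (g i))\<^sup>2 + (\<Sum>i<n. real (grp_size (g i)) * (r (g i) * (z (g i))\<^sup>2))"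
    using t by (simp add: mult.assoc)
  finally show ?thesis unfolding eq .
qed

text \<open>
  At least a fraction of about \<open>2 * (1 / 2) ^ d\<close> of all edges is homogeneous. The constant depends on
  \<open>d\<close> only, which makes it possible to choose the trimming constant independently of the noise and
  of the group sizes.
\<close>

lemma expected_edges_ge: "(1 / 2) ^ (d + 1) * Q \<le> (\<Sum>e\<in>edges n d. p e)"
proof -
  let ?H = "\<lambda>b. {e. e \<subseteq> {i\<in>{..<n}. g i = b} \<and> card e = d}"
  have card_H: "card (?H b) = grp_size b choose d" for b
    unfolding grp_size_def by (rule n_subsets) simp
  have fin: "finite (?H b)" for b by (rule finite_subset[of _ "Pow {..<n}"]) auto
  have disj: "?H 0 \<inter> ?H 1 = {}"
  proof -
    have False if e: "e \<in> ?H 0" "e \<in> ?H 1" for e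
    proof -
      have "e \<noteq> {}" using e d by auto
      then obtain k where "k \<in> e" by blast
      then have "g k = 0" "g k = 1" using e by auto
      then show False by simp
    qed
    then show ?thesis by blast
  qed
  have "(1 - 1/2) * (2 * (1 / 2) ^ d) * real ((grp_size 0 + grp_size 1) choose d) \<le> real (grp_size 0 choose d) + real (grp_size 1 choose d)"
  proof (rule binomial_sum_ge)
    show "2 * real d \<le> real (grp_size 0 + grp_size 1)" unfolding sizes_sum using n_ge(3) by linarith
    have "real (4 * d\<^sup>2) \<le> real n" using n_large by (simp only: of_nat_le_iff)
    then show "2 * (real d)\<^sup>2 \<le> 1/2 * real (grp_size 0 + grp_size 1)" unfolding sizes_sum by simp
  qed simp
  then have *: "(1 / 2) ^ d * real (n choose d) \<le> real (grp_size 0 choose d) + real (grp_size 1 choose d)"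
    unfolding sizes_sum by simp
  have "(1 / 2) ^ (d + 1) * Q = \<rho> / 2 * ((1 / 2) ^ d * real (n choose d))" by (simp add: Q_def)
  also have "\<dots> \<le> \<rho> / 2 * (real (grp_size 0 choose d) + real (grp_size 1 choose d))"
    using * \<rho> by (intro mult_left_mono) auto
  also have "\<dots> = (\<Sum>e\<in>?H 0 \<union> ?H 1. \<rho> / 2)"
    by (simp only: sum_constant card_Un_disjoint[OF fin fin disj] card_H) (simp add: algebra_simps)
  also have "\<dots> \<le> (\<Sum>e\<in>?H 0 \<union> ?H 1. p e)"
  proof (rule sum_mono)
    fix e assume "e \<in> ?H 0 \<union> ?H 1"
    then have "g constant_on e" by (auto simp: constant_on_def)
    then have "p e = \<rho> * (1 - \<theta>)" by (simp add: p_def)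
    also have "\<rho> * (1 / 2) \<le> \<rho> * (1 - \<theta>)" using \<theta> \<rho> by (intro mult_left_mono) auto
    finally show "\<rho> / 2 \<le> p e" by simp
  qed
  also have "\<dots> \<le> (\<Sum>e\<in>edges n d. p e)"
    using p_bounds by (intro sum_mono2) (auto simp: edges_def)
  finally show ?thesis .
qed

lemma expected_edges_le: "(\<Sum>e\<in>edges n d. p e) \<le> Q"
proof -
  have "(\<Sum>e\<in>edges n d. p e) \<le> (\<Sum>e\<in>edges n d. \<rho>)" by (intro sum_mono p_bounds)
  then show ?thesis by (simp add: card_edges Q_def)
qed

lemma expected_degree_le:
  assumes "i < n"
  shows "(\<Sum>e\<in>{e\<in>edges n d. i \<in> e}. p e) \<le> real d * D"
proof -
  have "(\<Sum>e\<in>{e\<in>edges n d. i \<in> e}. p e) \<le> (\<Sum>e\<in>{e\<in>edges n d. i \<in> e}. \<rho>)" by (intro sum_mono p_bounds)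
  also have "\<dots> = real ((n - 1) choose (d - 1)) * \<rho>" using card_edges_through[OF assms, of d] d by simp
  also have "\<dots> = real d * D"
  proof -
    have "real d * real (n choose d) = real n * real ((n - 1) choose (d - 1))"
      using times_binomial_minus1_eq[of d n] d by (metis of_nat_mult not_gr_zero not_numeral_le_zero)
    then show ?thesis using n_ge(4) by (simp add: D_def Q_def field_simps)
  qed
  finally show ?thesis .
qed

text \<open>
  On average a row of \<open>A\<close> sums to at least \<open>d * (d - 1) * D / 2 ^ (d + 2)\<close>, and no expected row sum exceeds
  \<open>d * (d - 1) * D\<close>. With the trimming constant \<open>2 ^ (d + 3)\<close> every trimmed row thus exceeds its
  expectation by more than \<open>D\<close>. The total excess is bounded by the first part of typicality, so
  only few rows are trimmed, while the remaining ones are bounded by a multiple of \<open>D\<close>.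
\<close>

lemma typical_trimmed_form_bound:
  fixes f :: "nat set \<Rightarrow> bool"
  defines "A \<equiv> codeg n d (\<lambda>e. of_bool (f e))"
  defines "H \<equiv> {i\<in>{..<n}. 2 ^ (d + 3) * (1 / real n) * (\<Sum>i<n. \<Sum>j<n. A i j) < (\<Sum>j<n. A i j)}"
  assumes tf: "typical n d p Q \<mu> \<kappa> \<sigma> f"
    and \<mu>: "0 < \<mu>" "\<mu> \<le> (1 / 2) ^ (d + 1)" "\<mu> \<le> \<sigma> / 4" and \<kappa>: "0 < \<kappa>" and \<sigma>: "0 < \<sigma>"
  shows "\<bar>bilin {..<n} (\<lambda>i j. (if i \<in> H \<or> j \<in> H then 0 else A i j) - B (g i) (g j)) x y\<bar> \<le>
    (8 * sqrt ((real d)\<^sup>2 * \<kappa> * (2 ^ (d + 3) * (real d)\<^sup>2)) + 2 * (2 * (real d)\<^sup>2) * sqrt \<sigma> +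
      4 * (\<mu> + 2 * (real d)\<^sup>2 / real n) / \<sigma>) * D * L2_set x {..<n} * L2_set y {..<n}"
proof -
  define A' where "A' = codeg n d p"
  define dd where "dd = real d * (real d - 1)"
  have dd: "2 \<le> dd"
  proof -
    have "2 * 1 \<le> dd" unfolding dd_def using d by (intro mult_mono) auto
    then show ?thesis by simp
  qed
  have Ann: "0 \<le> A i j" for i j by (simp add: A_def codeg_nonneg)
  have diff: "bilin {..<n} (\<lambda>i j. A i j - A' i j) s t = (\<Sum>e\<in>edges n d. sign_sum s t e * (of_bool (f e) - p e))" for s t
    unfolding bilin_diff A_def A'_def bilin_codeg sum_subtractf[symmetric] by (simp add: algebra_simps)
  have cut: "\<bar>bilin {..<n} (\<lambda>i j. A i j - A' i j) s t\<bar> \<le> \<mu> * Q"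
    if "\<forall>i. s i \<in> {-1, 1}" "\<forall>i. t i \<in> {-1, 1}" for s t
    unfolding diff using tf that by (simp add: typical_def)
  \<comment> \<open>the number of observed edges is close to its mean\<close>
  define W where "W = (\<Sum>e\<in>edges n d. of_bool (f e) :: real)"
  define EW where "EW = (\<Sum>e\<in>edges n d. p e)"
  have total: "(\<Sum>i<n. \<Sum>j<n. A i j) = dd * W"
    by (simp add: A_def codeg_total W_def dd_def)
  have dev: "\<bar>dd * W - dd * EW\<bar> \<le> \<mu> * Q"
  proof -
    have "bilin {..<n} (\<lambda>i j. A i j - A' i j) (\<lambda>_. 1) (\<lambda>_. 1) = dd * W - dd * EW"
      unfolding bilin_diff by (simp add: bilin_def total) (simp add: A'_def codeg_total EW_def dd_def)
    then show ?thesis using cut[of "\<lambda>_. 1" "\<lambda>_. 1"] by simp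
  qed
  define thr where "thr = 2 ^ (d + 3) * (1 / real n) * (\<Sum>i<n. \<Sum>j<n. A i j)"
  have H: "H = {i\<in>{..<n}. thr < (\<Sum>j<n. A i j)}" by (simp add: H_def thr_def)
  have thr_ge: "2 * dd * D \<le> thr"
  proof -
    have "dd * ((1 / 2) ^ (d + 1) * Q) \<le> dd * EW"
      unfolding EW_def using dd by (intro mult_left_mono expected_edges_ge) auto
    moreover have "\<mu> * Q \<le> (dd / 2 * (1 / 2) ^ (d + 1)) * Q"
    proof (intro mult_right_mono)
      have "1 * (1 / 2) ^ (d + 1) \<le> dd / 2 * (1 / 2::real) ^ (d + 1)" using dd by (intro mult_right_mono) auto
      then show "\<mu> \<le> dd / 2 * (1 / 2) ^ (d + 1)" using \<mu> by linarith
    qed (use Q_pos in auto)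
    ultimately have "dd / 2 * (1 / 2) ^ (d + 1) * Q \<le> dd * W" using dev by (simp add: algebra_simps)
    then have "2 ^ (d + 3) * (1 / real n) * (dd / 2 * (1 / 2) ^ (d + 1) * Q) \<le> thr"
      unfolding thr_def total by (intro mult_left_mono) auto
    moreover have "2 ^ (d + 3) * (1 / real n) * (dd / 2 * (1 / 2) ^ (d + 1) * Q) = 2 * dd * D"
      by (simp add: D_def power_add power_divide)
    ultimately show ?thesis by simp
  qed
  have thr_le: "thr \<le> (2 ^ (d + 3) * (real d)\<^sup>2) * D"
  proof -
    have "(1 / 2 :: real) ^ (d + 1) \<le> 1" by (rule power_le_one) auto
    then have "\<mu> \<le> 1" using \<mu> by linarith
    have "dd * EW \<le> dd * Q" unfolding EW_def using dd by (intro mult_left_mono expected_edges_le) auto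
    moreover have "\<mu> * Q \<le> real d * Q" using \<open>\<mu> \<le> 1\<close> Q_pos d by (intro mult_right_mono) auto
    ultimately have "dd * W \<le> dd * Q + real d * Q" using dev by linarith
    also have "\<dots> = (real d)\<^sup>2 * Q" by (simp add: dd_def power2_eq_square algebra_simps)
    finally have "thr \<le> 2 ^ (d + 3) * (1 / real n) * ((real d)\<^sup>2 * Q)"
      unfolding thr_def total by (intro mult_left_mono) auto
    then show ?thesis by (simp add: D_def mult_ac)
  qed
  have card_H: "real (card H) \<le> \<mu> * real n"
  proof -
    have HI: "H \<subseteq> {..<n}" by (auto simp: H)
    have excess: "D \<le> (\<Sum>j<n. A i j - A' i j)" if "i \<in> H" for i
    proof -
      have i: "i < n" "thr < (\<Sum>j<n. A i j)" using that by (auto simp: H)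
      have "(\<Sum>j<n. A' i j) \<le> (real d - 1) * (real d * D)"
        unfolding A'_def codeg_row_sum[OF i(1)] using d by (intro mult_left_mono expected_degree_le i) auto
      then have "(\<Sum>j<n. A' i j) \<le> dd * D" by (simp add: dd_def mult_ac)
      moreover have "1 * D \<le> dd * D" using dd D_pos by (intro mult_right_mono) auto
      ultimately show ?thesis using i(2) thr_ge by (simp add: sum_subtractf)
    qed
    have "real (card H) * D = (\<Sum>i\<in>H. D)" by simp
    also have "\<dots> \<le> (\<Sum>i\<in>H. \<Sum>j<n. A i j - A' i j)" by (rule sum_mono) (rule excess)
    also have "\<dots> = bilin {..<n} (\<lambda>i j. A i j - A' i j) (\<lambda>i. of_bool (i \<in> H)) (\<lambda>i. of_bool (i \<in> {..<n}))"
      using HI by (subst bilin_indicator) auto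
    also have "\<dots> \<le> \<bar>\<dots>\<bar>" by simp
    also have "\<dots> \<le> 1 * 1 * (\<mu> * Q)"
      by (intro form_le_of_sign_vectors cut) auto
    finally show ?thesis using D_pos by (simp add: Q_D)
  qed
  show ?thesis
  proof (rule trimmed_form_bound[where A = A and H = H])
    show "A i j = A j i" for i j by (simp add: A_def codeg_sym)
    show "H \<subseteq> {..<n}" by (auto simp: H)
    have "\<mu> * real n \<le> \<sigma> / 4 * real n" using \<mu> by (intro mult_right_mono) auto
    then show "real (card H) \<le> \<sigma> * real (card {..<n}) / 4" using card_H by simp
    show "(\<Sum>j\<in>{..<n}. A i j) \<le> (2 ^ (d + 3) * (real d)\<^sup>2) * D" if "i \<in> {..<n} - H" for i
      using that thr_le by (auto simp: H)
    show "(\<Sum>i\<in>T. \<Sum>j\<in>T. A i j) \<le> ((real d)\<^sup>2 * \<kappa>) * D * real (card T)"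
      if T: "T \<subseteq> {..<n}" "real (card T) \<le> \<sigma> * real (card {..<n})" for T
    proof (cases "T = {}")
      case False
      then have "1 \<le> card T" using T(1) finite_subset[OF T(1)] by (simp add: Suc_leI card_gt_0_iff)
      then have "real (card (inner_edges n d f T)) \<le> \<kappa> * D * real (card T)"
        using tf T by (auto simp: typical_def D_def intro: less_imp_le)
      then have "(real d)\<^sup>2 * real (card (inner_edges n d f T)) \<le> (real d)\<^sup>2 * (\<kappa> * D * real (card T))"
        by (intro mult_left_mono) auto
      then show ?thesis using codeg_sum_le[OF T(1), of d f] unfolding A_def by (simp add: mult_ac)
    qed simp
    show "\<bar>B (g i) (g j)\<bar> \<le> (2 * (real d)\<^sup>2) * D / real (card {..<n})" for i j
      using B_bounds by simp
    fix s t :: "nat \<Rightarrow> real" assume st: "\<forall>i. s i \<in> {-1, 1}" "\<forall>i. t i \<in> {-1, 1}"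
    have "bilin {..<n} (\<lambda>i j. A i j - B (g i) (g j)) s t =
        bilin {..<n} (\<lambda>i j. A i j - A' i j) s t - (\<Sum>i<n. s i * B (g i) (g i) * t i)"
    proof -
      have "s i * (A i j - B (g i) (g j)) * t j =
          s i * (A i j - A' i j) * t j - (if j = i then s i * B (g i) (g i) * t i else 0)" if "i < n" "j < n" for i j
        using that by (auto simp: A'_def expected_codeg) (simp add: codeg_def algebra_simps)
      then show ?thesis unfolding bilin_def by (simp add: sum_subtractf)
    qed
    moreover have "\<bar>\<Sum>i<n. s i * B (g i) (g i) * t i\<bar> \<le> 2 * (real d)\<^sup>2 * D"
    proof -
      have "\<bar>\<Sum>i<n. s i * B (g i) (g i) * t i\<bar> \<le> (\<Sum>i<n. 2 * (real d)\<^sup>2 * D / real n)"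
      proof (rule order.trans[OF sum_abs], rule sum_mono)
        fix i
        have "\<bar>s i\<bar> = 1" "\<bar>t i\<bar> = 1" using st(1)[rule_format, of i] st(2)[rule_format, of i] by auto
        then show "\<bar>s i * B (g i) (g i) * t i\<bar> \<le> 2 * (real d)\<^sup>2 * D / real n"
          using B_bounds by (simp add: abs_mult)
      qed
      then show ?thesis using n_ge(4) by simp
    qed
    ultimately have "\<bar>bilin {..<n} (\<lambda>i j. A i j - B (g i) (g j)) s t\<bar> \<le> \<mu> * Q + 2 * (real d)\<^sup>2 * D"
      using cut[OF st] by linarith
    also have "\<dots> = (\<mu> + 2 * (real d)\<^sup>2 / real n) * D * real (card {..<n})"
      using n_ge(4) by (simp add: Q_D field_simps)
    finally show "\<bar>bilin {..<n} (\<lambda>i j. A i j - B (g i) (g j)) s t\<bar> \<le>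
      (\<mu> + 2 * (real d)\<^sup>2 / real n) * D * real (card {..<n})" .
  qed (use Ann \<kappa> \<sigma> D_pos in \<open>auto\<close>)
qed

end

text \<open>
  The parameters of typicality and \<open>n0\<close> are fixed before the density \<open>\<rho>\<close>, the groups and the
  observations. The clustering step sees the indicator \<open>f\<close> of the edges with weight \<open>1\<close>, and
  \<open>2 ^ (d + 3)\<close> is its trimming constant.
\<close>

definition typicality_suffices ::
  "nat \<Rightarrow> real \<Rightarrow> real \<Rightarrow> real \<Rightarrow> real \<Rightarrow> real \<Rightarrow> real \<Rightarrow> real \<Rightarrow> nat \<Rightarrow> bool" where
  "typicality_suffices d \<theta> \<gamma> \<delta> \<epsilon> \<mu> \<kappa> \<sigma> n0 \<longleftrightarrow>
     (\<forall>n\<ge>n0. \<forall>\<rho> g f E w \<Phi>. 0 < \<rho> \<longrightarrow> \<rho> \<le> 1 \<longrightarrow> (\<forall>i<n. g i \<in> {0, 1}) \<longrightarrow>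
        (\<forall>b\<in>{0, 1}. \<gamma> * real n \<le> real (card {i\<in>{..<n}. g i = b})) \<longrightarrow>
        typical n d (edge_mean \<rho> \<theta> g) (real (n choose d) * \<rho>) \<mu> \<kappa> \<sigma> f \<longrightarrow>
        E \<subseteq> edges n d \<longrightarrow> (\<forall>e\<in>edges n d. (if e \<in> E then w e else 0) = of_bool (f e)) \<longrightarrow>
        hsc_output (2 ^ (d + 3)) \<epsilon> 2 n E w \<Phi> \<longrightarrow>
        (\<exists>\<pi>. \<pi> permutes {0, 1::nat} \<and> real (card (misplaced n g \<pi> \<Phi>)) \<le> \<delta> * real n))"

text \<open>
  The tolerated fraction \<open>\<delta>\<close> fixes how small the cost \<open>K\<close> of the partition into the groups must be,
  and so the admissible perturbation \<open>\<eta>\<close>. Then \<open>\<kappa>\<close>, \<open>\<sigma>\<close>, \<open>\<mu>\<close> and \<open>n0\<close> are chosen in this order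
  so that each of the four terms in the bound on the perturbation is at most \<open>\<eta> / 4\<close>.
\<close>

lemma typical_recovers:
  fixes d :: nat and \<theta> \<gamma> \<delta> \<epsilon> :: real
  assumes d: "2 \<le> d" and \<theta>: "0 < \<theta>" "\<theta> < 1 / 2" and \<gamma>: "0 < \<gamma>" "\<gamma> \<le> 1" and "0 < \<delta>" "0 < \<epsilon>"
  obtains \<mu> \<kappa> \<sigma> n0 where "0 < \<mu>" "\<mu> \<le> 1" "0 < \<kappa>" "0 < \<sigma>" "\<sigma> \<le> exp (- 1)"
    "2 * (real d)\<^sup>2 * sqrt \<sigma> \<le> \<kappa> / 4"
    "typicality_suffices d \<theta> \<gamma> \<delta> \<epsilon> \<mu> \<kappa> \<sigma> n0"
proof -
  define c where "c = (1 - 2 * \<theta>) * (\<gamma> / (2 * real d)) ^ d"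
  have c: "0 < c" using \<theta> \<gamma> d by (simp add: c_def)
  define K where "K = min (1 / 8) (min \<delta> (\<gamma> / 2) / (32 * (2 + \<epsilon>)))"
  have K: "0 < K" "K \<le> 1 / 8" using \<open>0 < \<delta>\<close> \<open>0 < \<epsilon>\<close> \<gamma> by (auto simp: K_def)
  have K\<delta>: "32 * (2 + \<epsilon>) * K \<le> min \<delta> (\<gamma> / 2)"
  proof -
    have "K \<le> min \<delta> (\<gamma> / 2) / (32 * (2 + \<epsilon>))" unfolding K_def by (rule min.cobounded2)
    then show ?thesis using \<open>0 < \<epsilon>\<close> by (simp add: pos_le_divide_eq mult.commute)
  qed
  define \<eta> where "\<eta> = c * sqrt (K / 8)"
  have \<eta>: "0 < \<eta>" using c K by (simp add: \<eta>_def)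
  have K_eq: "K = 8 * (\<eta> / c)\<^sup>2" using c K by (simp add: \<eta>_def)
  have \<eta>c: "2 * \<eta> \<le> c"
  proof -
    have "sqrt (K / 8) \<le> sqrt ((1 / 8)\<^sup>2)" using K by (intro real_sqrt_le_mono) (simp add: power2_eq_square)
    then have "sqrt (K / 8) \<le> 1 / 8" by simp
    then have "c * sqrt (K / 8) \<le> c * (1 / 8)" using c by (intro mult_left_mono) auto
    then show ?thesis using c by (simp add: \<eta>_def)
  qed
  define C where "C = 2 ^ (d + 3) * (real d)\<^sup>2"
  have C: "0 < C" using d by (simp add: C_def)
  define \<kappa> where "\<kappa> = (\<eta> / 32)\<^sup>2 / ((real d)\<^sup>2 * C)"
  have \<kappa>: "0 < \<kappa>" using \<eta> C d by (simp add: \<kappa>_def)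
  have term1: "8 * sqrt ((real d)\<^sup>2 * \<kappa> * C) = \<eta> / 4"
  proof -
    have "(real d)\<^sup>2 * \<kappa> * C = (\<eta> / 32)\<^sup>2" using C d by (simp add: \<kappa>_def)
    then have "sqrt ((real d)\<^sup>2 * \<kappa> * C) = \<eta> / 32" using \<eta> by (simp only: real_sqrt_abs)
    then show ?thesis by simp
  qed
  define s where "s = min (\<kappa> / 8) (\<eta> / 16) / (real d)\<^sup>2"
  have s: "0 < s" using \<kappa> \<eta> d by (simp add: s_def)
  define \<sigma> where "\<sigma> = min (exp (- 1)) (s\<^sup>2)"
  have \<sigma>: "0 < \<sigma>" "\<sigma> \<le> exp (- 1)" using s by (auto simp: \<sigma>_def)
  have "sqrt \<sigma> \<le> sqrt (s\<^sup>2)" by (intro real_sqrt_le_mono) (simp add: \<sigma>_def)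
  then have "sqrt \<sigma> \<le> s" using s by simp
  then have "(real d)\<^sup>2 * sqrt \<sigma> \<le> (real d)\<^sup>2 * s" by (intro mult_left_mono) auto
  also have "(real d)\<^sup>2 * s = min (\<kappa> / 8) (\<eta> / 16)" using d by (simp add: s_def)
  finally have \<sigma>s: "(real d)\<^sup>2 * sqrt \<sigma> \<le> \<kappa> / 8" "(real d)\<^sup>2 * sqrt \<sigma> \<le> \<eta> / 16" by auto
  define \<mu> where "\<mu> = min ((1 / 2) ^ (d + 1)) (min (\<sigma> / 4) (\<sigma> * \<eta> / 16))"
  have \<mu>: "0 < \<mu>" "\<mu> \<le> (1 / 2) ^ (d + 1)" "\<mu> \<le> \<sigma> / 4" "\<mu> \<le> \<sigma> * \<eta> / 16"
    using \<sigma> \<eta> by (auto simp: \<mu>_def)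
  have "(1 / 2 :: real) ^ (d + 1) \<le> 1" by (rule power_le_one) auto
  then have \<mu>1: "\<mu> \<le> 1" using \<mu> by linarith
  define n0 where "n0 = 4 * d\<^sup>2 + nat \<lceil>2 * real d / \<gamma> + 32 * (real d)\<^sup>2 / (\<eta> * \<sigma>)\<rceil>"
  show thesis
  proof (rule that[OF \<mu>(1) \<mu>1 \<kappa> \<sigma>])
    show "2 * (real d)\<^sup>2 * sqrt \<sigma> \<le> \<kappa> / 4" using \<sigma>s by simp
    show "typicality_suffices d \<theta> \<gamma> \<delta> \<epsilon> \<mu> \<kappa> \<sigma> n0"
      unfolding typicality_suffices_def
    proof (intro allI impI)
      fix n and \<rho> :: real and g \<Phi> :: "nat \<Rightarrow> nat" and f :: "nat set \<Rightarrow> bool" and E :: "nat set set" and w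
      assume n: "n0 \<le> n" and \<rho>: "0 < \<rho>" "\<rho> \<le> 1" and g_all: "\<forall>i<n. g i \<in> {0, 1}"
        and sizes_all: "\<forall>b\<in>{0, 1}. \<gamma> * real n \<le> real (card {i\<in>{..<n}. g i = b})"
        and tf: "typical n d (edge_mean \<rho> \<theta> g) (real (n choose d) * \<rho>) \<mu> \<kappa> \<sigma> f"
        and E: "E \<subseteq> edges n d" and w_all: "\<forall>e\<in>edges n d. (if e \<in> E then w e else 0) = of_bool (f e)"
        and out: "hsc_output (2 ^ (d + 3)) \<epsilon> 2 n E w \<Phi>"
      note g = g_all[rule_format] and sizes = bspec[OF sizes_all] and w = bspec[OF w_all]
      have "4 * d\<^sup>2 \<le> n" using n by (simp add: n0_def)
      then interpret two_groups n d \<theta> \<rho> g using d \<theta> \<rho> g by unfold_locales auto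
      have big: "2 * real d / \<gamma> + 32 * (real d)\<^sup>2 / (\<eta> * \<sigma>) \<le> real n"
        using n by (simp add: n0_def) linarith
      have "0 \<le> 2 * real d / \<gamma>" "0 \<le> 32 * (real d)\<^sup>2 / (\<eta> * \<sigma>)" using \<gamma> \<eta> \<sigma> by auto
      with big have "2 * real d / \<gamma> \<le> real n" "32 * (real d)\<^sup>2 / (\<eta> * \<sigma>) \<le> real n" by linarith+
      then have big1: "2 * real d \<le> \<gamma> * real n" and big2: "32 * (real d)\<^sup>2 \<le> real n * (\<eta> * \<sigma>)"
        using \<gamma> \<eta> \<sigma> by (auto simp: divide_le_eq mult.commute)
      have tf': "typical n d p Q \<mu> \<kappa> \<sigma> f" using tf by (simp add: p_def[abs_def] Q_def)
      define A where "A = codeg n d (\<lambda>e. of_bool (f e))"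
      define H where "H = {i\<in>{..<n}. 2 ^ (d + 3) * (1 / real n) * (\<Sum>i<n. \<Sum>j<n. A i j) < (\<Sum>j<n. A i j)}"
      define A0 where "A0 i j = (if i \<in> H \<or> j \<in> H then 0 else A i j)" for i j
      have trim: "trim (2 ^ (d + 3)) (adj_mat n E w) = mat n n (\<lambda>(i, j). A0 i j)"
      proof -
        have "adj_mat n E w = mat n n (\<lambda>(i, j). A i j)"
          unfolding A_def by (rule adj_mat_codeg[OF E w])
        then show ?thesis unfolding A0_def H_def by (simp only: trim_mat)
      qed
      obtain U where U: "top_eigenvectors (mat n n (\<lambda>(i, j). A0 i j)) 2 U" "approx_kmeans \<epsilon> U 2 \<Phi>"
        using out unfolding hsc_output_def trim by blast
      have coeff: "8 * sqrt ((real d)\<^sup>2 * \<kappa> * (2 ^ (d + 3) * (real d)\<^sup>2)) + 2 * (2 * (real d)\<^sup>2) * sqrt \<sigma> +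
        4 * (\<mu> + 2 * (real d)\<^sup>2 / real n) / \<sigma> \<le> \<eta>"
      proof -
        have "4 * \<mu> / \<sigma> \<le> \<eta> / 4" using \<mu>(4) \<sigma> by (simp add: divide_le_eq mult_ac)
        moreover have "8 * (real d)\<^sup>2 / (real n * \<sigma>) \<le> \<eta> / 4"
          using big2 n_ge(4) \<sigma> by (simp add: divide_le_eq mult_ac)
        moreover have "4 * (\<mu> + 2 * (real d)\<^sup>2 / real n) / \<sigma> = 4 * \<mu> / \<sigma> + 8 * (real d)\<^sup>2 / (real n * \<sigma>)"
          by (simp add: add_divide_distrib distrib_left)
        ultimately show ?thesis using term1 \<sigma>s(2) unfolding C_def by linarith
      qed
      have "\<exists>\<pi>. \<pi> permutes {0, 1::nat} \<and> real (card (misplaced n g \<pi> \<Phi>)) \<le> 32 * (2 + \<epsilon>) * K * real n"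
      proof (rule hsc_recovers_groups[OF U \<open>0 < \<epsilon>\<close> n_ge(1) D_pos c _ \<eta>c g _ _ K_eq K(2)])
        show "\<bar>bilin {..<n} (\<lambda>i j. A0 i j - B (g i) (g j)) x y\<bar> \<le> \<eta> * D * L2_set x {..<n} * L2_set y {..<n}" for x y
        proof -
          have "\<bar>bilin {..<n} (\<lambda>i j. A0 i j - B (g i) (g j)) x y\<bar> \<le>
              (8 * sqrt ((real d)\<^sup>2 * \<kappa> * (2 ^ (d + 3) * (real d)\<^sup>2)) + 2 * (2 * (real d)\<^sup>2) * sqrt \<sigma> +
                4 * (\<mu> + 2 * (real d)\<^sup>2 / real n) / \<sigma>) * D * L2_set x {..<n} * L2_set y {..<n}"
            unfolding A0_def H_def A_def by (rule typical_trimmed_form_bound[OF tf' \<mu>(1-3) \<kappa> \<sigma>(1)])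
          also have "\<dots> \<le> \<eta> * D * L2_set x {..<n} * L2_set y {..<n}"
            using D_pos by (intro mult_right_mono coeff) auto
          finally show ?thesis .
        qed
        show "c * D * (\<Sum>i<n. (z (g i))\<^sup>2) \<le> bilin {..<n} (\<lambda>i j. B (g i) (g j)) (\<lambda>i. z (g i)) (\<lambda>i. z (g i))" for z
          unfolding c_def using sizes by (intro B_form_lower \<gamma> big1) (simp add: grp_size_def)
        show "32 * (2 + \<epsilon>) * K * real n < real (card {i\<in>{..<n}. g i = b})" if "b \<in> {0, 1}" for b
        proof -
          have "32 * (2 + \<epsilon>) * K * real n \<le> \<gamma> / 2 * real n" using K\<delta> by (intro mult_right_mono) auto
          also have "\<dots> < \<gamma> * real n" using \<gamma> n_ge(4) by simp
          finally show ?thesis using sizes[OF that] by linarith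
        qed
      qed (use \<eta> in auto)
      moreover have "32 * (2 + \<epsilon>) * K * real n \<le> \<delta> * real n" using K\<delta> by (intro mult_right_mono) auto
      ultimately show "\<exists>\<pi>. \<pi> permutes {0, 1::nat} \<and> real (card (misplaced n g \<pi> \<Phi>)) \<le> \<delta> * real n"
        by (meson order.trans)
    qed
  qed
qed

section \<open>Local refinement\<close>

lemma constant_on_cong: "(\<And>x. x \<in> S \<Longrightarrow> f x = h x) \<Longrightarrow> f constant_on S \<longleftrightarrow> h constant_on S"
  by (simp add: constant_on_def)

lemma set_pmf_measurement:
  assumes "0 \<le> \<theta>" "\<theta> \<le> 1" "0 \<le> a" "a \<le> 1"
  shows "set_pmf (measurement_pmf \<theta> a \<Psi> e) \<subseteq> {None, Some 0, Some 1}"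
proof -
  have wf: "pmf_of_list_wf [(Some (1::nat), a * (1 - \<theta>)), (Some 0, a * \<theta>), (None, 1 - a)]"
       "pmf_of_list_wf [(Some (1::nat), a * \<theta>), (Some 0, a * (1 - \<theta>)), (None, 1 - a)]"
    using assms by (auto simp: pmf_of_list_wf_def algebra_simps mult_left_le_one_le)
  show ?thesis
    using set_pmf_of_list[OF wf(1)] set_pmf_of_list[OF wf(2)] by (auto simp: measurement_pmf_def)
qed

lemma expectation_measurement:
  fixes F :: "nat option \<Rightarrow> real"
  assumes "0 \<le> \<theta>" "\<theta> \<le> 1" "0 \<le> a" "a \<le> 1"
  shows "measure_pmf.expectation (measurement_pmf \<theta> a \<Psi> e) F =
    (1 - a) * F None + a * ((1 - \<theta>) * F (Some (homogeneity \<Psi> e)) + \<theta> * F (Some (1 - homogeneity \<Psi> e)))"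
proof -
  have "measure_pmf.expectation (measurement_pmf \<theta> a \<Psi> e) F =
      (\<Sum>x\<in>{None, Some 0, Some 1}. F x * pmf (measurement_pmf \<theta> a \<Psi> e) x)"
    using set_pmf_measurement[OF assms, of \<Psi> e] by (intro integral_measure_pmf_real) auto
  then show ?thesis
    by (cases "\<Psi> constant_on e")
       (simp_all add: pmf_measurement_pmf[OF assms, simplified] homogeneity_def algebra_simps)
qed

lemma disagreements_eq:
  assumes "finite E"
  shows "real (disagreements E W V) = real (card E) - (\<Sum>e\<in>E. of_bool (W e = Some (homogeneity V e)))"
proof -
  have "(\<Sum>e\<in>E. of_bool (W e = Some (homogeneity V e)) :: real) = (\<Sum>e\<in>{e\<in>E. W e = Some (homogeneity V e)}. 1)"
    using assms by (intro sum.mono_neutral_cong_right) auto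
  moreover have "card E = card {e\<in>E. W e = Some (homogeneity V e)} + card {e\<in>E. W e \<noteq> Some (homogeneity V e)}"
    using assms by (subst card_Un_disjoint[symmetric]) (auto intro!: arg_cong[of _ _ card])
  ultimately show ?thesis by (simp add: disagreements_def)
qed

text \<open>
  How much the observation \<open>x\<close> of the edge \<open>e\<close> favours the label \<open>1 - y\<close> of \<open>i\<close> over the label \<open>y\<close>,
  given the labels \<open>X\<close> of the other nodes.
\<close>

definition gain :: "(nat \<Rightarrow> nat) \<Rightarrow> nat \<Rightarrow> nat \<Rightarrow> nat set \<Rightarrow> nat option \<Rightarrow> real" where
  "gain X i y e x = of_bool (x = Some (homogeneity (X(i := 1 - y)) e)) - of_bool (x = Some (homogeneity (X(i := y)) e))"

abbreviation gain_mgf ::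
  "real \<Rightarrow> real \<Rightarrow> (nat \<Rightarrow> nat) \<Rightarrow> real \<Rightarrow> (nat \<Rightarrow> nat) \<Rightarrow> nat \<Rightarrow> nat \<Rightarrow> nat set \<Rightarrow> real" where
  "gain_mgf \<theta> a Y r X i y e \<equiv>
     measure_pmf.expectation (measurement_pmf \<theta> a Y e) (\<lambda>x. exp (ln r * gain X i y e x))"

text \<open>
  A tie makes the algorithm change the label of \<open>i\<close>, which may be wrong; hence the sum is only
  bounded below by \<open>0\<close>.
\<close>

lemma refine_failure_gain:
  assumes E: "finite E" and X: "X i \<in> {0, 1}" and y: "y \<in> {0, 1}" and fail: "refine E W X i \<noteq> y"
  shows "0 \<le> (\<Sum>e\<in>E. gain X i y e (W e))"
proof -
  have "disagreements E W (X(i := 1 - y)) \<le> disagreements E W (X(i := y))"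
  proof (cases "X i = y")
    case True
    then have "X(i := y) = X" "X(i := 1 - y) = flip i X" using y by (auto simp: flip_def)
    then show ?thesis using fail True by (auto simp: refine_def split: if_splits)
  next
    case False
    then have "X(i := 1 - y) = X" "X(i := y) = flip i X" using X y by (auto simp: flip_def)
    then show ?thesis using fail False X y by (auto simp: refine_def split: if_splits)
  qed
  then have "real (disagreements E W (X(i := 1 - y))) \<le> real (disagreements E W (X(i := y)))" by simp
  then show ?thesis unfolding disagreements_eq[OF E] gain_def by (simp add: sum_subtractf)
qed

lemma homogeneity_01: "homogeneity V e = 0 \<or> homogeneity V e = 1"
  by (simp add: homogeneity_def)

text \<open>
  If all other nodes of \<open>e\<close> have the same label, exactly one of the two labels of \<open>i\<close> makes \<open>e\<close>
  homogeneous.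
\<close>

lemma homogeneity_flip:
  assumes "k \<in> e" "k \<noteq> i" "i \<in> e" "X k \<in> {0, 1}" "y \<in> {0, 1}" and const: "X constant_on (e - {i})"
  shows "homogeneity (X(i := 1 - y)) e = 1 - homogeneity (X(i := y)) e"
proof -
  have *: "(X(i := z)) constant_on e \<longleftrightarrow> z = X k" for z
  proof
    assume "(X(i := z)) constant_on e"
    then obtain c where c: "\<And>x. x \<in> e \<Longrightarrow> (X(i := z)) x = c" by (auto simp: constant_on_def)
    show "z = X k" using c[OF assms(1)] c[OF assms(3)] assms(2) by simp
  next
    assume "z = X k"
    obtain c where c: "\<And>x. x \<in> e - {i} \<Longrightarrow> X x = c" using const by (auto simp: constant_on_def)
    have "(X(i := z)) x = c" if "x \<in> e" for x
      using c[of x] c[of k] that assms \<open>z = X k\<close> by (cases "x = i") auto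
    then show "(X(i := z)) constant_on e" by (auto simp: constant_on_def)
  qed
  show ?thesis using assms(4,5) by (auto simp: homogeneity_def *)
qed

text \<open>
  The three kinds of edges through a node \<open>i\<close>. If the other nodes do not all have equal labels, the
  label of \<open>i\<close> has no influence. If they do, and rightly so, the tilt \<open>ln r\<close> gives the two
  values \<open>\<plusminus>1\<close> of the gain equal weight \<open>sqrt (\<theta> * (1 - \<theta>))\<close>, which is the minimum of the moment
  generating function. Otherwise there is only a crude bound.
\<close>

lemma exp_gain_expectation:
  fixes Y X :: "nat \<Rightarrow> nat" and \<theta> a r :: real
  assumes \<theta>: "0 < \<theta>" "\<theta> < 1 / 2" and a: "0 \<le> a" "a \<le> 1" and r: "r = sqrt ((1 - \<theta>) / \<theta>)"
  shows "homogeneity (X(i := 1 - y)) e = homogeneity (X(i := y)) e \<Longrightarrow>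
      gain_mgf \<theta> a Y r X i y e = 1"
    and "homogeneity (X(i := y)) e = homogeneity Y e \<Longrightarrow> homogeneity (X(i := 1 - y)) e = 1 - homogeneity Y e \<Longrightarrow>
      gain_mgf \<theta> a Y r X i y e =
        1 - a * (sqrt (1 - \<theta>) - sqrt \<theta>)\<^sup>2"
    and "gain_mgf \<theta> a Y r X i y e \<le> 1 + a * r"
proof -
  have \<theta>': "0 \<le> \<theta>" "\<theta> \<le> 1" using \<theta> by auto
  note ex = expectation_measurement[OF \<theta>' a]
  have r1: "1 < r" using \<theta> by (simp add: r)
  have h: "homogeneity Y e \<noteq> 1 - homogeneity Y e" using homogeneity_01[of Y e] by auto
  show "gain_mgf \<theta> a Y r X i y e = 1"
    if "homogeneity (X(i := 1 - y)) e = homogeneity (X(i := y)) e"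
    using that by (simp add: gain_def)
  show "gain_mgf \<theta> a Y r X i y e =
        1 - a * (sqrt (1 - \<theta>) - sqrt \<theta>)\<^sup>2"
    if "homogeneity (X(i := y)) e = homogeneity Y e" "homogeneity (X(i := 1 - y)) e = 1 - homogeneity Y e"
  proof -
    have balance: "(1 - \<theta>) * inverse r = sqrt \<theta> * sqrt (1 - \<theta>)" "\<theta> * r = sqrt \<theta> * sqrt (1 - \<theta>)"
    proof -
      have cancel: "x * x * (z / x) = z * x" if "x \<noteq> 0" for x z :: real using that by simp
      have s: "sqrt \<theta> * sqrt \<theta> = \<theta>" "sqrt (1 - \<theta>) * sqrt (1 - \<theta>) = 1 - \<theta>" "sqrt \<theta> \<noteq> 0" "sqrt (1 - \<theta>) \<noteq> 0"
        using \<theta> by auto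
      have r': "r = sqrt (1 - \<theta>) / sqrt \<theta>" by (simp add: r real_sqrt_divide)
      have "(1 - \<theta>) * inverse r = (sqrt (1 - \<theta>) * sqrt (1 - \<theta>)) * (sqrt \<theta> / sqrt (1 - \<theta>))"
        unfolding s(2) r' by (simp add: inverse_eq_divide)
      also have "\<dots> = sqrt \<theta> * sqrt (1 - \<theta>)" by (rule cancel[OF s(4)])
      finally show "(1 - \<theta>) * inverse r = sqrt \<theta> * sqrt (1 - \<theta>)" .
      have "\<theta> * r = (sqrt \<theta> * sqrt \<theta>) * (sqrt (1 - \<theta>) / sqrt \<theta>)" unfolding s(1) r' ..
      also have "\<dots> = sqrt (1 - \<theta>) * sqrt \<theta>" by (rule cancel[OF s(3)])
      finally show "\<theta> * r = sqrt \<theta> * sqrt (1 - \<theta>)" by simp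
    qed
    have "gain_mgf \<theta> a Y r X i y e =
        (1 - a) + a * ((1 - \<theta>) * inverse r + \<theta> * r)"
      using r1 h unfolding ex gain_def that by (simp add: exp_minus)
    also have "\<dots> = 1 - a * (1 - 2 * (sqrt \<theta> * sqrt (1 - \<theta>)))"
      unfolding balance by (simp add: algebra_simps)
    also have "1 - 2 * (sqrt \<theta> * sqrt (1 - \<theta>)) = (sqrt (1 - \<theta>) - sqrt \<theta>)\<^sup>2"
      using \<theta> by (simp add: power2_diff)
    finally show ?thesis .
  qed
  show "gain_mgf \<theta> a Y r X i y e \<le> 1 + a * r"
  proof -
    have le: "exp (ln r * gain X i y e x) \<le> r" for x
    proof -
      have "ln r * gain X i y e x \<le> ln r * 1" using r1 by (intro mult_left_mono) (auto simp: gain_def)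
      then have "exp (ln r * gain X i y e x) \<le> exp (ln r)" by simp
      then show ?thesis using r1 by simp
    qed
    have "gain_mgf \<theta> a Y r X i y e \<le>
        (1 - a) * 1 + a * ((1 - \<theta>) * r + \<theta> * r)"
    proof -
      have none: "exp (ln r * gain X i y e None) \<le> 1" by (simp add: gain_def)
      show ?thesis unfolding ex using \<theta> a by (intro add_mono mult_left_mono none le) auto
    qed
    also have "\<dots> = 1 - a + a * r" by (simp add: algebra_simps)
    finally show ?thesis using a by simp
  qed
qed

text \<open>
  The edges in \<open>C\<close> speak for the right label. Those in \<open>R\<close> contain a wrongly labelled node other
  than \<open>i\<close> and may mislead. The labels \<open>X\<close> are fixed here.
\<close>

lemma refine_failure_prob:
  fixes X Y :: "nat \<Rightarrow> nat" and \<theta> a :: real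
  assumes E: "E \<subseteq> edges n d" and d: "2 \<le> d" and i: "i < n"
    and X: "\<And>k. k < n \<Longrightarrow> X k \<in> {0, 1}" and Y: "\<And>k. k < n \<Longrightarrow> Y k \<in> {0, 1}"
    and \<theta>: "0 < \<theta>" "\<theta> < 1 / 2" and a: "0 \<le> a" "a \<le> 1"
  defines "Bad \<equiv> {k\<in>{..<n}. X k \<noteq> Y k}"
  defines "C \<equiv> {e\<in>E. i \<in> e \<and> Y constant_on (e - {i}) \<and> e \<inter> Bad \<subseteq> {i}}"
  defines "R \<equiv> {e\<in>edges n d. i \<in> e \<and> \<not> e \<inter> Bad \<subseteq> {i}}"
  shows "measure_pmf.prob (Pi_pmf E None (measurement_pmf \<theta> a Y)) {W. refine E W X i \<noteq> Y i}
    \<le> exp (a * sqrt ((1 - \<theta>) / \<theta>) * real (card R) - a * (sqrt (1 - \<theta>) - sqrt \<theta>)\<^sup>2 * real (card C))"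
proof -
  define r where "r = sqrt ((1 - \<theta>) / \<theta>)"
  define q where "q = (sqrt (1 - \<theta>) - sqrt \<theta>)\<^sup>2"
  have finE: "finite E" using E finite_subset by blast
  have fin_supp: "finite (set_pmf (measurement_pmf \<theta> a Y e))" for e
    by (rule finite_subset[OF set_pmf_measurement]) (use \<theta> a in auto)
  have "{W. refine E W X i \<noteq> Y i} \<subseteq> {W. 0 \<le> (\<Sum>e\<in>E. ln r * gain X i (Y i) e (W e))}"
  proof clarify
    fix W assume "refine E W X i \<noteq> Y i"
    then have "0 \<le> (\<Sum>e\<in>E. gain X i (Y i) e (W e))"
      by (rule refine_failure_gain[where X = X and i = i and y = "Y i", OF finE X[OF i] Y[OF i]])
    moreover have "0 \<le> ln r" using \<theta> by (simp add: r_def)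
    ultimately show "0 \<le> (\<Sum>e\<in>E. ln r * gain X i (Y i) e (W e))"
      by (simp add: sum_distrib_left[symmetric])
  qed
  then have "measure_pmf.prob (Pi_pmf E None (measurement_pmf \<theta> a Y)) {W. refine E W X i \<noteq> Y i} \<le>
      measure_pmf.prob (Pi_pmf E None (measurement_pmf \<theta> a Y)) {W. 0 \<le> (\<Sum>e\<in>E. ln r * gain X i (Y i) e (W e))}"
    by (intro measure_pmf.finite_measure_mono) auto
  also have "\<dots> \<le> exp (- 0) * (\<Prod>e\<in>E. gain_mgf \<theta> a Y r X i (Y i) e)"
    by (rule prob_sum_ge_le_exp[OF finE fin_supp])
  also have "\<dots> = (\<Prod>e\<in>E. gain_mgf \<theta> a Y r X i (Y i) e)"
    by simp
  also have "\<dots> \<le> (\<Prod>e\<in>E. exp (a * r * of_bool (e \<in> R) - a * q * of_bool (e \<in> C)))"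
  proof (rule prod_mono)
    fix e assume e: "e \<in> E"
    then have eE: "e \<in> edges n d" using E by blast
    have en: "k < n" if "k \<in> e" for k using edgesD(3)[OF eE that] .
    let ?m = "gain_mgf \<theta> a Y r X i (Y i) e"
    have "?m \<le> exp (a * r * of_bool (e \<in> R) - a * q * of_bool (e \<in> C))"
    proof (cases "e \<in> C")
      case True
      then have ie: "i \<in> e" and const: "Y constant_on (e - {i})" and good: "e \<inter> Bad \<subseteq> {i}" by (auto simp: C_def)
      have XY: "X k = Y k" if "k \<in> e" "k \<noteq> i" for k using good that en by (auto simp: Bad_def)
      have "e \<noteq> {i}" using edgesD(2)[OF eE] d by auto
      then obtain k where k: "k \<in> e" "k \<noteq> i" using ie by blast
      have constX: "X constant_on (e - {i})" using const constant_on_cong[of "e - {i}" X Y] XY by blast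
      have "(X(i := Y i)) constant_on e \<longleftrightarrow> Y constant_on e" using XY by (intro constant_on_cong) auto
      then have h1: "homogeneity (X(i := Y i)) e = homogeneity Y e" by (simp add: homogeneity_def)
      have h2: "homogeneity (X(i := 1 - Y i)) e = 1 - homogeneity Y e"
        using homogeneity_flip[OF k ie X[OF en[OF k(1)]] Y[OF i] constX] h1 by simp
      have "?m = 1 - a * q" unfolding q_def by (rule exp_gain_expectation(2)[OF \<theta> a r_def h1 h2])
      also have "\<dots> \<le> exp (- (a * q))" using exp_ge_add_one_self[of "- (a * q)"] by simp
      also have "\<dots> = exp (a * r * of_bool (e \<in> R) - a * q * of_bool (e \<in> C))"
        using True good by (simp add: R_def)
      finally show ?thesis .
    next
      case False
      show ?thesis
      proof (cases "e \<in> R")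
        case True
        have "?m \<le> 1 + a * r" by (rule exp_gain_expectation(3)[OF \<theta> a r_def])
        also have "\<dots> \<le> exp (a * r)" by (rule exp_ge_add_one_self)
        finally show ?thesis using True False by simp
      next
        case notR: False
        have "homogeneity (X(i := 1 - Y i)) e = homogeneity (X(i := Y i)) e"
        proof (cases "i \<in> e")
          case False
          then have "(X(i := z)) constant_on e \<longleftrightarrow> X constant_on e" for z by (intro constant_on_cong) auto
          then show ?thesis by (simp add: homogeneity_def)
        next
          case True
          then have good: "e \<inter> Bad \<subseteq> {i}" using notR eE by (auto simp: R_def)
          have "\<not> Y constant_on (e - {i})" using False True good e by (auto simp: C_def)
          moreover have "X k = Y k" if "k \<in> e" "k \<noteq> i" for k using good that en by (auto simp: Bad_def)
          ultimately have nX: "\<not> X constant_on (e - {i})" using constant_on_cong[of "e - {i}" X Y] by blast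
          have "\<not> (X(i := z)) constant_on e" for z
          proof
            assume "(X(i := z)) constant_on e"
            then have "(X(i := z)) constant_on (e - {i})" by (rule constant_on_subset) blast
            then show False using nX constant_on_cong[of "e - {i}" "X(i := z)" X] by simp
          qed
          then show ?thesis by (simp add: homogeneity_def)
        qed
        then have "?m = 1" by (rule exp_gain_expectation(1)[OF \<theta> a r_def])
        then show ?thesis using notR False by simp
      qed
    qed
    moreover have "0 \<le> ?m" by (intro Bochner_Integration.integral_nonneg) auto
    ultimately show "0 \<le> ?m \<and> ?m \<le> exp (a * r * of_bool (e \<in> R) - a * q * of_bool (e \<in> C))" by simp
  qed
  also have "\<dots> = exp (\<Sum>e\<in>E. a * r * of_bool (e \<in> R) - a * q * of_bool (e \<in> C))"
    using finE by (simp add: exp_sum)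
  also have "\<dots> \<le> exp (a * r * real (card R) - a * q * real (card C))"
  proof -
    have sum_bool: "(\<Sum>e\<in>E. c * of_bool (e \<in> S)) = c * real (card (E \<inter> S))" for c :: real and S
      using finE by (simp add: sum_distrib_left[symmetric] Int_def)
    have "real (card (E \<inter> R)) \<le> real (card R)"
      unfolding of_nat_le_iff by (rule card_mono) (auto simp: R_def)
    then have "a * r * real (card (E \<inter> R)) \<le> a * r * real (card R)"
      using a \<theta> by (intro mult_left_mono) (auto simp: r_def)
    moreover have "E \<inter> C = C" by (auto simp: C_def)
    ultimately show ?thesis by (simp add: sum_subtractf sum_bool)
  qed
  finally show ?thesis by (simp add: r_def q_def)
qed

lemma card_agreeing_edges_ge:
  assumes i: "i < n" and d: "2 \<le> d" and Y: "\<And>k. k < n \<Longrightarrow> Y k \<in> {0, 1::nat}"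
    and "0 < \<delta>" and m: "2 * real (d - 1) \<le> real (n - 1)" "2 * (real (d - 1))\<^sup>2 \<le> \<delta> * real (n - 1)"
  shows "(1 - \<delta>) * (2 * (1 / 2) ^ (d - 1)) * real ((n - 1) choose (d - 1)) \<le>
    real (card {e\<in>edges n d. i \<in> e \<and> Y constant_on (e - {i})})"
proof -
  define G where "G b = {k\<in>{..<n} - {i}. Y k = b}" for b
  have finG: "finite (G b)" for b by (simp add: G_def)
  define F where "F b = {f. f \<subseteq> G b \<and> card f = d - 1}" for b
  have finF: "finite (F b)" for b using finG by (auto simp: F_def intro: finite_subset[of _ "Pow (G b)"])
  have cardF: "card (F b) = card (G b) choose (d - 1)" for b
    unfolding F_def by (rule n_subsets[OF finG])
  have sumG: "card (G 0) + card (G 1) = n - 1"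
  proof -
    have "card (G 0) + card (G 1) = card (G 0 \<union> G 1)"
      by (rule card_Un_disjoint[symmetric]) (auto simp: G_def)
    also have "G 0 \<union> G 1 = {..<n} - {i}" using Y by (auto simp: G_def)
    finally show ?thesis using i by simp
  qed
  have disj: "F 0 \<inter> F 1 = {}"
  proof -
    have False if f: "f \<in> F 0" "f \<in> F 1" for f
    proof -
      have "card f = d - 1" using f by (simp add: F_def)
      then have "f \<noteq> {}" using d by auto
      then obtain k where "k \<in> f" by blast
      then have "Y k = 0" "Y k = 1" using f by (auto simp: F_def G_def)
      then show False by simp
    qed
    then show ?thesis by blast
  qed
  have "real (card (F 0 \<union> F 1)) = real (card (G 0) choose (d - 1)) + real (card (G 1) choose (d - 1))"
    using card_Un_disjoint[OF finF finF disj] by (simp add: cardF)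
  then have "(1 - \<delta>) * (2 * (1 / 2) ^ (d - 1)) * real ((n - 1) choose (d - 1)) \<le> real (card (F 0 \<union> F 1))"
    using binomial_sum_ge[OF \<open>0 < \<delta>\<close>, of "d - 1" "card (G 0)" "card (G 1)"] m by (simp only: sumG)
  also have "card (F 0 \<union> F 1) = card (insert i ` (F 0 \<union> F 1))"
  proof (rule card_image[symmetric], rule inj_onI)
    fix f f' assume "f \<in> F 0 \<union> F 1" "f' \<in> F 0 \<union> F 1" "insert i f = insert i f'"
    then show "f = f'" by (auto simp: F_def G_def)
  qed
  also have "real (card (insert i ` (F 0 \<union> F 1))) \<le> real (card {e\<in>edges n d. i \<in> e \<and> Y constant_on (e - {i})})"
    unfolding of_nat_le_iff
  proof (rule card_mono)
    show "insert i ` (F 0 \<union> F 1) \<subseteq> {e\<in>edges n d. i \<in> e \<and> Y constant_on (e - {i})}"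
    proof clarify
      fix f assume "f \<in> F 0 \<union> F 1"
      then obtain b where f: "f \<subseteq> G b" "card f = d - 1" by (auto simp: F_def)
      have "finite f" by (rule finite_subset[OF f(1) finG])
      moreover have "i \<notin> f" using f by (auto simp: G_def)
      ultimately have "card (insert i f) = d" using f d by simp
      moreover have "insert i f \<subseteq> {..<n}" using f i by (auto simp: G_def)
      moreover have "Y constant_on (insert i f - {i})"
      proof -
        have "\<forall>k\<in>insert i f - {i}. Y k = b" using f by (auto simp: G_def)
        then show ?thesis unfolding constant_on_def by blast
      qed
      ultimately show "insert i f \<in> edges n d \<and> i \<in> insert i f \<and> Y constant_on (insert i f - {i})"
        by (simp add: edges_def)
    qed
  qed simp
  finally show ?thesis .
qed

lemma card_edges_meeting_bad:
  assumes i: "i < n" and d: "2 \<le> d" and Bad: "Bad \<subseteq> {..<n}"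
  shows "card {e\<in>edges n d. i \<in> e \<and> \<not> e \<inter> Bad \<subseteq> {i}} \<le> card Bad * ((n - 2) choose (d - 2))"
proof -
  have finB: "finite Bad" using Bad finite_subset by blast
  have "card {e\<in>edges n d. i \<in> e \<and> \<not> e \<inter> Bad \<subseteq> {i}} \<le> card (\<Union>j\<in>Bad - {i}. {e\<in>edges n d. {i, j} \<subseteq> e})"
    using finB by (intro card_mono finite_UN_I) auto
  also have "\<dots> \<le> (\<Sum>j\<in>Bad - {i}. card {e\<in>edges n d. {i, j} \<subseteq> e})"
    using finB by (intro card_UN_le) auto
  also have "\<dots> = (\<Sum>j\<in>Bad - {i}. (n - 2) choose (d - 2))"
    using Bad i d by (intro sum.cong refl card_edges_through_pair) auto
  also have "\<dots> = card (Bad - {i}) * ((n - 2) choose (d - 2))" by simp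
  also have "\<dots> \<le> card Bad * ((n - 2) choose (d - 2))"
    using finB by (intro mult_right_mono card_mono) auto
  finally show ?thesis .
qed

section \<open>The two stages together\<close>

lemma prob_bind_le:
  assumes "\<And>x. x \<in> set_pmf p \<Longrightarrow> measure_pmf.prob (f x) S \<le> b" and b: "0 \<le> b"
  shows "measure_pmf.prob (bind_pmf p f) S \<le> b"
proof -
  have "emeasure (bind_pmf p f) S = (\<integral>\<^sup>+x. emeasure (f x) S \<partial>p)" by simp
  also have "\<dots> \<le> (\<integral>\<^sup>+x. ennreal b \<partial>p)"
    using assms by (intro nn_integral_mono_AE) (auto simp: AE_measure_pmf_iff measure_pmf.emeasure_eq_measure intro!: ennreal_leI)
  also have "\<dots> = ennreal b" by simp
  finally show ?thesis using b by (simp add: measure_pmf.emeasure_eq_measure)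
qed

text \<open>
  Conditioning on the first component.
\<close>

lemma prob_pair_le:
  assumes "\<And>x. x \<in> set_pmf p \<Longrightarrow> measure_pmf.prob q {y. (x, y) \<in> S} \<le> b" and b: "0 \<le> b"
  shows "measure_pmf.prob (pair_pmf p q) S \<le> b"
proof -
  have "pair_pmf p q = bind_pmf p (\<lambda>x. map_pmf (Pair x) q)"
    by (simp add: pair_pmf_def map_pmf_def)
  moreover have "measure_pmf.prob (map_pmf (Pair x) q) S \<le> b" if "x \<in> set_pmf p" for x
    using assms(1)[OF that] by (simp add: vimage_def)
  ultimately show ?thesis using prob_bind_le[OF _ b] by metis
qed

lemma prob_le_on_support:
  assumes "\<And>x. x \<in> set_pmf p \<Longrightarrow> x \<in> S \<Longrightarrow> x \<in> T"
  shows "measure_pmf.prob p S \<le> measure_pmf.prob p T"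
proof -
  have "measure_pmf.prob p (S \<inter> set_pmf p) \<le> measure_pmf.prob p T"
    using assms by (intro measure_pmf.finite_measure_mono) auto
  then show ?thesis by (simp add: measure_Int_set_pmf)
qed

lemma set_random_subset: "finite S \<Longrightarrow> E \<in> set_pmf (random_subset_pmf S \<beta>) \<Longrightarrow> E \<subseteq> S"
  by (auto simp: random_subset_pmf_def)

lemma set_gcbm:
  assumes "0 \<le> \<theta>" "\<theta> \<le> 1" "0 \<le> a" "a \<le> 1" and "W \<in> set_pmf (gcbm n d \<theta> a g)" "e \<in> edges n d"
  shows "W e \<in> {None, Some 0, Some 1}"
  using assms(5,6) set_pmf_measurement[OF assms(1-4), of g e]
  by (auto simp: gcbm_def set_Pi_pmf PiE_dflt_def)

definition positives :: "nat set set \<Rightarrow> (nat set \<Rightarrow> nat option) \<Rightarrow> nat set \<Rightarrow> bool" where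
  "positives E W e \<longleftrightarrow> e \<in> E \<and> W e = Some 1"

text \<open>
  The weights of the clustering step depend on the split and the observations only through
  these edges, which are independent.
\<close>

lemma positives_distribution:
  assumes \<theta>: "0 \<le> \<theta>" "\<theta> \<le> 1" and a: "0 \<le> a" "a \<le> 1" and \<beta>: "0 \<le> \<beta>" "\<beta> \<le> 1"
  shows "map_pmf (\<lambda>(E, W). positives E W) (pair_pmf (random_subset_pmf (edges n d) \<beta>) (gcbm n d \<theta> a g)) =
    Pi_pmf (edges n d) False (\<lambda>e. bernoulli_pmf (edge_mean (\<beta> * a) \<theta> g e))"
proof -
  let ?A = "edges n d"
  let ?m = "measurement_pmf \<theta> a g"
  let ?q = "\<lambda>e. if g constant_on e then 1 - \<theta> else \<theta>"
  have pe: "0 \<le> \<beta> * a * ?q e" "\<beta> * a * ?q e \<le> 1" for e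
  proof -
    show "0 \<le> \<beta> * a * ?q e" using assms by auto
    have "\<beta> * a * ?q e \<le> 1 * 1 * 1" using assms by (intro mult_mono) auto
    then show "\<beta> * a * ?q e \<le> 1" by simp
  qed
  have single: "bind_pmf (bernoulli_pmf \<beta>) (\<lambda>s. bind_pmf (?m e) (\<lambda>x. return_pmf (s \<and> x = Some 1))) =
      bernoulli_pmf (\<beta> * a * ?q e)" for e
  proof (rule pmf_eqI)
    fix b
    have ex: "measure_pmf.expectation (?m e) (\<lambda>x. pmf (return_pmf (x = Some 1)) b) =
        (if b then a * ?q e else 1 - a * ?q e)"
      unfolding expectation_measurement[OF \<theta> a]
      by (cases b; cases "g constant_on e") (auto simp: homogeneity_def algebra_simps)
    have "pmf (bind_pmf (bernoulli_pmf \<beta>) (\<lambda>s. bind_pmf (?m e) (\<lambda>x. return_pmf (s \<and> x = Some 1)))) b =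
        measure_pmf.expectation (?m e) (\<lambda>x. pmf (return_pmf (x = Some 1)) b) * \<beta> + pmf (return_pmf False) b * (1 - \<beta>)"
      using \<beta> by (simp add: pmf_bind)
    also have "\<dots> = pmf (bernoulli_pmf (\<beta> * a * ?q e)) b"
      unfolding ex using pe[of e] by (cases b) (auto simp: algebra_simps)
    finally show "pmf (bind_pmf (bernoulli_pmf \<beta>) (\<lambda>s. bind_pmf (?m e) (\<lambda>x. return_pmf (s \<and> x = Some 1)))) b =
        pmf (bernoulli_pmf (\<beta> * a * ?q e)) b" .
  qed
  have "Pi_pmf ?A False (\<lambda>e. bernoulli_pmf (\<beta> * a * ?q e)) =
      Pi_pmf ?A False (\<lambda>e. bind_pmf (bernoulli_pmf \<beta>) (\<lambda>s. bind_pmf (?m e) (\<lambda>x. return_pmf (s \<and> x = Some 1))))"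
    by (simp only: single)
  also have "\<dots> = bind_pmf (Pi_pmf ?A False (\<lambda>_. bernoulli_pmf \<beta>)) (\<lambda>s. Pi_pmf ?A False
      (\<lambda>e. bind_pmf (?m e) (\<lambda>x. return_pmf (s e \<and> x = Some 1))))"
    by (rule Pi_pmf_bind) simp
  also have "\<dots> = bind_pmf (Pi_pmf ?A False (\<lambda>_. bernoulli_pmf \<beta>)) (\<lambda>s. bind_pmf (Pi_pmf ?A None ?m) (\<lambda>W.
      return_pmf (\<lambda>e. if e \<in> ?A then s e \<and> W e = Some 1 else False)))"
    by (subst Pi_pmf_bind[where d' = None]) simp_all
  also have "\<dots> = map_pmf (\<lambda>(E, W). positives E W) (pair_pmf (random_subset_pmf ?A \<beta>) (gcbm n d \<theta> a g))"
    by (simp add: random_subset_pmf_def gcbm_def pair_pmf_def map_pmf_def bind_assoc_pmf bind_return_pmf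
        positives_def[abs_def] if_distrib cong: if_cong)
      (intro bind_pmf_cong refl arg_cong[of _ _ return_pmf] ext, auto)
  finally show ?thesis by simp
qed

text \<open>
  For a fixed split, the observations in the two parts are independent.
\<close>

lemma gcbm_split:
  assumes "E \<subseteq> edges n d"
  shows "gcbm n d \<theta> a g = map_pmf (\<lambda>(W1, W2) e. if e \<in> E then W1 e else W2 e)
    (pair_pmf (Pi_pmf E None (measurement_pmf \<theta> a g)) (Pi_pmf (edges n d - E) None (measurement_pmf \<theta> a g)))"
proof -
  have "edges n d = E \<union> (edges n d - E)" using assms by blast
  then show ?thesis
    unfolding gcbm_def using assms finite_subset[OF assms]
    by (subst \<open>edges n d = E \<union> (edges n d - E)\<close>, subst Pi_pmf_union) auto
qed

text \<open>
  The first part takes only a fraction \<open>\<beta> \<longlonglongrightarrow> 0\<close> of the edges through each node.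
\<close>

lemma split_degree_tail:
  assumes i: "i < n" and d: "2 \<le> d" and \<beta>: "0 \<le> \<beta>" "\<beta> \<le> 1" "4 * \<beta> \<le> \<delta>"
  shows "measure_pmf.prob (random_subset_pmf (edges n d) \<beta>)
      {E. \<delta> * real ((n - 1) choose (d - 1)) \<le> real (card {e\<in>E. i \<in> e})}
    \<le> exp (- (\<delta> / 2 * real ((n - 1) choose (d - 1))))"
proof -
  let ?M = "real ((n - 1) choose (d - 1))"
  have "measure_pmf.prob (random_subset_pmf (edges n d) \<beta>) {E. \<delta> * ?M \<le> real (card {e\<in>E. i \<in> e})} =
      measure_pmf.prob (Pi_pmf (edges n d) False (\<lambda>_. bernoulli_pmf \<beta>))
        {f. \<delta> * ?M \<le> (\<Sum>e\<in>edges n d. of_bool (i \<in> e) * of_bool (f e))}"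
  proof -
    have "(\<Sum>e\<in>edges n d. of_bool (i \<in> e) * of_bool (f e)) = real (card {e \<in> {e\<in>edges n d. f e}. i \<in> e})" for f
    proof -
      have "(\<Sum>e\<in>edges n d. of_bool (i \<in> e) * of_bool (f e) :: real) = (\<Sum>e\<in>{e \<in> {e\<in>edges n d. f e}. i \<in> e}. 1)"
        by (rule sum.mono_neutral_cong_right) auto
      then show ?thesis by (simp only: sum_constant mult_1_right)
    qed
    then show ?thesis by (simp only: random_subset_pmf_def measure_map_pmf vimage_def mem_Collect_eq)
  qed
  also have "\<dots> \<le> exp (- (\<delta> * ?M) + (\<Sum>e\<in>edges n d. \<beta> * (exp (of_bool (i \<in> e)) - 1)))"
    using \<beta> by (intro bernoulli_family_tail) auto
  also have "(\<Sum>e\<in>edges n d. \<beta> * (exp (of_bool (i \<in> e)) - 1)) = (\<Sum>e\<in>{e\<in>edges n d. i \<in> e}. \<beta> * (exp 1 - 1))"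
    by (rule sum.mono_neutral_cong_right) auto
  also have "\<dots> = ?M * (\<beta> * (exp 1 - 1))"
    using card_edges_through[OF i, of d] d by simp
  also have "exp (- (\<delta> * ?M) + ?M * (\<beta> * (exp 1 - 1))) \<le> exp (- (\<delta> / 2 * ?M))"
  proof -
    have "exp 1 \<le> (3::real)" by (rule exp_le)
    then have "\<beta> * (exp 1 - 1) \<le> \<beta> * 2" using \<beta> by (intro mult_left_mono) auto
    also have "\<dots> \<le> \<delta> / 2" using \<beta> by simp
    finally have "?M * (\<beta> * (exp 1 - 1)) \<le> ?M * (\<delta> / 2)" by (intro mult_left_mono) auto
    then show ?thesis by (simp add: algebra_simps)
  qed
  finally show ?thesis .
qed

text \<open>
  At least about \<open>L * M\<close> edges through \<open>i\<close> are informative. At most \<open>\<delta> * M\<close> of them are lost to the first part,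
  and at most \<open>2 * d * \<delta> * M\<close> contain a wrongly labelled node besides \<open>i\<close>. The condition on \<open>\<delta>\<close> makes
  these losses cost at most half of the slack \<open>\<epsilon>\<close> in the threshold.
\<close>

lemma refine_failure_small:
  fixes X Y :: "nat \<Rightarrow> nat" and \<theta> a \<epsilon> :: real
  assumes E1: "E1 \<subseteq> edges n d" and d: "2 \<le> d" and i: "i < n"
    and X: "\<And>k. k < n \<Longrightarrow> X k \<in> {0, 1}" and Y: "\<And>k. k < n \<Longrightarrow> Y k \<in> {0, 1}"
    and \<theta>: "0 < \<theta>" "\<theta> < 1 / 2" and a: "0 \<le> a" "a \<le> 1" and \<epsilon>: "0 < \<epsilon>"
    and q: "q = (sqrt (1 - \<theta>) - sqrt \<theta>)\<^sup>2" and r: "r = sqrt ((1 - \<theta>) / \<theta>)" and L: "L = 2 * (1 / 2 :: real) ^ (d - 1)"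
    and \<delta>: "0 < \<delta>" "\<delta> * (q * (L + 1 + 2 * real d) + 2 * real d * r) \<le> q * L * (\<epsilon> / 2 / (1 + \<epsilon>))"
    and M: "M = real ((n - 1) choose (d - 1))" and aM: "(1 + \<epsilon>) * ln (real n) \<le> L * q * (a * M)"
    and bad: "real (card {k\<in>{..<n}. X k \<noteq> Y k}) \<le> \<delta> * real n"
    and deg: "real (card {e\<in>E1. i \<in> e}) \<le> \<delta> * M"
    and n: "2 * real (d - 1) \<le> real (n - 1)" "2 * (real (d - 1))\<^sup>2 \<le> \<delta> * real (n - 1)"
  shows "measure_pmf.prob (Pi_pmf (edges n d - E1) None (measurement_pmf \<theta> a Y)) {W. refine (edges n d - E1) W X i \<noteq> Y i}
    \<le> exp (- ((1 + \<epsilon> / 2) * ln (real n)))"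
proof -
  define Bad where "Bad = {k\<in>{..<n}. X k \<noteq> Y k}"
  define C where "C = {e\<in>edges n d - E1. i \<in> e \<and> Y constant_on (e - {i}) \<and> e \<inter> Bad \<subseteq> {i}}"
  define R where "R = {e\<in>edges n d. i \<in> e \<and> \<not> e \<inter> Bad \<subseteq> {i}}"
  define N where "N = {e\<in>edges n d. i \<in> e \<and> Y constant_on (e - {i})}"
  have n2: "2 \<le> n" using n(1) d i by (cases n) auto
  have q0: "0 \<le> q" by (simp add: q)
  have r0: "0 \<le> r" using \<theta> by (simp add: r)
  have M0: "0 \<le> M" by (simp add: M)
  have card_R: "real (card R) \<le> 2 * real d * \<delta> * M"
  proof -
    have absorb: "real (n - 1) * real ((n - 2) choose (d - 2)) = real (d - 1) * M"
    proof -
      have "(d - 1) * ((n - 1) choose (d - 1)) = (n - 1) * ((n - 1 - 1) choose (d - 1 - 1))"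
        using d by (intro times_binomial_minus1_eq) auto
      then have "(n - 1) * ((n - 2) choose (d - 2)) = (d - 1) * ((n - 1) choose (d - 1))"
        by (simp add: numeral_2_eq_2)
      then have "real ((n - 1) * ((n - 2) choose (d - 2))) = real ((d - 1) * ((n - 1) choose (d - 1)))" by (rule arg_cong)
      then show ?thesis by (simp add: M)
    qed
    have "card R \<le> card Bad * ((n - 2) choose (d - 2))"
      unfolding R_def by (rule card_edges_meeting_bad[OF i d]) (auto simp: Bad_def)
    then have "real (card R) \<le> real (card Bad * ((n - 2) choose (d - 2)))" by (rule of_nat_mono)
    also have "\<dots> = real (card Bad) * real ((n - 2) choose (d - 2))" by simp
    also have "\<dots> \<le> (\<delta> * real n) * real ((n - 2) choose (d - 2))"
      using bad by (intro mult_right_mono) (auto simp: Bad_def)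
    also have "\<dots> \<le> (\<delta> * (2 * real (n - 1))) * real ((n - 2) choose (d - 2))"
      using n2 \<delta>(1) by (intro mult_right_mono mult_left_mono) auto
    also have "\<dots> = 2 * \<delta> * (real (d - 1) * M)" unfolding absorb[symmetric] by simp
    also have "\<dots> \<le> 2 * \<delta> * (real d * M)" using \<delta>(1) M0 by (intro mult_left_mono mult_right_mono) auto
    finally show ?thesis by (simp add: mult_ac)
  qed
  have card_C: "(1 - \<delta>) * L * M - \<delta> * M - real (card R) \<le> real (card C)"
  proof -
    have ge: "(1 - \<delta>) * L * M \<le> real (card N)"
      unfolding L M N_def by (rule card_agreeing_edges_ge[OF i d Y \<delta>(1) n]) auto
    have "finite {e\<in>E1. i \<in> e}" using finite_subset[OF E1] by simp
    have "N \<subseteq> C \<union> {e\<in>E1. i \<in> e} \<union> R" by (auto simp: N_def C_def R_def)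
    then have "card N \<le> card (C \<union> {e\<in>E1. i \<in> e} \<union> R)"
      using \<open>finite {e\<in>E1. i \<in> e}\<close> by (intro card_mono) (auto simp: C_def R_def)
    also have "\<dots> \<le> card C + card {e\<in>E1. i \<in> e} + card R"
      using card_Un_le[of "C \<union> {e\<in>E1. i \<in> e}" R] card_Un_le[of C "{e\<in>E1. i \<in> e}"] by linarith
    finally have "real (card N) \<le> real (card C + card {e\<in>E1. i \<in> e} + card R)" by (rule of_nat_mono)
    then show ?thesis using ge deg by simp
  qed
  have "measure_pmf.prob (Pi_pmf (edges n d - E1) None (measurement_pmf \<theta> a Y)) {W. refine (edges n d - E1) W X i \<noteq> Y i}
      \<le> exp (a * r * real (card R) - a * q * real (card C))"
    unfolding r q C_def R_def Bad_def
    by (rule refine_failure_prob[where n = n and d = d and X = X and Y = Y and i = i, OF _ d i X Y \<theta> a]) auto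
  also have "\<dots> \<le> exp (- ((1 + \<epsilon> / 2) * ln (real n)))"
  proof -
    have "a * q * ((1 - \<delta>) * L * M - \<delta> * M - real (card R)) \<le> a * q * real (card C)"
      using card_C a q0 by (intro mult_left_mono) auto
    then have "a * r * real (card R) - a * q * real (card C) \<le>
        a * (r + q) * real (card R) - a * q * ((1 - \<delta>) * L * M - \<delta> * M)" by (simp add: algebra_simps)
    also have "\<dots> \<le> a * (r + q) * (2 * real d * \<delta> * M) - a * q * ((1 - \<delta>) * L * M - \<delta> * M)"
      using card_R a q0 r0 by (intro diff_right_mono mult_left_mono) auto
    also have "\<dots> = (a * M) * (\<delta> * (q * (L + 1 + 2 * real d) + 2 * real d * r)) - (a * M) * (q * L)"
      by (simp add: algebra_simps)
    also have "\<dots> \<le> (a * M) * (q * L * (\<epsilon> / 2 / (1 + \<epsilon>))) - (a * M) * (q * L)"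
      using \<delta>(2) a M0 by (intro diff_right_mono mult_left_mono) auto
    also have "\<dots> = - ((L * q * (a * M)) * ((1 + \<epsilon> / 2) / (1 + \<epsilon>)))"
      using \<epsilon> by (simp add: field_simps)
    also have "\<dots> \<le> - (((1 + \<epsilon>) * ln (real n)) * ((1 + \<epsilon> / 2) / (1 + \<epsilon>)))"
      using aM \<epsilon> by (intro le_imp_neg_le mult_right_mono) auto
    also have "\<dots> = - ((1 + \<epsilon> / 2) * ln (real n))"
      using \<epsilon> by (simp add: field_simps)
    finally show ?thesis by simp
  qed
  finally show ?thesis .
qed

lemma refine_cong:
  assumes "\<And>e. e \<in> E \<Longrightarrow> W e = W' e"
  shows "refine E W X i = refine E W' X i"
proof -
  have "{e\<in>E. W e \<noteq> Some (homogeneity V e)} = {e\<in>E. W' e \<noteq> Some (homogeneity V e)}" for V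
    using assms by auto
  then have "disagreements E W V = disagreements E W' V" for V by (simp only: disagreements_def)
  then show ?thesis by (simp add: refine_def)
qed

lemma err_eq_0:
  assumes "\<pi> permutes {0, 1}" "\<And>i. i < n \<Longrightarrow> g i = \<pi> (\<Phi> i)"
  shows "err n g \<Phi> = 0"
proof -
  let ?c = "\<lambda>\<pi>. card (misplaced n g \<pi> \<Phi>)"
  have "misplaced n g \<pi> \<Phi> = {}" using assms(2) by auto
  then have "?c \<pi> = 0" by (simp only: card.empty)
  moreover have "Min (?c ` {\<pi>. \<pi> permutes {0, 1::nat}}) \<le> ?c \<pi>"
    using assms(1) by (intro Min_le finite_imageI finite_permutations imageI) auto
  ultimately have "Min (?c ` {\<pi>. \<pi> permutes {0, 1}}) = 0" by linarith
  then show ?thesis unfolding err_def by (simp only: of_nat_0 mult_zero_right)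
qed

lemma hsc_output_labels:
  assumes "hsc_output c \<epsilon> 2 n E w \<Phi>" "i < n"
  shows "\<Phi> i \<in> {0, 1}"
proof -
  obtain U where U: "top_eigenvectors (trim c (adj_mat n E w)) 2 U" "approx_kmeans \<epsilon> U 2 \<Phi>"
    using assms(1) by (auto simp: hsc_output_def)
  have "dim_row (trim c (adj_mat n E w)) = n" by (simp add: trim_def adj_mat_def Let_def)
  then have "dim_row U = n" using U(1) by (auto simp: top_eigenvectors_def)
  then have "\<Phi> i < 2" using U(2) assms(2) by (auto simp: approx_kmeans_def)
  then show ?thesis by auto
qed

text \<open>
  The predicate \<open>G\<close> stands for typicality of the first part.
  The output is correct unless \<open>G\<close> fails, or a node has too many of its edges in
  the first part, or the refinement fails at a node although the initial labels are accurate. For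
  the last event the first part and its observations are fixed, which determines the initial
  labels and the permutation \<open>\<pi>\<close> that relates them to the groups. Since disagreements only depend on
  which labels are equal, the refinement can be analysed with the relabelled partition \<open>Y\<close>.
\<close>

lemma hsclr_success_prob:
  fixes hsc :: "nat \<Rightarrow> nat set set \<Rightarrow> (nat set \<Rightarrow> real) \<Rightarrow> nat \<Rightarrow> nat" and \<theta> a \<epsilon> :: real
  assumes d: "2 \<le> d" and g: "\<And>k. k < n \<Longrightarrow> g k \<in> {0, 1}"
    and \<theta>: "0 < \<theta>" "\<theta> < 1 / 2" and a: "0 \<le> a" "a \<le> 1" and \<epsilon>: "0 < \<epsilon>"
    and \<beta>: "\<beta> = ln (ln (real n)) / ln (real n)" "0 \<le> \<beta>" "\<beta> \<le> 1" "4 * \<beta> \<le> \<delta>"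
    and q: "q = (sqrt (1 - \<theta>) - sqrt \<theta>)\<^sup>2" and r: "r = sqrt ((1 - \<theta>) / \<theta>)" and L: "L = 2 * (1 / 2 :: real) ^ (d - 1)"
    and \<delta>: "0 < \<delta>" "\<delta> * (q * (L + 1 + 2 * real d) + 2 * real d * r) \<le> q * L * (\<epsilon> / 2 / (1 + \<epsilon>))"
    and M: "M = real ((n - 1) choose (d - 1))" and aM: "(1 + \<epsilon>) * ln (real n) \<le> L * q * (a * M)"
    and n: "2 * real (d - 1) \<le> real (n - 1)" "2 * (real (d - 1))\<^sup>2 \<le> \<delta> * real (n - 1)" "2 \<le> n"
    and impl: "hsc_implementation d c \<epsilon>' 2 hsc"
    and recovers: "\<And>f E w \<Phi>. G f \<Longrightarrow> E \<subseteq> edges n d \<Longrightarrow>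
       (\<And>e. e \<in> edges n d \<Longrightarrow> (if e \<in> E then w e else 0) = of_bool (f e)) \<Longrightarrow> hsc_output c \<epsilon>' 2 n E w \<Phi> \<Longrightarrow>
       \<exists>\<pi>. \<pi> permutes {0, 1::nat} \<and> real (card (misplaced n g \<pi> \<Phi>)) \<le> \<delta> * real n"
  shows "1 - (measure_pmf.prob (Pi_pmf (edges n d) False
        (\<lambda>e. bernoulli_pmf (edge_mean (\<beta> * a) \<theta> g e))) {f. \<not> G f}
      + real n * exp (- (\<delta> / 2 * M)) + real n * exp (- ((1 + \<epsilon> / 2) * ln (real n))))
    \<le> measure_pmf.prob (bind_pmf (gcbm n d \<theta> a g) (hsclr hsc d n)) {\<Phi>. err n g \<Phi> = 0}"
proof -
  define RS where "RS = random_subset_pmf (edges n d) \<beta>"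
  define J where "J = pair_pmf RS (gcbm n d \<theta> a g)"
  define init where "init E W = hsc n E (\<lambda>e\<in>E. weight (W e))" for E and W :: "nat set \<Rightarrow> nat option"
  define out where "out = (\<lambda>(E, W). refine (edges n d - E) W (init E W))"
  have run: "bind_pmf (gcbm n d \<theta> a g) (hsclr hsc d n) = map_pmf out J"
  proof -
    have "bind_pmf (gcbm n d \<theta> a g) (hsclr hsc d n) =
        bind_pmf (gcbm n d \<theta> a g) (\<lambda>W. bind_pmf RS (\<lambda>E. return_pmf (out (E, W))))"
      by (simp add: hsclr_def[abs_def] RS_def out_def init_def \<beta>(1) Let_def)
    also have "\<dots> = bind_pmf RS (\<lambda>E. bind_pmf (gcbm n d \<theta> a g) (\<lambda>W. return_pmf (out (E, W))))"
      by (rule bind_commute_pmf)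
    finally show ?thesis
      by (simp add: J_def pair_pmf_def map_pmf_def bind_assoc_pmf bind_return_pmf)
  qed
  \<comment> \<open>\<open>rel X\<close> is a permutation that makes the labels \<open>X\<close> accurate, if there is one\<close>
  define acc where "acc X \<pi> \<longleftrightarrow> \<pi> permutes {0, 1::nat} \<and> real (card (misplaced n g \<pi> X)) \<le> \<delta> * real n" for X :: "nat \<Rightarrow> nat" and \<pi>
  define rel where "rel X = (SOME \<pi>. acc X \<pi>)" for X
  \<comment> \<open>the three kinds of failure\<close>
  define T0 where "T0 = {(E, W). \<not> G (positives E W)}"
  define T1 where "T1 i = {(E :: nat set set, W :: nat set \<Rightarrow> nat option). \<delta> * M \<le> real (card {e\<in>E. i \<in> e})}" for i :: nat
  define T2 where "T2 i = {(E, W). E \<subseteq> edges n d \<and> acc (init E W) (rel (init E W)) \<and> (\<forall>k<n. init E W k \<in> {0, 1}) \<and>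
     real (card {e\<in>E. i \<in> e}) \<le> \<delta> * M \<and> refine (edges n d - E) W (init E W) i \<noteq> inv_into UNIV (rel (init E W)) (g i)}" for i
  have sub: "measure_pmf.prob J {x. err n g (out x) \<noteq> 0} \<le> measure_pmf.prob J (T0 \<union> ((\<Union>i\<in>{..<n}. T1 i) \<union> (\<Union>i\<in>{..<n}. T2 i)))"
  proof (rule prob_le_on_support, rule ccontr)
    fix x assume x: "x \<in> set_pmf J" "x \<in> {x. err n g (out x) \<noteq> 0}"
      "x \<notin> T0 \<union> ((\<Union>i\<in>{..<n}. T1 i) \<union> (\<Union>i\<in>{..<n}. T2 i))"
    obtain E W where EW: "x = (E, W)" by (cases x)
    have "E \<in> set_pmf (random_subset_pmf (edges n d) \<beta>)" and W: "W \<in> set_pmf (gcbm n d \<theta> a g)"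
      using x(1) by (auto simp: EW J_def RS_def)
    then have E: "E \<subseteq> edges n d" by (intro set_random_subset[OF finite_edges])
    have W01: "W e \<in> {None, Some 0, Some 1}" if "e \<in> edges n d" for e
      using \<theta> a by (intro set_gcbm[OF _ _ _ _ W that]) auto
    have good: "G (positives E W)" using x(3) by (simp add: EW T0_def)
    have hout: "hsc_output c \<epsilon>' 2 n E (\<lambda>e\<in>E. weight (W e)) (init E W)"
      using impl E n(3) by (simp add: hsc_implementation_def init_def)
    have "\<exists>\<pi>. acc (init E W) \<pi>"
      unfolding acc_def
    proof (rule recovers[OF good E _ hout])
      fix e assume "e \<in> edges n d"
      then show "(if e \<in> E then (\<lambda>e\<in>E. weight (W e)) e else 0) = of_bool (positives E W e)"
        using W01[of e] by (auto simp: positives_def weight_def)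
    qed
    then have acc: "acc (init E W) (rel (init E W))" unfolding rel_def by (rule someI_ex)
    have labels: "\<forall>k<n. init E W k \<in> {0, 1}" using hsc_output_labels[OF hout] by blast
    have "refine (edges n d - E) W (init E W) i = inv_into UNIV (rel (init E W)) (g i)" if "i < n" for i
    proof -
      have "(E, W) \<notin> T1 i" "(E, W) \<notin> T2 i" using x(3) that by (auto simp: EW)
      then show ?thesis using acc labels E by (auto simp: T1_def T2_def)
    qed
    moreover have perm: "rel (init E W) permutes {0, 1}" using acc by (simp add: acc_def)
    ultimately have "err n g (out x) = 0"
      by (intro err_eq_0[OF perm]) (simp add: EW out_def permutes_inverses(1)[OF perm])
    then show False using x(2) by simp
  qed
  have p0: "measure_pmf.prob J T0 = measure_pmf.prob (Pi_pmf (edges n d) False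
        (\<lambda>e. bernoulli_pmf (edge_mean (\<beta> * a) \<theta> g e))) {f. \<not> G f}"
  proof -
    have "measure_pmf.prob (map_pmf (\<lambda>(E, W). positives E W) J) {f. \<not> G f} = measure_pmf.prob J T0"
      unfolding measure_map_pmf by (rule arg_cong[of _ _ "measure_pmf.prob J"]) (auto simp: T0_def)
    moreover have "map_pmf (\<lambda>(E, W). positives E W) J =
        Pi_pmf (edges n d) False (\<lambda>e. bernoulli_pmf (edge_mean (\<beta> * a) \<theta> g e))"
      unfolding J_def RS_def using \<theta> by (intro positives_distribution a \<beta>) auto
    ultimately show ?thesis by simp
  qed
  have p1: "measure_pmf.prob J (T1 i) \<le> exp (- (\<delta> / 2 * M))" if "i < n" for i
  proof -
    have "measure_pmf.prob J (T1 i) = measure_pmf.prob (map_pmf fst J) {E. \<delta> * M \<le> real (card {e\<in>E. i \<in> e})}"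
      unfolding measure_map_pmf by (rule arg_cong[of _ _ "measure_pmf.prob J"]) (auto simp: T1_def)
    also have "map_pmf fst J = RS" unfolding J_def by (rule map_fst_pair_pmf)
    also have "measure_pmf.prob RS {E. \<delta> * M \<le> real (card {e\<in>E. i \<in> e})} \<le> exp (- (\<delta> / 2 * M))"
      unfolding RS_def M by (rule split_degree_tail[OF that d \<beta>(2-4)])
    finally show ?thesis .
  qed
  have p2: "measure_pmf.prob J (T2 i) \<le> exp (- ((1 + \<epsilon> / 2) * ln (real n)))" if i: "i < n" for i
    unfolding J_def
  proof (rule prob_pair_le)
    fix E assume "E \<in> set_pmf RS"
    then have E: "E \<subseteq> edges n d" unfolding RS_def by (rule set_random_subset[OF finite_edges])
    let ?m = "measurement_pmf \<theta> a g"
    \<comment> \<open>the initial labels depend on the observations of the first part only, the refinement given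
      these labels only on those of the second part\<close>
    define join where "join = (\<lambda>(W1, W2) e. if e \<in> E then W1 e else (W2 e :: nat option))"
    have init_join: "init E (join (W1, W2)) = init E W1" for W1 W2
      unfolding init_def by (intro arg_cong[of _ _ "hsc n E"]) (auto simp: join_def restrict_def)
    have refine_join: "refine (edges n d - E) (join (W1, W2)) X i = refine (edges n d - E) W2 X i" for W1 W2 X
      by (rule refine_cong) (simp add: join_def)
    have "measure_pmf.prob (gcbm n d \<theta> a g) {W. (E, W) \<in> T2 i} =
        measure_pmf.prob (pair_pmf (Pi_pmf E None ?m) (Pi_pmf (edges n d - E) None ?m)) {x. (E, join x) \<in> T2 i}"
      unfolding gcbm_split[OF E] join_def[symmetric] measure_map_pmf vimage_def by simp
    also have "\<dots> \<le> exp (- ((1 + \<epsilon> / 2) * ln (real n)))"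
    proof (rule prob_pair_le)
      fix W1
      define X where "X = init E W1"
      define \<pi> where "\<pi> = rel X"
      define Y where "Y k = inv_into UNIV \<pi> (g k)" for k
      show "measure_pmf.prob (Pi_pmf (edges n d - E) None ?m) {W2. (W1, W2) \<in> {x. (E, join x) \<in> T2 i}}
          \<le> exp (- ((1 + \<epsilon> / 2) * ln (real n)))"
      proof (cases "acc X \<pi> \<and> (\<forall>k<n. X k \<in> {0, 1}) \<and> real (card {e\<in>E. i \<in> e}) \<le> \<delta> * M")
        case False
        then have "{W2. (W1, W2) \<in> {x. (E, join x) \<in> T2 i}} = {}"
          by (auto simp: T2_def init_join X_def \<pi>_def)
        then have "measure_pmf.prob (Pi_pmf (edges n d - E) None ?m) {W2. (W1, W2) \<in> {x. (E, join x) \<in> T2 i}} = 0"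
          by (simp only: measure_empty)
        then show ?thesis by simp
      next
        case True
        then have perm: "\<pi> permutes {0, 1}" and card: "real (card (misplaced n g \<pi> X)) \<le> \<delta> * real n"
          by (auto simp: acc_def)
        have "{k\<in>{..<n}. X k \<noteq> Y k} = (misplaced n g \<pi> X)"
          unfolding Y_def using permutes_inverses[OF perm] by (metis (no_types, opaque_lifting))
        then have bad: "real (card {k\<in>{..<n}. X k \<noteq> Y k}) \<le> \<delta> * real n" using card by simp
        have Y01: "Y k \<in> {0, 1}" if "k < n" for k
          unfolding Y_def using permutes_in_image[OF permutes_inv[OF perm]] g[OF that] by blast
        have const: "g constant_on e \<longleftrightarrow> Y constant_on e" for e
        proof
          assume "Y constant_on e"
          then obtain y where "\<forall>k\<in>e. Y k = y" by (auto simp: constant_on_def)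
          then have "\<forall>k\<in>e. g k = \<pi> y" unfolding Y_def using permutes_inverses(1)[OF perm] by metis
          then show "g constant_on e" by (auto simp: constant_on_def)
        qed (auto simp: constant_on_def Y_def)
        then have m_eq: "?m = measurement_pmf \<theta> a Y" by (intro ext) (simp add: measurement_pmf_def)
        have "{W2. (W1, W2) \<in> {x. (E, join x) \<in> T2 i}} \<subseteq> {W2. refine (edges n d - E) W2 X i \<noteq> Y i}"
          by (auto simp: T2_def init_join refine_join X_def \<pi>_def Y_def)
        then have "measure_pmf.prob (Pi_pmf (edges n d - E) None ?m) {W2. (W1, W2) \<in> {x. (E, join x) \<in> T2 i}} \<le>
            measure_pmf.prob (Pi_pmf (edges n d - E) None ?m) {W2. refine (edges n d - E) W2 X i \<noteq> Y i}"
          by (intro measure_pmf.finite_measure_mono) auto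
        also have "\<dots> \<le> exp (- ((1 + \<epsilon> / 2) * ln (real n)))"
          unfolding m_eq using True
          by (intro refine_failure_small[OF E d i _ Y01 \<theta> a \<epsilon> q r L \<delta> M aM bad _ n(1,2)]) auto
        finally show ?thesis .
      qed
    qed simp
    finally show "measure_pmf.prob (gcbm n d \<theta> a g) {W. (E, W) \<in> T2 i} \<le> exp (- ((1 + \<epsilon> / 2) * ln (real n)))" .
  qed simp
  have "measure_pmf.prob J (\<Union>i\<in>{..<n}. T1 i) \<le> real (card {..<n}) * exp (- (\<delta> / 2 * M))"
    by (rule prob_UN_le) (use p1 in auto)
  moreover have "measure_pmf.prob J (\<Union>i\<in>{..<n}. T2 i) \<le> real (card {..<n}) * exp (- ((1 + \<epsilon> / 2) * ln (real n)))"
    by (rule prob_UN_le) (use p2 in auto)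
  moreover have "measure_pmf.prob J (T0 \<union> ((\<Union>i\<in>{..<n}. T1 i) \<union> (\<Union>i\<in>{..<n}. T2 i))) \<le>
      measure_pmf.prob J T0 + (measure_pmf.prob J (\<Union>i\<in>{..<n}. T1 i) + measure_pmf.prob J (\<Union>i\<in>{..<n}. T2 i))"
    by (intro order.trans[OF measure_Un_le] add_left_mono measure_Un_le) auto
  moreover have "measure_pmf.prob (map_pmf out J) {\<Phi>. err n g \<Phi> = 0} = 1 - measure_pmf.prob J {x. err n g (out x) \<noteq> 0}"
    by (subst measure_pmf.prob_compl[symmetric]) (auto simp: measure_map_pmf vimage_def Diff_eq intro!: arg_cong[of _ _ "measure_pmf.prob J"])
  ultimately show ?thesis unfolding run p0[symmetric] using sub by simp
qed

section \<open>The threshold\<close>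

text \<open>
  In the scaling of the theorem \<open>Q / n\<close> tends to infinity, and both terms tend to \<open>0\<close>.
\<close>

lemma not_typical_prob:
  fixes p :: "nat set \<Rightarrow> real"
  assumes p: "\<And>e. e \<in> edges n d \<Longrightarrow> 0 \<le> p e \<and> p e \<le> \<rho>" and \<rho>: "\<rho> \<le> 1" and d: "2 \<le> d" and n: "2 \<le> n"
    and Q: "Q = real (n choose d) * \<rho>" and \<mu>: "0 < \<mu>" "\<mu> \<le> 1" and \<kappa>: "0 < \<kappa>"
    and \<sigma>: "0 < \<sigma>" "\<sigma> \<le> exp (- 1)" "2 * (real d)\<^sup>2 * sqrt \<sigma> \<le> \<kappa> / 4"
    and big: "12 \<le> \<kappa> * (Q / real n)"
  shows "measure_pmf.prob (Pi_pmf (edges n d) False (\<lambda>e. bernoulli_pmf (p e))) {f. \<not> typical n d p Q \<mu> \<kappa> \<sigma> f}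
    \<le> 4 ^ n * exp (- (\<mu>\<^sup>2 * Q / (4 * real d ^ 4))) + 2 * exp (2 - \<kappa> * (Q / real n) / 4)"
proof -
  let ?M = "Pi_pmf (edges n d) False (\<lambda>e. bernoulli_pmf (p e))"
  let ?S = "{f. \<exists>s t. (\<forall>i. s i \<in> {-1, 1}) \<and> (\<forall>i. t i \<in> {-1, 1}) \<and>
        \<mu> * Q < \<bar>\<Sum>e\<in>edges n d. sign_sum s t e * (of_bool (f e) - p e)\<bar>}"
  let ?T = "{f. \<exists>U\<subseteq>{..<n}. 1 \<le> card U \<and> real (card U) \<le> \<sigma> * real n \<and>
         \<kappa> * (Q / real n) * real (card U) \<le> real (card (inner_edges n d f U))}"
  have sum_p: "(\<Sum>e\<in>edges n d. p e) \<le> Q"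
  proof -
    have "(\<Sum>e\<in>edges n d. p e) \<le> (\<Sum>e\<in>edges n d. \<rho>)" using p by (intro sum_mono) auto
    then show ?thesis by (simp add: card_edges Q)
  qed
  have p1: "0 \<le> p e \<and> p e \<le> 1" if "e \<in> edges n d" for e using p[OF that] \<rho> by auto
  have "{f. \<not> typical n d p Q \<mu> \<kappa> \<sigma> f} \<subseteq> ?S \<union> ?T"
    unfolding typical_def by (auto simp: not_le not_less)
  then have "measure_pmf.prob ?M {f. \<not> typical n d p Q \<mu> \<kappa> \<sigma> f} \<le> measure_pmf.prob ?M (?S \<union> ?T)"
    by (intro measure_pmf.finite_measure_mono) auto
  also have "\<dots> \<le> measure_pmf.prob ?M ?S + measure_pmf.prob ?M ?T"
    by (rule measure_Un_le) auto
  also have "\<dots> \<le> 4 ^ n * exp (- (\<mu>\<^sup>2 * Q / (4 * real d ^ 4))) + 2 * exp (2 - \<kappa> * (Q / real n) / 4)"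
    using d by (intro add_mono cut_deviation_prob[OF p1 _ \<mu> sum_p] sparse_prob[OF p \<rho> d n _ \<kappa> \<sigma> big]) (auto simp: Q)
  finally show ?thesis .
qed

lemma hidden_partitions_fraction:
  assumes "hidden_partitions \<Psi>"
  obtains \<gamma> :: real where "0 < \<gamma>" "\<gamma> \<le> 1"
    "\<forall>\<^sub>F n in sequentially. \<forall>b\<in>{0, 1}. \<gamma> * real n \<le> real (card {i\<in>{..<n}. \<Psi> n i = b})"
proof -
  have "\<exists>c>0. \<forall>\<^sub>F n in sequentially. c * real n \<le> real (card {i\<in>{..<n}. \<Psi> n i = b})" if b: "b \<in> {0, 1}" for b
  proof -
    have "(\<lambda>n. real (card {i\<in>{..<n}. \<Psi> n i = b})) \<in> \<Omega>(\<lambda>n. real n)"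
      using assms b unfolding hidden_partitions_def by (intro bigthetaD2) blast
    then show ?thesis by (elim landau_omega.bigE) auto
  qed
  then obtain c0 c1 where c: "0 < c0" "\<forall>\<^sub>F n in sequentially. c0 * real n \<le> real (card {i\<in>{..<n}. \<Psi> n i = 0})"
      "0 < c1" "\<forall>\<^sub>F n in sequentially. c1 * real n \<le> real (card {i\<in>{..<n}. \<Psi> n i = 1})" by blast
  define \<gamma> where "\<gamma> = min 1 (min c0 c1)"
  have "\<forall>\<^sub>F n in sequentially. \<forall>b\<in>{0, 1}. \<gamma> * real n \<le> real (card {i\<in>{..<n}. \<Psi> n i = b})"
    using c(2,4)
  proof eventually_elim
    case (elim n)
    have "\<gamma> * real n \<le> c0 * real n" "\<gamma> * real n \<le> c1 * real n" by (auto simp: \<gamma>_def intro!: mult_right_mono)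
    then show ?case using elim by auto
  qed
  moreover have "0 < \<gamma>" "\<gamma> \<le> 1" using c by (auto simp: \<gamma>_def)
  ultimately show thesis using that by blast
qed

lemma degree_ge_linear:
  assumes "2 \<le> d" "d \<le> n"
  shows "(real n - 1) / real d \<le> real ((n - 1) choose (d - 1))"
proof -
  have "(real n - 1) / real d \<le> real (n - 1) / real (d - 1)" using assms by (intro frac_le) auto
  also have "\<dots> = (real (n - 1) / real (d - 1)) ^ 1" by simp
  also have "\<dots> \<le> (real (n - 1) / real (d - 1)) ^ (d - 1)"
    using assms by (intro power_increasing) (auto simp: le_divide_eq)
  also have "\<dots> \<le> real ((n - 1) choose (d - 1))"
    using assms by (intro binomial_ge_n_over_k_pow_k) auto
  finally show ?thesis .
qed

theorem theorem3:
  fixes d :: nat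
  assumes "d \<ge> 2"
  shows "\<exists>c_thr>0. \<forall>(\<theta>::real) (\<epsilon>::real) (\<epsilon>'::real) (\<alpha> :: nat \<Rightarrow> real) (\<Psi> :: nat \<Rightarrow> nat \<Rightarrow> nat) hsc.
    0 < \<theta> \<longrightarrow> \<theta> < 1 / 2 \<longrightarrow> \<epsilon> > 0 \<longrightarrow> \<epsilon>' > 0 \<longrightarrow>
    (\<forall>n. 0 \<le> \<alpha> n \<and> \<alpha> n \<le> 1) \<longrightarrow>
    hidden_partitions \<Psi> \<longrightarrow>
    hsc_implementation d c_thr \<epsilon>' 2 hsc \<longrightarrow>
    (\<forall>\<^sub>F n in sequentially.
       real (n choose d) * \<alpha> n \<ge>
         (1 + \<epsilon>) * (2 ^ (d - 2) / real d) *
         (real n * ln (real n) / (sqrt (1 - \<theta>) - sqrt \<theta>)\<^sup>2)) \<longrightarrow>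
    strongly_consistent d \<theta> \<alpha> \<Psi> (hsclr hsc d)"
proof (intro exI[of _ "2 ^ (d + 3)"] conjI allI impI)
  fix \<theta> \<epsilon> \<epsilon>' :: real and \<alpha> :: "nat \<Rightarrow> real" and \<Psi> :: "nat \<Rightarrow> nat \<Rightarrow> nat"
    and hsc :: "nat \<Rightarrow> nat set set \<Rightarrow> (nat set \<Rightarrow> real) \<Rightarrow> nat \<Rightarrow> nat"
  assume \<theta>: "0 < \<theta>" "\<theta> < 1 / 2" and \<epsilon>: "0 < \<epsilon>" and \<epsilon>': "0 < \<epsilon>'"
    and \<alpha>: "\<forall>n. 0 \<le> \<alpha> n \<and> \<alpha> n \<le> 1" and part: "hidden_partitions \<Psi>"
    and impl: "hsc_implementation d (2 ^ (d + 3)) \<epsilon>' 2 hsc"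
    and rate: "\<forall>\<^sub>F n in sequentially.
       real (n choose d) * \<alpha> n \<ge>
         (1 + \<epsilon>) * (2 ^ (d - 2) / real d) *
         (real n * ln (real n) / (sqrt (1 - \<theta>) - sqrt \<theta>)\<^sup>2)"
  define q where "q = (sqrt (1 - \<theta>) - sqrt \<theta>)\<^sup>2"
  define r where "r = sqrt ((1 - \<theta>) / \<theta>)"
  define L :: real where "L = 2 * (1 / 2) ^ (d - 1)"
  have q: "0 < q"
  proof -
    have "sqrt \<theta> < sqrt (1 - \<theta>)" using \<theta> by simp
    then show ?thesis by (simp add: q_def)
  qed
  have r: "0 < r" using \<theta> by (simp add: r_def)
  have L: "0 < L" by (simp add: L_def)
  have L2: "L * 2 ^ (d - 2) = 1"
  proof -
    have "d - 1 = Suc (d - 2)" using assms by simp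
    then show ?thesis by (simp add: L_def power_divide)
  qed
  define s where "s = q * (L + 1 + 2 * real d) + 2 * real d * r"
  have s: "0 < s" unfolding s_def using q r L by (intro add_pos_nonneg) auto
  \<comment> \<open>the largest \<open>\<delta>\<close> admitted by \<open>refine_failure_small\<close>\<close>
  define \<delta> where "\<delta> = q * L * (\<epsilon> / 2 / (1 + \<epsilon>)) / s"
  have \<delta>: "0 < \<delta>" "\<delta> * (q * (L + 1 + 2 * real d) + 2 * real d * r) \<le> q * L * (\<epsilon> / 2 / (1 + \<epsilon>))"
    using q L \<epsilon> s unfolding s_def[symmetric] by (auto simp: \<delta>_def)
  obtain \<gamma> where \<gamma>: "0 < \<gamma>" "\<gamma> \<le> 1"
    and sizes: "\<forall>\<^sub>F n in sequentially. \<forall>b\<in>{0, 1}. \<gamma> * real n \<le> real (card {i\<in>{..<n}. \<Psi> n i = b})"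
    using hidden_partitions_fraction[OF part] by blast
  obtain \<mu> \<kappa> \<sigma> n0 where par: "0 < \<mu>" "\<mu> \<le> 1" "0 < \<kappa>" "0 < \<sigma>" "\<sigma> \<le> exp (- 1)"
      "2 * (real d)\<^sup>2 * sqrt \<sigma> \<le> \<kappa> / 4"
    and suff: "typicality_suffices d \<theta> \<gamma> \<delta> \<epsilon>' \<mu> \<kappa> \<sigma> n0"
    using typical_recovers[OF assms \<theta> \<gamma> \<delta>(1) \<epsilon>'] by blast
  define \<beta> where "\<beta> n = ln (ln (real n)) / ln (real n)" for n :: nat
  define c where "c = (1 + \<epsilon>) * (2 ^ (d - 2) / real d) / q"
  have c: "0 < c" using \<epsilon> q assms by (simp add: c_def)
  define success where "success n = measure_pmf.prob (bind_pmf (gcbm n d \<theta> (\<alpha> n) (\<Psi> n)) (hsclr hsc d n))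
    {\<Phi>. err n (\<Psi> n) \<Phi> = 0}" for n
  define fail where "fail n = exp (- real n) + 2 * exp (2 - \<kappa> * (c * ln (ln (real n))) / 4)
    + real n * exp (- (\<delta> / 2 * ((real n - 1) / real d))) + exp (- (\<epsilon> / 2 * ln (real n)))" for n :: nat
  \<comment> \<open>the threshold makes the expected degree in the first part of the split diverge\<close>
  have "filterlim (\<lambda>n::nat. c * ln (ln (real n))) at_top sequentially" using c by real_asymp
  then have "\<forall>\<^sub>F n::nat in sequentially. max (12 / \<kappa>) (12 * real d ^ 4 / \<mu>\<^sup>2) \<le> c * ln (ln (real n))"
    by (rule filterlim_at_top[THEN iffD1, rule_format])
  moreover have "\<forall>\<^sub>F n::nat in sequentially. 0 < ln (ln (real n))" by real_asymp
  moreover have "\<forall>\<^sub>F n in sequentially. 4 * \<beta> n < \<delta> \<and> \<beta> n < 1"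
  proof -
    have "\<beta> \<longlonglongrightarrow> 0" unfolding \<beta>_def by real_asymp
    then have "\<forall>\<^sub>F n in sequentially. \<beta> n < min (\<delta> / 4) 1" using \<delta>(1) by (intro order_tendstoD) auto
    then show ?thesis by eventually_elim auto
  qed
  moreover have "\<forall>\<^sub>F n::nat in sequentially. max (max (real n0) (2 * real d + 3)) (1 + 2 * (real d)\<^sup>2 / \<delta>) \<le> real n"
    by (rule filterlim_at_top[THEN iffD1, rule_format, OF filterlim_real_sequentially])
  ultimately have "\<forall>\<^sub>F n in sequentially. 1 - fail n \<le> success n"
    using rate sizes
  proof eventually_elim
    case (elim n)
    have n_big: "n0 \<le> n" "2 * d + 3 \<le> n" "1 + 2 * (real d)\<^sup>2 / \<delta> \<le> real n"
    proof -
      have "real n0 \<le> real n" "real (2 * d + 3) \<le> real n" using elim(4) by auto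
      then show "n0 \<le> n" "2 * d + 3 \<le> n" unfolding of_nat_le_iff by auto
      show "1 + 2 * (real d)\<^sup>2 / \<delta> \<le> real n" using elim(4) by simp
    qed
    have n: "2 \<le> n" "d \<le> n" "0 < real n" "0 < ln (real n)" using n_big by auto
    have "0 < \<beta> n" using elim(2) n by (simp add: \<beta>_def)
    then have \<beta>: "0 < \<beta> n" "\<beta> n \<le> 1" "4 * \<beta> n \<le> \<delta>" using elim(3) by auto
    define \<rho> where "\<rho> = \<beta> n * \<alpha> n"
    define Q where "Q = real (n choose d) * \<rho>"
    define M where "M = real ((n - 1) choose (d - 1))"
    have rate_n: "c * (real n * ln (real n)) \<le> real (n choose d) * \<alpha> n"
      using elim(5) by (simp add: c_def q_def)
    have \<alpha>n: "0 < \<alpha> n" "\<alpha> n \<le> 1"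
    proof -
      have "0 < c * (real n * ln (real n))" using c n by simp
      then have "0 < real (n choose d) * \<alpha> n" using rate_n by linarith
      then show "0 < \<alpha> n" by (simp add: zero_less_mult_iff)
    qed (use \<alpha> in auto)
    have \<rho>: "0 < \<rho>" "\<rho> \<le> 1" using \<beta> \<alpha>n by (auto simp: \<rho>_def intro: mult_le_one)
    have D: "c * ln (ln (real n)) \<le> Q / real n"
    proof -
      have "c * ln (ln (real n)) * real n = c * (real n * ln (real n)) * \<beta> n" using n by (simp add: \<beta>_def)
      also have "\<dots> \<le> real (n choose d) * \<alpha> n * \<beta> n"
        using rate_n \<beta> by (intro mult_right_mono) auto
      also have "\<dots> = Q" by (simp add: Q_def \<rho>_def)
      finally show ?thesis by (simp only: pos_le_divide_eq[OF n(3)])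
    qed
    have aM: "(1 + \<epsilon>) * ln (real n) \<le> L * q * (\<alpha> n * M)"
    proof -
      have absorb: "real d * real (n choose d) = real n * M"
        using times_binomial_minus1_eq[of d n] assms unfolding M_def by (metis of_nat_mult not_gr_zero not_numeral_le_zero)
      have "real d * (c * (real n * ln (real n))) \<le> real d * (real (n choose d) * \<alpha> n)"
        using rate_n by (intro mult_left_mono) auto
      also have "\<dots> = real n * (M * \<alpha> n)" using absorb by (metis mult.assoc)
      finally have deg: "real d * c * ln (real n) \<le> M * \<alpha> n" using n by (simp add: mult_ac)
      have "(1 + \<epsilon>) * ln (real n) = (L * 2 ^ (d - 2)) * ((1 + \<epsilon>) * ln (real n))" by (simp only: L2 mult_1_left)
      also have "\<dots> = (L * q) * (real d * c * ln (real n))"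
        using q assms by (simp add: c_def)
      also have "\<dots> \<le> (L * q) * (M * \<alpha> n)" using L q deg by (intro mult_left_mono) auto
      finally show ?thesis by (simp only: mult.commute)
    qed
    define G where "G f \<longleftrightarrow> typical n d (edge_mean \<rho> \<theta> (\<Psi> n)) Q \<mu> \<kappa> \<sigma> f" for f
    have g: "\<Psi> n i \<in> {0, 1}" if "i < n" for i using part that unfolding hidden_partitions_def by blast
    define P0 where "P0 = measure_pmf.prob (Pi_pmf (edges n d) False
        (\<lambda>e. bernoulli_pmf (edge_mean \<rho> \<theta> (\<Psi> n) e))) {f. \<not> G f}"
    have "1 - (P0 + real n * exp (- (\<delta> / 2 * M)) + real n * exp (- ((1 + \<epsilon> / 2) * ln (real n)))) \<le> success n"
      unfolding success_def P0_def \<rho>_def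
    proof (rule hsclr_success_prob[OF assms g \<theta> _ _ \<epsilon> \<beta>_def _ _ \<beta>(3) q_def r_def L_def \<delta> M_def aM _ _ n(1) impl])
      show "2 * real (d - 1) \<le> real (n - 1)" using n_big(2) by linarith
      have "2 * (real (d - 1))\<^sup>2 \<le> 2 * (real d)\<^sup>2" by (intro mult_left_mono power_mono) auto
      also have "\<dots> \<le> \<delta> * (real n - 1)"
      proof -
        have "2 * (real d)\<^sup>2 / \<delta> \<le> real n - 1" using n_big(3) by simp
        then show ?thesis using \<delta>(1) by (simp add: divide_le_eq mult.commute)
      qed
      also have "real n - 1 = real (n - 1)" using n by simp
      finally show "2 * (real (d - 1))\<^sup>2 \<le> \<delta> * real (n - 1)" .
      fix f E w \<Phi>
      assume "G f" "E \<subseteq> edges n d" "\<And>e. e \<in> edges n d \<Longrightarrow> (if e \<in> E then w e else 0) = of_bool (f e)"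
        "hsc_output (2 ^ (d + 3)) \<epsilon>' 2 n E w \<Phi>"
      then show "\<exists>\<pi>. \<pi> permutes {0, 1::nat} \<and> real (card (misplaced n (\<Psi> n) \<pi> \<Phi>)) \<le> \<delta> * real n"
        using suff elim(6) g n_big(1) \<rho> unfolding typicality_suffices_def G_def Q_def by blast
    qed (use \<alpha>n \<beta> in auto)
    moreover have "P0 \<le> exp (- real n) + 2 * exp (2 - \<kappa> * (c * ln (ln (real n))) / 4)"
    proof -
      have p\<rho>: "0 \<le> edge_mean \<rho> \<theta> (\<Psi> n) e \<and> edge_mean \<rho> \<theta> (\<Psi> n) e \<le> \<rho>" for e
        using \<theta> \<rho> by (auto intro: mult_left_le)
      have "12 / \<kappa> \<le> Q / real n" "12 * real d ^ 4 / \<mu>\<^sup>2 \<le> Q / real n" using elim(1) D by auto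
      then have big: "12 \<le> \<kappa> * (Q / real n)" "12 * real d ^ 4 \<le> \<mu>\<^sup>2 * (Q / real n)"
        using par by (auto simp: divide_le_eq mult.commute)
      have "P0 \<le> 4 ^ n * exp (- (\<mu>\<^sup>2 * Q / (4 * real d ^ 4))) + 2 * exp (2 - \<kappa> * (Q / real n) / 4)"
        unfolding P0_def G_def
        by (rule not_typical_prob[OF p\<rho> \<rho>(2) assms n(1) Q_def par(1-6) big(1)])
      also have "\<dots> \<le> exp (- real n) + 2 * exp (2 - \<kappa> * (c * ln (ln (real n))) / 4)"
      proof (rule add_mono)
        have "4 ^ n \<le> exp (2 * real n)"
        proof -
          have "2 \<le> exp (1::real)" using exp_ge_add_one_self[of 1] by simp
          then have "2 * 2 \<le> exp 1 * exp (1::real)" by (intro mult_mono) auto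
          then have "4 \<le> exp (2::real)" by (simp add: exp_add[symmetric])
          then have "4 ^ n \<le> exp (2::real) ^ n" by (intro power_mono) auto
          then show ?thesis by (simp add: exp_of_nat_mult[symmetric] mult.commute)
        qed
        moreover have "3 * real n \<le> \<mu>\<^sup>2 * Q / (4 * real d ^ 4)"
          using big(2) n assms by (simp add: field_simps)
        ultimately have "4 ^ n * exp (- (\<mu>\<^sup>2 * Q / (4 * real d ^ 4))) \<le> exp (2 * real n) * exp (- (3 * real n))"
          by (intro mult_mono) auto
        then show "4 ^ n * exp (- (\<mu>\<^sup>2 * Q / (4 * real d ^ 4))) \<le> exp (- real n)"
          by (simp add: exp_add[symmetric])
        have "\<kappa> * (c * ln (ln (real n))) \<le> \<kappa> * (Q / real n)" using D par by (intro mult_left_mono) auto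
        then show "2 * exp (2 - \<kappa> * (Q / real n) / 4) \<le> 2 * exp (2 - \<kappa> * (c * ln (ln (real n))) / 4)" by simp
      qed
      finally show ?thesis .
    qed
    moreover have "real n * exp (- (\<delta> / 2 * M)) \<le> real n * exp (- (\<delta> / 2 * ((real n - 1) / real d)))"
    proof -
      have "\<delta> / 2 * ((real n - 1) / real d) \<le> \<delta> / 2 * M"
        unfolding M_def using \<delta>(1) by (intro mult_left_mono degree_ge_linear assms n) auto
      then show ?thesis by (intro mult_left_mono) auto
    qed
    moreover have "real n * exp (- ((1 + \<epsilon> / 2) * ln (real n))) = exp (- (\<epsilon> / 2 * ln (real n)))"
    proof -
      have "real n * exp (- ((1 + \<epsilon> / 2) * ln (real n))) = exp (ln (real n)) * exp (- ((1 + \<epsilon> / 2) * ln (real n)))"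
        using n by simp
      also have "\<dots> = exp (- (\<epsilon> / 2 * ln (real n)))" unfolding exp_add[symmetric] by (simp add: algebra_simps)
      finally show ?thesis .
    qed
    ultimately show ?case unfolding fail_def by linarith
  qed
  moreover have "(\<lambda>n. 1 - fail n) \<longlonglongrightarrow> 1"
  proof -
    have "(\<lambda>n::nat. exp (- real n)) \<longlonglongrightarrow> 0" by real_asymp
    moreover have "(\<lambda>n::nat. 2 * exp (2 - k * ln (ln (real n)))) \<longlonglongrightarrow> 0" if "0 < k" for k :: real
      using that by real_asymp
    from this[of "\<kappa> * c / 4"] have "(\<lambda>n::nat. 2 * exp (2 - \<kappa> * (c * ln (ln (real n))) / 4)) \<longlonglongrightarrow> 0"
      using par c by (simp add: mult_ac)
    moreover have "(\<lambda>n::nat. real n * exp (- (k * (real n - 1)))) \<longlonglongrightarrow> 0" if "0 < k" for k :: real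
      using that by real_asymp
    from this[of "\<delta> / 2 / real d"] have "(\<lambda>n::nat. real n * exp (- (\<delta> / 2 * ((real n - 1) / real d)))) \<longlonglongrightarrow> 0"
      using \<delta>(1) assms by simp
    moreover have "(\<lambda>n::nat. exp (- (k * ln (real n)))) \<longlonglongrightarrow> 0" if "0 < k" for k :: real
      using that by real_asymp
    from this[of "\<epsilon> / 2"] have "(\<lambda>n::nat. exp (- (\<epsilon> / 2 * ln (real n)))) \<longlonglongrightarrow> 0" using \<epsilon> by simp
    ultimately have "fail \<longlonglongrightarrow> 0 + 0 + 0 + 0" unfolding fail_def by (intro tendsto_add)
    from tendsto_diff[OF tendsto_const[of 1] this] show ?thesis by simp
  qed
  ultimately have "success \<longlonglongrightarrow> 1"
    by (intro tendsto_sandwich[of "\<lambda>n. 1 - fail n" success sequentially "\<lambda>_. 1" 1]) (auto simp: success_def)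
  then show "strongly_consistent d \<theta> \<alpha> \<Psi> (hsclr hsc d)"
    unfolding strongly_consistent_def success_def .
qed simp

end
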